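(* Let $(L,R,\eta,\epsilon)$ be an adjunction with $R:\mathcal{A}\to\mathcal{B}$, $(L',R',\eta',\epsilon')$ an adjunction with $R':\mathcal{A}'\to\mathcal{B}$, and $F:\mathcal{A}\to\mathcal{A}'$ a functor with $F\circ L=L'$. Assume that: (1) $\mathcal{A}$ has all coequalizers and $F$ preserves them; (2) $R'$ preserves coequalizers of pairs $(fe,f)$ where $f$ is a composition of regular epimorphisms and $e$ is an idempotent morphism; (3) $R'$ preserves regular epimorphisms; (4) the monad $R'L'$ has an augmentation $\gamma':R'L'\to\mathrm{Id}_{\mathcal{B}}$. Let $\Gamma_{[n]}:\mathcal{B}\to\mathcal{B}_{[n]}$ and $\gamma_{[n]}:RL_{[n]}\Gamma_{[n]}\to\mathrm{Id}_{\mathcal{B}}$ be as in the context. Then, for every $n\in\mathbb{N}$, the functor $\Gamma_{[n]}$ induces a functor $\Gamma_n:\mathcal{B}\to\mathcal{B}_n$ into the $n$-th category of the monadic tower of $(L,R)$ such that $\Lambda_n\circ\Gamma_n=\Gamma_{[n]}$ and $U_{n,n+1}\circ\Gamma_{n+1}=\Gamma_n$. Moreover there is $\gamma_n:R_nL_n\Gamma_n\to\Gamma_n$ such that $\Gamma_{n+1}B=(\Gamma_nB,\gamma_nB)$ for all $B\in\mathcal{B}$, and $U_n\gamma_n\circ R\lambda_n\Gamma_n=\gamma_{[n]}$. Also, $\lambda_n\Gamma_n:L_{[n]}\Gamma_{[n]}=L_{[n]}\Lambda_n\Gamma_n\to L_n\Gamma_n$ is invertible.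
   Context: Whiskering of a natural transformation by functors is written $F\alpha$, $\alpha G$. Coequalizers in $\mathcal{A}$ are fixed once and for all. An augmentation for a monad $(M,m,u)$ is a natural transformation $\gamma:M\to\mathrm{Id}$ with $\gamma\circ u=\mathrm{Id}$ and $\gamma\gamma=\gamma\circ m$. Adjoint decomposition of $(L,R,\eta,\epsilon)$. Define recursively categories $\mathcal{B}_{[n]}$, functors $U_{[n]}:\mathcal{B}_{[n]}\to\mathcal{B}$, adjunctions $(L_{[n]},R_{[n]},\eta_{[n]},\epsilon_{[n]})$ with $R_{[n]}:\mathcal{A}\to\mathcal{B}_{[n]}$ and $U_{[n]}R_{[n]}=R$, and natural transformations $\pi_{[n]}:LU_{[n]}\to L_{[n]}$. For $n=0$: $\mathcal{B}_{[0]}=\mathcal{B}$, $U_{[0]}=\mathrm{Id}$, $(L_{[0]},R_{[0]},\eta_{[0]},\epsilon_{[0]})=(L,R,\eta,\epsilon)$, $\pi_{[0]}=\mathrm{Id}_L$. Given stage $n$: - objects of $\mathcal{B}_{[n+1]}$ are pairs $(B_{[n]},b_{[n]})$ with $B_{[n]}\in\mathcal{B}_{[n]}$ and $b_{[n]}:RL_{[n]}B_{[n]}\to U_{[n]}B_{[n]}$ any morphism in $\mathcal{B}$; morphisms $(B_{[n]},b_{[n]})\to(B'_{[n]},b'_{[n]})$ are morphisms $f:B_{[n]}\to B'_{[n]}$ in $\mathcal{B}_{[n]}$ with $U_{[n]}f\circ b_{[n]}=b'_{[n]}\circ RL_{[n]}f$; $U_{[n,n+1]}:\mathcal{B}_{[n+1]}\to\mathcal{B}_{[n]}$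 is the forgetful functor and $U_{[n+1]}=U_{[n]}U_{[n,n+1]}$; - $R_{[n+1]}A=(R_{[n]}A,R\epsilon_{[n]}A)$, $R_{[n+1]}f=R_{[n]}f$; - $\pi_{[n,n+1]}B_{[n+1]}:L_{[n]}B_{[n]}\to L_{[n+1]}B_{[n+1]}$ is the coequalizer of $\pi_{[n]}B_{[n]}\circ Lb_{[n]}$ and $\epsilon L_{[n]}B_{[n]}$, both from $LRL_{[n]}B_{[n]}$ to $L_{[n]}B_{[n]}$, where $B_{[n+1]}=(B_{[n]},b_{[n]})$; $\pi_{[n+1]}=\pi_{[n,n+1]}\circ\pi_{[n]}U_{[n,n+1]}$; - the unit and counit of $(L_{[n+1]},R_{[n+1]})$ are determined by $U_{[n,n+1]}\eta_{[n+1]}=R_{[n]}\pi_{[n,n+1]}\circ\eta_{[n]}U_{[n,n+1]}$ and $\epsilon_{[n+1]}\circ\pi_{[n,n+1]}R_{[n+1]}=\epsilon_{[n]}$. Monadic tower of $(L,R)$. $\mathcal{B}_0=\mathcal{B}$, $(L_0,R_0,\eta_0,\epsilon_0)=(L,R,\eta,\epsilon)$. Given $(L_n,R_n,\eta_n,\epsilon_n)$ with $R_n:\mathcal{A}\to\mathcal{B}_n$: $\mathcal{B}_{n+1}$ is the Eilenberg-Moore category of the monad $(R_nL_n,R_n\epsilon_nL_n,\eta_n)$ on $\mathcal{B}_n$, $U_{n,n+1}:\mathcal{B}_{n+1}\to\mathcal{B}_n$ is the forgetful functor, $R_{n+1}:\mathcal{A}\to\mathcal{B}_{n+1}$, $A\mapsto(R_nA,R_n\epsilon_nA)$,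 is the comparison functor, and $L_{n+1}$ is its left adjoint, with $L_{n+1}(B_n,\mu_n)$ the coequalizer of $L_n\mu_n,\epsilon_nL_nB_n:L_nR_nL_nB_n\to L_nB_n$; unit and counit $\eta_{n+1},\epsilon_{n+1}$. $U_n:\mathcal{B}_n\to\mathcal{B}$ is the composite of forgetful functors. The functors $\Lambda_n:\mathcal{B}_n\to\mathcal{B}_{[n]}$ are defined recursively, together with natural isomorphisms $\lambda_n:=\epsilon_{[n]}L_n\circ L_{[n]}\Lambda_n\eta_n:L_{[n]}\Lambda_n\to L_n$ (one has $\Lambda_nR_n=R_{[n]}$): $\Lambda_0=\mathrm{Id}$, and $\Lambda_{n+1}(V_n,\mu_n)=(\Lambda_nV_n,\;U_n\mu_n\circ R\lambda_nV_n)$, $U_{[n,n+1]}\Lambda_{n+1}f=\Lambda_nU_{n,n+1}f$. Each $\Lambda_n$ is fully faithful and injective on objects. The functors $\Gamma_{[n]}$ and transformations $\gamma_{[n]}$ (well defined under assumptions (1)-(4)). Put $\xi:=R'F\epsilon\circ\eta'R:R\to R'F$. Let $\Gamma_{[0]}=\mathrm{Id}_{\mathcal{B}}$ and $\gamma'_{[0]}=\gamma'$. Recursively put $S_{[n]}:=L_{[n]}\Gamma_{[n]}$, $\gamma_{[n]}:=\gamma'_{[n]}\circ\xi S_{[n]}:RS_{[n]}\to\mathrm{Id}_{\mathcal{B}}$, $\Gamma_{[n+1]}B:=(\Gamma_{[n]}B,\gamma_{[n]}B)$ (with $U_{[n,n+1]}\Gamma_{[n+1]}=\Gamma_{[n]}$),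 and let $\gamma'_{[n+1]}:R'FS_{[n+1]}\to\mathrm{Id}_{\mathcal{B}}$ be the unique natural transformation with $\gamma'_{[n+1]}\circ R'F\pi_{[n,n+1]}\Gamma_{[n+1]}=\gamma'_{[n]}$. They satisfy $U_{[n]}\Gamma_{[n]}=\mathrm{Id}_{\mathcal{B}}$, $\gamma_{[n]}\circ U_{[n]}\eta_{[n]}\Gamma_{[n]}=\mathrm{Id}$ and $\gamma_{[n+1]}\circ R\pi_{[n,n+1]}\Gamma_{[n+1]}=\gamma_{[n]}$. *)

theory Defs
  imports "HOL-Library.FuncSet"
begin

section \<open>Categories, functors, natural transformations\<close>

text \<open>
  Categories are given by hom-sets, which need not be disjoint: the same arrow may lie in several
  hom-sets. Hence a functor takes the source and the target of an arrow as additional arguments.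
  In return, all categories of the two towers below share the arrows of the base category, and
  their forgetful functors act as the identity on arrows.
\<close>

record ('o, 'm) cat =
  Obj :: "'o set"
  Hom :: "'o \<Rightarrow> 'o \<Rightarrow> 'm set"
  Ide :: "'o \<Rightarrow> 'm"
  Comp :: "'m \<Rightarrow> 'm \<Rightarrow> 'm"  (infixr "\<cdot>\<index>" 70)

locale category =
  fixes C :: "('o, 'm) cat" (structure)
  assumes hom_dom: "f \<in> Hom C X Y \<Longrightarrow> X \<in> Obj C"
    and hom_cod: "f \<in> Hom C X Y \<Longrightarrow> Y \<in> Obj C"
    and ide_hom: "X \<in> Obj C \<Longrightarrow> Ide C X \<in> Hom C X X"
    and comp_hom: "f \<in> Hom C X Y \<Longrightarrow> g \<in> Hom C Y Z \<Longrightarrow> g \<cdot> f \<in> Hom C X Z"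
    and ide_left: "f \<in> Hom C X Y \<Longrightarrow> Ide C Y \<cdot> f = f"
    and ide_right: "f \<in> Hom C X Y \<Longrightarrow> f \<cdot> Ide C X = f"
    and comp_assoc: "f \<in> Hom C W X \<Longrightarrow> g \<in> Hom C X Y \<Longrightarrow> h \<in> Hom C Y Z
      \<Longrightarrow> (h \<cdot> g) \<cdot> f = h \<cdot> (g \<cdot> f)"

definition is_iso :: "('o, 'm) cat \<Rightarrow> 'o \<Rightarrow> 'o \<Rightarrow> 'm \<Rightarrow> bool" where
  "is_iso C X Y f \<longleftrightarrow> f \<in> Hom C X Y \<and>
     (\<exists>g \<in> Hom C Y X. g \<cdot>\<^bsub>C\<^esub> f = Ide C X \<and> f \<cdot>\<^bsub>C\<^esub> g = Ide C Y)"

record ('o, 'm, 'p, 'n) ftr =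
  ob :: "'o \<Rightarrow> 'p"
  ar :: "'o \<Rightarrow> 'o \<Rightarrow> 'm \<Rightarrow> 'n"

locale is_functor = C: category C + D: category D
  for C :: "('o, 'm) cat" and D :: "('p, 'n) cat" +
  fixes F :: "('o, 'm, 'p, 'n) ftr"
  assumes ob_obj: "X \<in> Obj C \<Longrightarrow> ob F X \<in> Obj D"
    and ar_hom: "f \<in> Hom C X Y \<Longrightarrow> ar F X Y f \<in> Hom D (ob F X) (ob F Y)"
    and ar_ide: "X \<in> Obj C \<Longrightarrow> ar F X X (Ide C X) = Ide D (ob F X)"
    and ar_comp: "f \<in> Hom C X Y \<Longrightarrow> g \<in> Hom C Y Z
      \<Longrightarrow> ar F X Z (g \<cdot>\<^bsub>C\<^esub> f) = ar F Y Z g \<cdot>\<^bsub>D\<^esub> ar F X Y f"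

definition ftr_id :: "('o, 'm, 'o, 'm) ftr" where
  "ftr_id = \<lparr> ob = \<lambda>X. X, ar = \<lambda>X Y f. f \<rparr>"

definition ftr_comp ::
  "('p, 'n, 'q, 'l) ftr \<Rightarrow> ('o, 'm, 'p, 'n) ftr \<Rightarrow> ('o, 'm, 'q, 'l) ftr"  (infixr "\<circ>\<^sub>F" 75) where
  "G \<circ>\<^sub>F F = \<lparr> ob = \<lambda>X. ob G (ob F X), ar = \<lambda>X Y f. ar G (ob F X) (ob F Y) (ar F X Y f) \<rparr>"

text \<open>Equality of functors on \<open>C\<close>; values outside \<open>C\<close> are irrelevant.\<close>

definition ftr_eq :: "('o, 'm) cat \<Rightarrow> ('o, 'm, 'p, 'n) ftr \<Rightarrow> ('o, 'm, 'p, 'n) ftr \<Rightarrow> bool" where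
  "ftr_eq C F G \<longleftrightarrow> (\<forall>X \<in> Obj C. ob F X = ob G X) \<and>
     (\<forall>X Y. \<forall>f \<in> Hom C X Y. ar F X Y f = ar G X Y f)"

locale nat_trans = F: is_functor C D F + G: is_functor C D G
  for C :: "('o, 'm) cat" and D :: "('p, 'n) cat" and F G +
  fixes t :: "'o \<Rightarrow> 'n"
  assumes component: "X \<in> Obj C \<Longrightarrow> t X \<in> Hom D (ob F X) (ob G X)"
    and natural: "f \<in> Hom C X Y \<Longrightarrow> t Y \<cdot>\<^bsub>D\<^esub> ar F X Y f = ar G X Y f \<cdot>\<^bsub>D\<^esub> t X"

definition nat_iso :: "('o, 'm) cat \<Rightarrow> ('p, 'n) cat \<Rightarrow> ('o, 'm, 'p, 'n) ftr
    \<Rightarrow> ('o, 'm, 'p, 'n) ftr \<Rightarrow> ('o \<Rightarrow> 'n) \<Rightarrow> bool" where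
  "nat_iso C D F G t \<longleftrightarrow> nat_trans C D F G t \<and>
     (\<forall>X \<in> Obj C. is_iso D (ob F X) (ob G X) (t X))"


section \<open>Adjunctions, monads, augmentations\<close>

text \<open>
  Left adjoint, right adjoint, unit and counit. Arrows of the category \<open>A\<close> have type \<open>'k\<close>,
  those of \<open>B\<close> have type \<open>'m\<close>; the right adjoint goes from \<open>A\<close> to \<open>B\<close>.
\<close>

record ('a, 'k, 'o, 'm) adj =
  Lf :: "('o, 'm, 'a, 'k) ftr"
  Rf :: "('a, 'k, 'o, 'm) ftr"
  eta :: "'o \<Rightarrow> 'm"
  eps :: "'a \<Rightarrow> 'k"

definition adjunction ::
  "('a, 'k) cat \<Rightarrow> ('o, 'm) cat \<Rightarrow> ('a, 'k, 'o, 'm, 'z) adj_scheme \<Rightarrow> bool" where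
  "adjunction A B J \<longleftrightarrow>
     is_functor B A (Lf J) \<and> is_functor A B (Rf J) \<and>
     nat_trans B B ftr_id (Rf J \<circ>\<^sub>F Lf J) (eta J) \<and>
     nat_trans A A (Lf J \<circ>\<^sub>F Rf J) ftr_id (eps J) \<and>
     (\<forall>X \<in> Obj B. eps J (ob (Lf J) X) \<cdot>\<^bsub>A\<^esub>
        ar (Lf J) X (ob (Rf J) (ob (Lf J) X)) (eta J X) = Ide A (ob (Lf J) X)) \<and>
     (\<forall>Y \<in> Obj A. ar (Rf J) (ob (Lf J) (ob (Rf J) Y)) Y (eps J Y) \<cdot>\<^bsub>B\<^esub>
        eta J (ob (Rf J) Y) = Ide B (ob (Rf J) Y))"

record ('o, 'm) monad =
  Mf :: "('o, 'm, 'o, 'm) ftr"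
  mlt :: "'o \<Rightarrow> 'm"
  unt :: "'o \<Rightarrow> 'm"

definition monad_of :: "('a, 'k, 'o, 'm, 'z) adj_scheme \<Rightarrow> ('o, 'm) monad" where
  "monad_of J = \<lparr> Mf = Rf J \<circ>\<^sub>F Lf J,
     mlt = \<lambda>X. ar (Rf J) (ob (Lf J) (ob (Rf J) (ob (Lf J) X))) (ob (Lf J) X) (eps J (ob (Lf J) X)),
     unt = eta J \<rparr>"

text \<open>
  The horizontal composite of \<open>c\<close> with itself has the component \<open>c X \<cdot> M (c X)\<close> at \<open>X\<close>.
\<close>

definition augmentation :: "('o, 'm) cat \<Rightarrow> ('o, 'm) monad \<Rightarrow> ('o \<Rightarrow> 'm) \<Rightarrow> bool" where
  "augmentation C M c \<longleftrightarrow> nat_trans C C (Mf M) ftr_id c \<and>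
     (\<forall>X \<in> Obj C. c X \<cdot>\<^bsub>C\<^esub> unt M X = Ide C X) \<and>
     (\<forall>X \<in> Obj C. c X \<cdot>\<^bsub>C\<^esub> ar (Mf M) (ob (Mf M) X) X (c X) = c X \<cdot>\<^bsub>C\<^esub> mlt M X)"


section \<open>Coequalizers\<close>

definition is_coeq ::
  "('o, 'm) cat \<Rightarrow> 'o \<Rightarrow> 'o \<Rightarrow> 'm \<Rightarrow> 'm \<Rightarrow> 'o \<Rightarrow> 'm \<Rightarrow> bool" where
  "is_coeq C X Y f g Q q \<longleftrightarrow>
     f \<in> Hom C X Y \<and> g \<in> Hom C X Y \<and> q \<in> Hom C Y Q \<and> q \<cdot>\<^bsub>C\<^esub> f = q \<cdot>\<^bsub>C\<^esub> g \<and>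
     (\<forall>Z. \<forall>h \<in> Hom C Y Z. h \<cdot>\<^bsub>C\<^esub> f = h \<cdot>\<^bsub>C\<^esub> g \<longrightarrow> (\<exists>!k. k \<in> Hom C Q Z \<and> k \<cdot>\<^bsub>C\<^esub> q = h))"

definition has_coeqs :: "('o, 'm) cat \<Rightarrow> bool" where
  "has_coeqs C \<longleftrightarrow> (\<forall>X Y. \<forall>f \<in> Hom C X Y. \<forall>g \<in> Hom C X Y. \<exists>Q q. is_coeq C X Y f g Q q)"

text \<open>A fixed choice \<open>cq X Y f g = (Q, q)\<close> of coequalizers, wherever one exists.\<close>

type_synonym ('o, 'm) coeq_fun = "'o \<Rightarrow> 'o \<Rightarrow> 'm \<Rightarrow> 'm \<Rightarrow> 'o \<times> 'm"

definition coeq_choice :: "('o, 'm) cat \<Rightarrow> ('o, 'm) coeq_fun \<Rightarrow> bool" where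
  "coeq_choice C cq \<longleftrightarrow> (\<forall>X Y f g. (\<exists>Q q. is_coeq C X Y f g Q q) \<longrightarrow>
     is_coeq C X Y f g (fst (cq X Y f g)) (snd (cq X Y f g)))"

definition preserves_coeq :: "('o, 'm) cat \<Rightarrow> ('p, 'n) cat \<Rightarrow> ('o, 'm, 'p, 'n) ftr
    \<Rightarrow> 'o \<Rightarrow> 'o \<Rightarrow> 'm \<Rightarrow> 'm \<Rightarrow> bool" where
  "preserves_coeq C D F X Y f g \<longleftrightarrow> (\<forall>Q q. is_coeq C X Y f g Q q \<longrightarrow>
     is_coeq D (ob F X) (ob F Y) (ar F X Y f) (ar F X Y g) (ob F Q) (ar F Y Q q))"

definition regular_epi :: "('o, 'm) cat \<Rightarrow> 'o \<Rightarrow> 'o \<Rightarrow> 'm \<Rightarrow> bool" where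
  "regular_epi C Y Q q \<longleftrightarrow> (\<exists>X f g. is_coeq C X Y f g Q q)"

inductive regular_epi_composite :: "('o, 'm) cat \<Rightarrow> 'o \<Rightarrow> 'o \<Rightarrow> 'm \<Rightarrow> bool"
  for C :: "('o, 'm) cat" where
  single: "regular_epi C X Y f \<Longrightarrow> regular_epi_composite C X Y f"
| compose: "regular_epi_composite C X Y f \<Longrightarrow> regular_epi C Y Z g
    \<Longrightarrow> regular_epi_composite C X Z (g \<cdot>\<^bsub>C\<^esub> f)"

definition idempotent :: "('o, 'm) cat \<Rightarrow> 'o \<Rightarrow> 'm \<Rightarrow> bool" where
  "idempotent C X e \<longleftrightarrow> e \<in> Hom C X X \<and> e \<cdot>\<^bsub>C\<^esub> e = e"


section \<open>Common data of the two towers\<close>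

text \<open>
  The objects at stage \<open>n\<close> of either tower are iterated pairs
  \<open>Ext (\<dots> (Ext (Base X) b\<^sub>0) \<dots>) b\<^sub>n\<^sub>-\<^sub>1\<close>. The constructor \<open>Base\<close> is needed only to
  have one type for all stages: stage \<open>0\<close> is the category \<open>B\<close> with its objects tagged by \<open>Base\<close>.
\<close>

datatype ('o, 'm) tower_obj = Base 'o | Ext "('o, 'm) tower_obj" 'm

primrec base :: "('o, 'm) tower_obj \<Rightarrow> 'o" where
  "base (Base X) = X"
| "base (Ext X b) = base X"

primrec prev :: "('o, 'm) tower_obj \<Rightarrow> ('o, 'm) tower_obj" where
  "prev (Base X) = undefined"
| "prev (Ext X b) = X"

primrec str :: "('o, 'm) tower_obj \<Rightarrow> 'm" where
  "str (Base X) = undefined"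
| "str (Ext X b) = b"

definition forget :: "(('o, 'm) tower_obj, 'm, ('o, 'm) tower_obj, 'm) ftr" where
  "forget = \<lparr> ob = prev, ar = \<lambda>X Y f. f \<rparr>"

definition tag :: "('o, 'm, ('o, 'm) tower_obj, 'm) ftr" where
  "tag = \<lparr> ob = Base, ar = \<lambda>X Y f. f \<rparr>"

definition untag :: "(('o, 'm) tower_obj, 'm, 'o, 'm) ftr" where
  "untag = \<lparr> ob = base, ar = \<lambda>X Y f. f \<rparr>"

text \<open>
  A stage consists of an adjunction, the category \<open>Ct\<close> over which it lives, and the forgetful
  functor \<open>Ug\<close> from \<open>Ct\<close> to \<open>B\<close>. Stages of the adjoint decomposition have in addition
  the transformation \<open>pr\<close> from \<open>L Ug\<close> to the left adjoint of the stage
  (\<open>\<pi>\<^bsub>[n]\<^esub>\<close> in the literature).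
\<close>

record ('a, 'k, 'o, 'm) stage = "('a, 'k, ('o, 'm) tower_obj, 'm) adj" +
  Ct :: "(('o, 'm) tower_obj, 'm) cat"
  Ug :: "(('o, 'm) tower_obj, 'm, 'o, 'm) ftr"

record ('a, 'k, 'o, 'm) dec_stage = "('a, 'k, 'o, 'm) stage" +
  pr :: "('o, 'm) tower_obj \<Rightarrow> 'k"

definition tagged_cat :: "('o, 'm) cat \<Rightarrow> (('o, 'm) tower_obj, 'm) cat" where
  "tagged_cat B = \<lparr> Obj = Base ` Obj B,
     Hom = \<lambda>X Y. {f. \<exists>X' Y'. X = Base X' \<and> Y = Base Y' \<and> f \<in> Hom B X' Y'},
     Ide = \<lambda>X. Ide B (base X), Comp = Comp B \<rparr>"

text \<open>
  The passage from a stage \<open>S\<close> with adjunction \<open>(L\<^sub>S, R\<^sub>S, \<eta>\<^sub>S, \<epsilon>\<^sub>S)\<close> to the next one has the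
  same form in both towers. Let \<open>qu X\<close> be the chosen coequalizer
  \<open>p X : L\<^sub>S (prev X) \<rightarrow> L X\<close>, given as the pair \<open>(L X, p X)\<close>.
  Then the new left adjoint \<open>L\<close> is defined on arrows by \<open>L f \<cdot> p X = p Y \<cdot> L\<^sub>S f\<close>, and the new
  unit and counit by \<open>U \<eta> = R\<^sub>S p \<cdot> \<eta>\<^sub>S U\<close> and \<open>\<epsilon> \<cdot> p R = \<epsilon>\<^sub>S\<close>.
\<close>

definition next_L :: "('a, 'k) cat \<Rightarrow> ('a, 'k, 'o, 'm, 'z) stage_scheme
    \<Rightarrow> (('o, 'm) tower_obj \<Rightarrow> 'a \<times> 'k) \<Rightarrow> (('o, 'm) tower_obj, 'm, 'a, 'k) ftr" where
  "next_L A S qu = \<lparr> ob = \<lambda>X. fst (qu X),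
     ar = \<lambda>X Y f. THE k. k \<in> Hom A (fst (qu X)) (fst (qu Y)) \<and>
       k \<cdot>\<^bsub>A\<^esub> snd (qu X) = snd (qu Y) \<cdot>\<^bsub>A\<^esub> ar (Lf S) (prev X) (prev Y) f \<rparr>"

definition next_R :: "('a, 'k, 'o, 'm, 'z) stage_scheme \<Rightarrow> ('a \<Rightarrow> 'm)
    \<Rightarrow> ('a, 'k, ('o, 'm) tower_obj, 'm) ftr" where
  "next_R S b = \<lparr> ob = \<lambda>Y. Ext (ob (Rf S) Y) (b Y), ar = ar (Rf S) \<rparr>"

definition next_eta :: "('a, 'k, 'o, 'm, 'z) stage_scheme
    \<Rightarrow> (('o, 'm) tower_obj \<Rightarrow> 'a \<times> 'k) \<Rightarrow> ('o, 'm) tower_obj \<Rightarrow> 'm" where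
  "next_eta S qu = (\<lambda>X. ar (Rf S) (ob (Lf S) (prev X)) (fst (qu X)) (snd (qu X))
     \<cdot>\<^bsub>Ct S\<^esub> eta S (prev X))"

definition next_eps :: "('a, 'k) cat \<Rightarrow> ('a, 'k, 'o, 'm, 'z) stage_scheme
    \<Rightarrow> (('o, 'm) tower_obj \<Rightarrow> 'a \<times> 'k) \<Rightarrow> ('a \<Rightarrow> 'm) \<Rightarrow> 'a \<Rightarrow> 'k" where
  "next_eps A S qu b = (\<lambda>Y. THE e. e \<in> Hom A (fst (qu (ob (next_R S b) Y))) Y \<and>
     e \<cdot>\<^bsub>A\<^esub> snd (qu (ob (next_R S b) Y)) = eps S Y)"


section \<open>The adjoint decomposition\<close>

definition dec_cat :: "('o, 'm) cat \<Rightarrow> ('a, 'k, 'o, 'm) adj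
    \<Rightarrow> ('a, 'k, 'o, 'm, 'z) stage_scheme \<Rightarrow> (('o, 'm) tower_obj, 'm) cat" where
  "dec_cat B J S =
    (let objs = {Ext X b | X b. X \<in> Obj (Ct S) \<and>
           b \<in> Hom B (ob (Rf J) (ob (Lf S) X)) (ob (Ug S) X)}
     in \<lparr> Obj = objs,
       Hom = \<lambda>X Y. {f. X \<in> objs \<and> Y \<in> objs \<and> f \<in> Hom (Ct S) (prev X) (prev Y) \<and>
         ar (Ug S) (prev X) (prev Y) f \<cdot>\<^bsub>B\<^esub> str X =
         str Y \<cdot>\<^bsub>B\<^esub> ar (Rf J) (ob (Lf S) (prev X)) (ob (Lf S) (prev Y))
                      (ar (Lf S) (prev X) (prev Y) f)},
       Ide = \<lambda>X. Ide (Ct S) (prev X), Comp = Comp (Ct S) \<rparr>)"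

definition dec_coeq :: "('a, 'k) cat \<Rightarrow> ('a, 'k, 'o, 'm) adj \<Rightarrow> ('a, 'k) coeq_fun
    \<Rightarrow> ('a, 'k, 'o, 'm) dec_stage \<Rightarrow> ('o, 'm) tower_obj \<Rightarrow> 'a \<times> 'k" where
  "dec_coeq A J cq S X =
    (let Y = ob (Lf S) (prev X); RY = ob (Rf J) Y
     in cq (ob (Lf J) RY) Y
          (pr S (prev X) \<cdot>\<^bsub>A\<^esub> ar (Lf J) RY (ob (Ug S) (prev X)) (str X))
          (eps J Y))"

definition dec_struct :: "('a, 'k, 'o, 'm) adj \<Rightarrow> ('a, 'k, 'o, 'm, 'z) stage_scheme \<Rightarrow> 'a \<Rightarrow> 'm"
  where
  "dec_struct J S = (\<lambda>Y. ar (Rf J) (ob (Lf S) (ob (Rf S) Y)) Y (eps S Y))"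

primrec dec :: "('a, 'k) cat \<Rightarrow> ('o, 'm) cat \<Rightarrow> ('a, 'k, 'o, 'm) adj \<Rightarrow> ('a, 'k) coeq_fun
    \<Rightarrow> nat \<Rightarrow> ('a, 'k, 'o, 'm) dec_stage" where
  "dec A B J cq 0 =
    \<lparr> Lf = Lf J \<circ>\<^sub>F untag, Rf = tag \<circ>\<^sub>F Rf J, eta = \<lambda>X. eta J (base X), eps = eps J,
      Ct = tagged_cat B, Ug = untag, pr = \<lambda>X. Ide A (ob (Lf J) (base X)) \<rparr>"
| "dec A B J cq (Suc n) =
    (let S = dec A B J cq n; qu = dec_coeq A J cq S; b = dec_struct J S in
     \<lparr> Lf = next_L A S qu, Rf = next_R S b, eta = next_eta S qu, eps = next_eps A S qu b,
       Ct = dec_cat B J S, Ug = Ug S \<circ>\<^sub>F forget,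
       pr = \<lambda>X. snd (qu X) \<cdot>\<^bsub>A\<^esub> pr S (prev X) \<rparr>)"

text \<open>The component at an object of stage \<open>n + 1\<close> of the transformation from \<open>L\<^bsub>[n]\<^esub>\<close> to
  \<open>L\<^bsub>[n+1]\<^esub>\<close>.\<close>

definition dec_pi :: "('a, 'k) cat \<Rightarrow> ('o, 'm) cat \<Rightarrow> ('a, 'k, 'o, 'm) adj \<Rightarrow> ('a, 'k) coeq_fun
    \<Rightarrow> nat \<Rightarrow> ('o, 'm) tower_obj \<Rightarrow> 'k" where
  "dec_pi A B J cq n X = snd (dec_coeq A J cq (dec A B J cq n) X)"


section \<open>The monadic tower\<close>

definition em_cat :: "(('o, 'm) tower_obj, 'm) cat \<Rightarrow> (('o, 'm) tower_obj, 'm) monad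
    \<Rightarrow> (('o, 'm) tower_obj, 'm) cat" where
  "em_cat C M =
    (let objs = {Ext X u | X u. X \<in> Obj C \<and> u \<in> Hom C (ob (Mf M) X) X \<and>
           u \<cdot>\<^bsub>C\<^esub> unt M X = Ide C X \<and>
           u \<cdot>\<^bsub>C\<^esub> ar (Mf M) (ob (Mf M) X) X u = u \<cdot>\<^bsub>C\<^esub> mlt M X}
     in \<lparr> Obj = objs,
       Hom = \<lambda>X Y. {f. X \<in> objs \<and> Y \<in> objs \<and> f \<in> Hom C (prev X) (prev Y) \<and>
         f \<cdot>\<^bsub>C\<^esub> str X = str Y \<cdot>\<^bsub>C\<^esub> ar (Mf M) (prev X) (prev Y) f},
       Ide = \<lambda>X. Ide C (prev X), Comp = Comp C \<rparr>)"

definition mon_coeq :: "('a, 'k) coeq_fun \<Rightarrow> ('a, 'k, 'o, 'm) stage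
    \<Rightarrow> ('o, 'm) tower_obj \<Rightarrow> 'a \<times> 'k" where
  "mon_coeq cq S X =
    (let Y = ob (Lf S) (prev X); RY = ob (Rf S) Y
     in cq (ob (Lf S) RY) Y (ar (Lf S) RY (prev X) (str X)) (eps S Y))"

definition mon_struct :: "('a, 'k, 'o, 'm) stage \<Rightarrow> 'a \<Rightarrow> 'm" where
  "mon_struct S = (\<lambda>Y. ar (Rf S) (ob (Lf S) (ob (Rf S) Y)) Y (eps S Y))"

primrec mon :: "('a, 'k) cat \<Rightarrow> ('o, 'm) cat \<Rightarrow> ('a, 'k, 'o, 'm) adj \<Rightarrow> ('a, 'k) coeq_fun
    \<Rightarrow> nat \<Rightarrow> ('a, 'k, 'o, 'm) stage" where
  "mon A B J cq 0 =
    \<lparr> Lf = Lf J \<circ>\<^sub>F untag, Rf = tag \<circ>\<^sub>F Rf J, eta = \<lambda>X. eta J (base X), eps = eps J,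
      Ct = tagged_cat B, Ug = untag \<rparr>"
| "mon A B J cq (Suc n) =
    (let S = mon A B J cq n; qu = mon_coeq cq S; b = mon_struct S in
     \<lparr> Lf = next_L A S qu, Rf = next_R S b, eta = next_eta S qu, eps = next_eps A S qu b,
       Ct = em_cat (Ct S) (monad_of S), Ug = Ug S \<circ>\<^sub>F forget \<rparr>)"


section \<open>Comparison of the towers\<close>

text \<open>The component \<open>\<epsilon>\<^bsub>[n]\<^esub> L\<^sub>n V \<cdot> L\<^bsub>[n]\<^esub> \<Lambda>\<^sub>n \<eta>\<^sub>n V\<close>, for stages \<open>D\<close> of the
  adjoint decomposition and \<open>M\<close> of the monadic tower.\<close>

definition lam_of :: "('a, 'k) cat \<Rightarrow> ('a, 'k, 'o, 'm) dec_stage \<Rightarrow> ('a, 'k, 'o, 'm) stage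
    \<Rightarrow> (('o, 'm) tower_obj, 'm, ('o, 'm) tower_obj, 'm) ftr \<Rightarrow> ('o, 'm) tower_obj \<Rightarrow> 'k" where
  "lam_of A D M Lm V =
    (let RLV = ob (Rf M) (ob (Lf M) V)
     in eps D (ob (Lf M) V) \<cdot>\<^bsub>A\<^esub> ar (Lf D) (ob Lm V) (ob Lm RLV) (ar Lm V RLV (eta M V)))"

primrec Lam :: "('a, 'k) cat \<Rightarrow> ('o, 'm) cat \<Rightarrow> ('a, 'k, 'o, 'm) adj \<Rightarrow> ('a, 'k) coeq_fun
    \<Rightarrow> nat \<Rightarrow> (('o, 'm) tower_obj, 'm, ('o, 'm) tower_obj, 'm) ftr" where
  "Lam A B J cq 0 = ftr_id"
| "Lam A B J cq (Suc n) =
    (let D = dec A B J cq n; M = mon A B J cq n; Lm = Lam A B J cq n in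
     \<lparr> ob = \<lambda>X. let V = prev X; LV = ob (Lf M) V in
         Ext (ob Lm V)
           (ar (Ug M) (ob (Rf M) LV) V (str X) \<cdot>\<^bsub>B\<^esub>
            ar (Rf J) (ob (Lf D) (ob Lm V)) LV (lam_of A D M Lm V)),
       ar = \<lambda>X Y f. ar Lm (prev X) (prev Y) f \<rparr>)"

definition lam :: "('a, 'k) cat \<Rightarrow> ('o, 'm) cat \<Rightarrow> ('a, 'k, 'o, 'm) adj \<Rightarrow> ('a, 'k) coeq_fun
    \<Rightarrow> nat \<Rightarrow> ('o, 'm) tower_obj \<Rightarrow> 'k" where
  "lam A B J cq n = lam_of A (dec A B J cq n) (mon A B J cq n) (Lam A B J cq n)"


section \<open>The functors induced by an augmentation\<close>

text \<open>
  Here \<open>J\<close> is the adjunction between \<open>A\<close> and \<open>B\<close>, \<open>J'\<close> the one between \<open>A'\<close> and \<open>B\<close>, and \<open>F\<close> a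
  functor from \<open>A\<close> to \<open>A'\<close> with \<open>F L = L'\<close>; \<open>c'\<close> is the augmentation of \<open>R' L'\<close>.
\<close>

definition xi :: "('o, 'm) cat \<Rightarrow> ('a, 'k, 'o, 'm) adj \<Rightarrow> ('a2, 'k2, 'o, 'm) adj
    \<Rightarrow> ('a, 'k, 'a2, 'k2) ftr \<Rightarrow> 'a \<Rightarrow> 'm" where
  "xi B J J' F = (\<lambda>Y. ar (Rf J' \<circ>\<^sub>F F) (ob (Lf J) (ob (Rf J) Y)) Y (eps J Y)
     \<cdot>\<^bsub>B\<^esub> eta J' (ob (Rf J) Y))"

text \<open>
  \<open>Gam_aux \<dots> n\<close> is the pair of \<open>\<Gamma>\<^bsub>[n]\<^esub>\<close> and \<open>\<gamma>'\<^bsub>[n]\<^esub>\<close>. The latter is required to be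
  \<open>undefined\<close> outside the objects of \<open>B\<close>, so that the description as the unique natural
  transformation makes sense for a total function.
\<close>

primrec Gam_aux :: "('a, 'k) cat \<Rightarrow> ('o, 'm) cat \<Rightarrow> ('a, 'k, 'o, 'm) adj \<Rightarrow> ('a, 'k) coeq_fun
    \<Rightarrow> ('a2, 'k2, 'o, 'm) adj \<Rightarrow> ('a, 'k, 'a2, 'k2) ftr \<Rightarrow> ('o \<Rightarrow> 'm)
    \<Rightarrow> nat \<Rightarrow> ('o, 'm, ('o, 'm) tower_obj, 'm) ftr \<times> ('o \<Rightarrow> 'm)" where
  "Gam_aux A B J cq J' F c' 0 = (tag, c')"
| "Gam_aux A B J cq J' F c' (Suc n) =
    (let G = fst (Gam_aux A B J cq J' F c' n);
         g' = snd (Gam_aux A B J cq J' F c' n);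
         S = Lf (dec A B J cq n) \<circ>\<^sub>F G;
         g = (\<lambda>X. g' X \<cdot>\<^bsub>B\<^esub> xi B J J' F (ob S X));
         G1 = \<lparr> ob = \<lambda>X. Ext (ob G X) (g X), ar = ar G \<rparr>;
         S1 = Lf (dec A B J cq (Suc n)) \<circ>\<^sub>F G1
     in (G1, THE t. t \<in> extensional (Obj B) \<and>
               nat_trans B B (Rf J' \<circ>\<^sub>F F \<circ>\<^sub>F S1) ftr_id t \<and>
               (\<forall>X \<in> Obj B. t X \<cdot>\<^bsub>B\<^esub>
                  ar (Rf J' \<circ>\<^sub>F F) (ob S X) (ob S1 X) (dec_pi A B J cq n (ob G1 X)) = g' X)))"

definition Gam :: "('a, 'k) cat \<Rightarrow> ('o, 'm) cat \<Rightarrow> ('a, 'k, 'o, 'm) adj \<Rightarrow> ('a, 'k) coeq_fun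
    \<Rightarrow> ('a2, 'k2, 'o, 'm) adj \<Rightarrow> ('a, 'k, 'a2, 'k2) ftr \<Rightarrow> ('o \<Rightarrow> 'm)
    \<Rightarrow> nat \<Rightarrow> ('o, 'm, ('o, 'm) tower_obj, 'm) ftr" where
  "Gam A B J cq J' F c' n = fst (Gam_aux A B J cq J' F c' n)"

definition gam :: "('a, 'k) cat \<Rightarrow> ('o, 'm) cat \<Rightarrow> ('a, 'k, 'o, 'm) adj \<Rightarrow> ('a, 'k) coeq_fun
    \<Rightarrow> ('a2, 'k2, 'o, 'm) adj \<Rightarrow> ('a, 'k, 'a2, 'k2) ftr \<Rightarrow> ('o \<Rightarrow> 'm)
    \<Rightarrow> nat \<Rightarrow> 'o \<Rightarrow> 'm" where
  "gam A B J cq J' F c' n = (\<lambda>X. snd (Gam_aux A B J cq J' F c' n) X \<cdot>\<^bsub>B\<^esub>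
     xi B J J' F (ob (Lf (dec A B J cq n)) (ob (Gam A B J cq J' F c' n) X)))"

end

theory Submission
  imports Defs
begin

text \<open>
  All categories of both towers have arrows of \<open>B\<close> as their arrows, and the forgetful functors,
  \<open>\<Lambda>\<^sub>n\<close> and \<open>\<Gamma>\<^bsub>[n]\<^esub>\<close> do nothing to arrows. So the theorem is about equations between arrows of
  \<open>B\<close>, and about the hom-sets of the stages in which these arrows lie.

  The heart is one equation. Let \<open>S = L\<^bsub>[n]\<^esub> \<Gamma>\<^bsub>[n]\<^esub> X\<close>, let \<open>q : L X \<rightarrow> S\<close> be the composite of the
  coequalizers that lead from \<open>L X\<close> to \<open>S\<close>, and suppose that the augmentation \<open>\<gamma>'\<close>, called \<open>c'\<close>
  below, factors as \<open>\<gamma>'\<^sub>X = h \<cdot> R'F q\<close>; put \<open>\<gamma> = h \<cdot> \<xi>\<^sub>S\<close>. Then \<open>h \<cdot> R'F \<epsilon>\<^sub>S = \<gamma> \<cdot> \<gamma>'\<^bsub>R S\<^esub>\<close> (lemma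
  \<open>factors_aug_algebra\<close>). Indeed \<open>F \<epsilon>\<^sub>S = \<epsilon>'\<^bsub>F S\<^esub> \<cdot> L' \<xi>\<^sub>S\<close>, so it suffices that
  \<open>h \<cdot> R' \<epsilon>'\<^bsub>F S\<^esub> = h \<cdot> \<gamma>'\<^bsub>R'F S\<^esub>\<close>; and this may be checked after composition with the epimorphism
  \<open>R'L'R'F q\<close>, where it becomes the multiplication law of the augmentation at \<open>X\<close>.

  The equation is used twice. First, \<open>F\<close> maps the pair whose coequalizer is \<open>\<pi>\<^bsub>[n,n+1]\<^esub>\<close> to
  \<open>(f e, f)\<close>, where \<open>f = F \<epsilon>\<^sub>S\<close> and where \<open>e\<close> is the image under \<open>L'\<close> of the idempotent \<open>u \<gamma>\<close>, with
  the section \<open>u = R q \<cdot> \<eta>\<^sub>X\<close> of \<open>\<gamma>\<close>. Moreover \<open>f\<close> is a composite of regular epimorphisms, because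
  \<open>\<epsilon>\<^sub>S\<close> is the component of \<open>\<pi>\<^bsub>[n]\<^esub>\<close> at \<open>R\<^bsub>[n]\<^esub> S\<close> followed by the split epimorphism \<open>\<epsilon>\<^bsub>[n]\<^esub> S\<close>. So \<open>R'\<close>
  preserves the coequalizer of this pair, the equation says that \<open>h\<close> coequalizes its image, and the
  factorization \<open>h\<close> descends to the next stage: \<open>\<gamma>'\<^bsub>[n+1]\<^esub>\<close> exists (\<open>factors_aug_coeq\<close>,
  \<open>Gam_well_defined\<close>).

  Secondly, the equation gives \<open>\<gamma>\<^bsub>[m]\<^esub> \<cdot> R \<epsilon>\<^bsub>[k]\<^esub> = \<gamma>\<^bsub>[k]\<^esub> \<cdot> R L\<^bsub>[k]\<^esub> \<gamma>\<^bsub>[m]\<^esub>\<close> for \<open>k \<le> m\<close> (\<open>gam_square\<close>). For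
  \<open>k < m\<close> this says, step by step, that \<open>\<gamma>\<^bsub>[m]\<^esub>\<close> is a morphism of the stages \<open>1, \<dots>, m\<close> of the adjoint
  decomposition; for \<open>k = m\<close> it is the associativity law of an algebra over \<open>R\<^bsub>[m]\<^esub> L\<^bsub>[m]\<^esub>\<close>. As
  \<open>\<Lambda>\<^sub>n\<close> is fully faithful and \<open>\<lambda>\<^sub>n\<close> is invertible, \<open>\<gamma>\<^sub>n = \<gamma>\<^bsub>[n]\<^esub> \<cdot> R \<lambda>\<^sub>n\<^sup>-\<^sup>1\<close> is then a morphism of the
  monadic tower and an Eilenberg-Moore structure, and \<open>\<Gamma>\<^bsub>n+1\<^esub>\<close> is obtained by adjoining it to
  \<open>\<Gamma>\<^sub>n\<close> (\<open>mon_gam_hom\<close>, \<open>mon_gam_unit\<close>, \<open>mon_gam_mult\<close>).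
\<close>

section \<open>Epimorphisms and coequalizers\<close>

definition epi :: "('o, 'm) cat \<Rightarrow> 'o \<Rightarrow> 'o \<Rightarrow> 'm \<Rightarrow> bool" where
  "epi C X Y f \<longleftrightarrow> f \<in> Hom C X Y \<and>
     (\<forall>Z. \<forall>g \<in> Hom C Y Z. \<forall>h \<in> Hom C Y Z. g \<cdot>\<^bsub>C\<^esub> f = h \<cdot>\<^bsub>C\<^esub> f \<longrightarrow> g = h)"

lemma epi_hom: "epi C X Y f \<Longrightarrow> f \<in> Hom C X Y"
  by (simp add: epi_def)

lemma epi_cancel:
  "epi C X Y f \<Longrightarrow> g \<in> Hom C Y Z \<Longrightarrow> h \<in> Hom C Y Z \<Longrightarrow> g \<cdot>\<^bsub>C\<^esub> f = h \<cdot>\<^bsub>C\<^esub> f \<Longrightarrow> g = h"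
  by (auto simp: epi_def)

lemma is_coeq_hom:
  assumes "is_coeq C X Y f g Q q"
  shows "f \<in> Hom C X Y" and "g \<in> Hom C X Y" and "q \<in> Hom C Y Q"
  using assms by (auto simp: is_coeq_def)

lemma is_coeq_eq: "is_coeq C X Y f g Q q \<Longrightarrow> q \<cdot>\<^bsub>C\<^esub> f = q \<cdot>\<^bsub>C\<^esub> g"
  by (simp add: is_coeq_def)

lemma is_coeq_factor:
  assumes "is_coeq C X Y f g Q q" and "h \<in> Hom C Y Z" and "h \<cdot>\<^bsub>C\<^esub> f = h \<cdot>\<^bsub>C\<^esub> g"
  obtains k where "k \<in> Hom C Q Z" and "k \<cdot>\<^bsub>C\<^esub> q = h"
  using assms unfolding is_coeq_def by blast

context category
begin

lemma epi_comp:
  assumes f: "epi C X Y f" and g: "epi C Y Z g"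
  shows "epi C X Z (g \<cdot> f)"
proof -
  have "h = k" if h: "h \<in> Hom C Z W" and k: "k \<in> Hom C Z W"
    and eq: "h \<cdot> (g \<cdot> f) = k \<cdot> (g \<cdot> f)" for W h k
  proof -
    have "(h \<cdot> g) \<cdot> f = (k \<cdot> g) \<cdot> f"
      using eq h k comp_assoc[OF epi_hom[OF f] epi_hom[OF g]] by simp
    then have "h \<cdot> g = k \<cdot> g"
      using epi_cancel[OF f] comp_hom[OF epi_hom[OF g]] h k by blast
    then show ?thesis using epi_cancel[OF g h k] by blast
  qed
  then show ?thesis
    using comp_hom[OF epi_hom[OF f] epi_hom[OF g]] by (auto simp: epi_def)
qed

lemma is_coeq_epi:
  assumes q: "is_coeq C X Y f g Q q"
  shows "epi C Y Q q"
proof -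
  note f = is_coeq_hom(1)[OF q] and g = is_coeq_hom(2)[OF q] and q' = is_coeq_hom(3)[OF q]
  have "h = k" if h: "h \<in> Hom C Q Z" and k: "k \<in> Hom C Q Z" and eq: "h \<cdot> q = k \<cdot> q" for Z h k
  proof -
    have "(h \<cdot> q) \<cdot> f = (h \<cdot> q) \<cdot> g"
      using comp_assoc[OF f q' h] comp_assoc[OF g q' h] is_coeq_eq[OF q] by simp
    then have "\<exists>!l. l \<in> Hom C Q Z \<and> l \<cdot> q = h \<cdot> q"
      using q comp_hom[OF q' h] unfolding is_coeq_def by blast
    then show ?thesis using h k eq by metis
  qed
  then show ?thesis using q' by (auto simp: epi_def)
qed

lemma regular_epi_epi: "regular_epi C X Y f \<Longrightarrow> epi C X Y f"
  using is_coeq_epi by (auto simp: regular_epi_def)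

lemma regular_epi_composite_epi: "regular_epi_composite C X Y f \<Longrightarrow> epi C X Y f"
  by (induction rule: regular_epi_composite.induct) (auto intro: regular_epi_epi epi_comp)

text \<open>
  If \<open>s\<close> is a section of \<open>f\<close>, then \<open>f\<close> is the coequalizer of \<open>s f\<close> and the identity: an arrow \<open>h\<close>
  with \<open>h s f = h\<close> factors through \<open>f\<close> as \<open>h s\<close>.
\<close>

lemma split_epi_regular:
  assumes f: "f \<in> Hom C X Y" and s: "s \<in> Hom C Y X" and fs: "f \<cdot> s = Ide C Y"
  shows "regular_epi C X Y f"
proof -
  have sf: "s \<cdot> f \<in> Hom C X X" using comp_hom[OF f s] .
  have "\<exists>!k. k \<in> Hom C Y Z \<and> k \<cdot> f = h"
    if h: "h \<in> Hom C X Z" and eq: "h \<cdot> (s \<cdot> f) = h \<cdot> Ide C X" for Z h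
  proof (rule ex1I[of _ "h \<cdot> s"])
    show "h \<cdot> s \<in> Hom C Y Z \<and> (h \<cdot> s) \<cdot> f = h"
      using comp_hom[OF s h] comp_assoc[OF f s h] eq ide_right[OF h] by simp
    show "k = h \<cdot> s" if k: "k \<in> Hom C Y Z \<and> k \<cdot> f = h" for k
      using k comp_assoc[OF s f, of k Z] fs ide_right[of k Y Z] by metis
  qed
  moreover have "f \<cdot> (s \<cdot> f) = f \<cdot> Ide C X"
    using comp_assoc[OF f s f] fs ide_left[OF f] ide_right[OF f] by simp
  ultimately have "is_coeq C X X (s \<cdot> f) (Ide C X) Y f"
    using f sf ide_hom[OF hom_dom[OF f]] by (simp add: is_coeq_def)
  then show ?thesis by (auto simp: regular_epi_def)
qed

lemma ide_regular_epi: "X \<in> Obj C \<Longrightarrow> regular_epi C X X (Ide C X)"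
  by (rule split_epi_regular[of _ _ _ "Ide C X"]) (auto intro: ide_hom ide_left)

end

lemma preserves_regular_epi_composite:
  assumes F: "is_functor C D F"
    and reg: "\<And>X Y f. regular_epi C X Y f \<Longrightarrow> regular_epi D (ob F X) (ob F Y) (ar F X Y f)"
    and f: "regular_epi_composite C X Y f"
  shows "regular_epi_composite D (ob F X) (ob F Y) (ar F X Y f)"
proof -
  interpret is_functor C D F by (rule F)
  show ?thesis using f
  proof induction
    case (single X Y f)
    then show ?case by (intro regular_epi_composite.single reg)
  next
    case (compose X Y f Z g)
    have "ar F X Z (g \<cdot>\<^bsub>C\<^esub> f) = ar F Y Z g \<cdot>\<^bsub>D\<^esub> ar F X Y f"
      using compose by (intro ar_comp epi_hom)
        (auto intro: C.regular_epi_composite_epi C.regular_epi_epi)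
    then show ?case using compose reg by (auto intro: regular_epi_composite.compose)
  qed
qed

section \<open>Identity and composite functors\<close>

lemma ftr_id_sel [simp]: "ob ftr_id X = X" "ar ftr_id X Y f = f"
  by (simp_all add: ftr_id_def)

lemma ftr_comp_sel [simp]:
  "ob (G \<circ>\<^sub>F F) X = ob G (ob F X)"
  "ar (G \<circ>\<^sub>F F) X Y f = ar G (ob F X) (ob F Y) (ar F X Y f)"
  by (simp_all add: ftr_comp_def)

lemma is_functor_id: "category C \<Longrightarrow> is_functor C C ftr_id"
  by (auto simp: is_functor_def is_functor_axioms_def)

lemma is_functor_comp:
  assumes "is_functor C D F" and "is_functor D E G"
  shows "is_functor C E (G \<circ>\<^sub>F F)"
proof -
  interpret F: is_functor C D F by (rule assms(1))
  interpret G: is_functor D E G by (rule assms(2))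
  show ?thesis
    by unfold_locales
      (auto simp: F.ar_ide G.ar_ide[OF F.ob_obj] F.ar_comp[where f = f and g = g for f g]
        intro!: F.ob_obj G.ob_obj F.ar_hom G.ar_hom G.ar_comp)
qed

section \<open>Transposition along an adjunction\<close>

locale adj_pair =
  fixes A :: "('a, 'k) cat" and B :: "('o, 'm) cat" and J :: "('a, 'k, 'o, 'm, 'z) adj_scheme"
  assumes adj: "adjunction A B J"
begin

lemma L_functor: "is_functor B A (Lf J)" and R_functor: "is_functor A B (Rf J)"
  and eta_nat: "nat_trans B B ftr_id (Rf J \<circ>\<^sub>F Lf J) (eta J)"
  and eps_nat: "nat_trans A A (Lf J \<circ>\<^sub>F Rf J) ftr_id (eps J)"
  using adj by (auto simp: adjunction_def)

sublocale A: category A using L_functor by (simp add: is_functor_def)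
sublocale B: category B using L_functor by (simp add: is_functor_def)
sublocale L: is_functor B A "Lf J" by (rule L_functor)
sublocale R: is_functor A B "Rf J" by (rule R_functor)

lemma eta_hom: "X \<in> Obj B \<Longrightarrow> eta J X \<in> Hom B X (ob (Rf J) (ob (Lf J) X))"
  using nat_trans.component[OF eta_nat] by simp

lemma eps_hom: "Y \<in> Obj A \<Longrightarrow> eps J Y \<in> Hom A (ob (Lf J) (ob (Rf J) Y)) Y"
  using nat_trans.component[OF eps_nat] by simp

lemma eta_natural: "f \<in> Hom B X Y \<Longrightarrow> eta J Y \<cdot>\<^bsub>B\<^esub> f =
    ar (Rf J) (ob (Lf J) X) (ob (Lf J) Y) (ar (Lf J) X Y f) \<cdot>\<^bsub>B\<^esub> eta J X"
  using nat_trans.natural[OF eta_nat] by simp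

lemma eps_natural: "f \<in> Hom A X Y \<Longrightarrow> f \<cdot>\<^bsub>A\<^esub> eps J X =
    eps J Y \<cdot>\<^bsub>A\<^esub> ar (Lf J) (ob (Rf J) X) (ob (Rf J) Y) (ar (Rf J) X Y f)"
  using nat_trans.natural[OF eps_nat] by simp

lemma triangle_L: "X \<in> Obj B \<Longrightarrow> eps J (ob (Lf J) X) \<cdot>\<^bsub>A\<^esub>
    ar (Lf J) X (ob (Rf J) (ob (Lf J) X)) (eta J X) = Ide A (ob (Lf J) X)"
  using adj by (simp add: adjunction_def)

lemma triangle_R: "Y \<in> Obj A \<Longrightarrow> ar (Rf J) (ob (Lf J) (ob (Rf J) Y)) Y (eps J Y) \<cdot>\<^bsub>B\<^esub>
    eta J (ob (Rf J) Y) = Ide B (ob (Rf J) Y)"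
  using adj by (simp add: adjunction_def)

abbreviation transpose :: "'o \<Rightarrow> 'a \<Rightarrow> 'k \<Rightarrow> 'm" where
  "transpose X Y f \<equiv> ar (Rf J) (ob (Lf J) X) Y f \<cdot>\<^bsub>B\<^esub> eta J X"

abbreviation cotranspose :: "'o \<Rightarrow> 'a \<Rightarrow> 'm \<Rightarrow> 'k" where
  "cotranspose X Y f \<equiv> eps J Y \<cdot>\<^bsub>A\<^esub> ar (Lf J) X (ob (Rf J) Y) f"

lemma transpose_hom:
  assumes "X \<in> Obj B" and "f \<in> Hom A (ob (Lf J) X) Y"
  shows "transpose X Y f \<in> Hom B X (ob (Rf J) Y)"
  using B.comp_hom[OF eta_hom R.ar_hom] assms by simp

lemma cotranspose_hom:
  assumes "f \<in> Hom B X (ob (Rf J) Y)" and "Y \<in> Obj A"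
  shows "cotranspose X Y f \<in> Hom A (ob (Lf J) X) Y"
  using A.comp_hom[OF L.ar_hom eps_hom] assms by simp

text \<open>
  The bijection \<open>Hom(L X, Y) \<cong> Hom(X, R Y)\<close> and its naturality replace most computations with units
  and counits below: two arrows out of \<open>L X\<close> are equal as soon as their transposes are.
\<close>

lemma transpose_comp_right:
  assumes g: "g \<in> Hom A (ob (Lf J) X) Y" and f: "f \<in> Hom B W X"
  shows "transpose W Y (g \<cdot>\<^bsub>A\<^esub> ar (Lf J) W X f) = transpose X Y g \<cdot>\<^bsub>B\<^esub> f"
proof -
  have W: "W \<in> Obj B" and X: "X \<in> Obj B" using f B.hom_dom B.hom_cod by auto
  note Lf = L.ar_hom[OF f]
  show ?thesis
    using R.ar_comp[OF Lf g] eta_natural[OF f]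
      B.comp_assoc[OF eta_hom[OF W] R.ar_hom[OF Lf] R.ar_hom[OF g]]
      B.comp_assoc[OF f eta_hom[OF X] R.ar_hom[OF g]]
    by simp
qed

lemma transpose_comp_left:
  assumes X: "X \<in> Obj B" and g: "g \<in> Hom A (ob (Lf J) X) Y" and h: "h \<in> Hom A Y Z"
  shows "transpose X Z (h \<cdot>\<^bsub>A\<^esub> g) = ar (Rf J) Y Z h \<cdot>\<^bsub>B\<^esub> transpose X Y g"
  using R.ar_comp[OF g h] B.comp_assoc[OF eta_hom[OF X] R.ar_hom[OF g] R.ar_hom[OF h]] by simp

lemma transpose_eps:
  assumes h: "h \<in> Hom A Y Z"
  shows "transpose (ob (Rf J) Y) Z (h \<cdot>\<^bsub>A\<^esub> eps J Y) = ar (Rf J) Y Z h"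
proof -
  have Y: "Y \<in> Obj A" using A.hom_dom[OF h] .
  show ?thesis
    using transpose_comp_left[OF R.ob_obj[OF Y] eps_hom[OF Y] h] triangle_R[OF Y]
      B.ide_right[OF R.ar_hom[OF h]] by simp
qed

lemma transpose_cotranspose:
  assumes f: "f \<in> Hom B X (ob (Rf J) Y)" and Y: "Y \<in> Obj A"
  shows "transpose X Y (cotranspose X Y f) = f"
  using transpose_comp_right[OF eps_hom[OF Y] f] triangle_R[OF Y] B.ide_left[OF f] by simp

lemma cotranspose_transpose:
  assumes X: "X \<in> Obj B" and g: "g \<in> Hom A (ob (Lf J) X) Y"
  shows "cotranspose X Y (transpose X Y g) = g"
proof -
  note e = eta_hom[OF X] and Rg = R.ar_hom[OF g]
  have Y: "Y \<in> Obj A" using A.hom_cod[OF g] .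
  have "cotranspose X Y (transpose X Y g) = g \<cdot>\<^bsub>A\<^esub> (eps J (ob (Lf J) X) \<cdot>\<^bsub>A\<^esub>
      ar (Lf J) X (ob (Rf J) (ob (Lf J) X)) (eta J X))"
    using L.ar_comp[OF e Rg] A.comp_assoc[OF L.ar_hom[OF e] L.ar_hom[OF Rg] eps_hom[OF Y]]
      eps_natural[OF g] A.comp_assoc[OF L.ar_hom[OF e] eps_hom[OF A.hom_dom[OF g]] g] by simp
  then show ?thesis using triangle_L[OF X] A.ide_right[OF g] by simp
qed

lemma transpose_inject:
  assumes "X \<in> Obj B" and "f \<in> Hom A (ob (Lf J) X) Y" and "g \<in> Hom A (ob (Lf J) X) Y"
    and "transpose X Y f = transpose X Y g"
  shows "f = g"
  using assms cotranspose_transpose by metis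

text \<open>
  Transposition turns arrows out of \<open>L Y\<close> that coequalize \<open>L f\<close> and \<open>L g\<close> into arrows out of \<open>Y\<close> that
  coequalize \<open>f\<close> and \<open>g\<close>.
\<close>

lemma L_preserves_coeq: "preserves_coeq B A (Lf J) X Y f g"
proof -
  have "is_coeq A (ob (Lf J) X) (ob (Lf J) Y) (ar (Lf J) X Y f) (ar (Lf J) X Y g)
      (ob (Lf J) Q) (ar (Lf J) Y Q q)" if q: "is_coeq B X Y f g Q q" for Q q
  proof -
    note f = is_coeq_hom(1)[OF q] and g = is_coeq_hom(2)[OF q] and q' = is_coeq_hom(3)[OF q]
    have obj: "X \<in> Obj B" "Y \<in> Obj B" "Q \<in> Obj B"
      using B.hom_dom[OF f] B.hom_dom[OF q'] B.hom_cod[OF q'] by auto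
    have "\<exists>!k. k \<in> Hom A (ob (Lf J) Q) Z \<and> k \<cdot>\<^bsub>A\<^esub> ar (Lf J) Y Q q = h"
      if h: "h \<in> Hom A (ob (Lf J) Y) Z"
        and eq: "h \<cdot>\<^bsub>A\<^esub> ar (Lf J) X Y f = h \<cdot>\<^bsub>A\<^esub> ar (Lf J) X Y g" for Z h
    proof -
      have Z: "Z \<in> Obj A" using A.hom_cod[OF h] .
      have "transpose Y Z h \<cdot>\<^bsub>B\<^esub> f = transpose Y Z h \<cdot>\<^bsub>B\<^esub> g"
        using eq transpose_comp_right[OF h f] transpose_comp_right[OF h g] by simp
      then obtain l where l: "l \<in> Hom B Q (ob (Rf J) Z)" "l \<cdot>\<^bsub>B\<^esub> q = transpose Y Z h"
        using is_coeq_factor[OF q transpose_hom[OF obj(2) h]] by blast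
      let ?k = "cotranspose Q Z l"
      have k: "?k \<in> Hom A (ob (Lf J) Q) Z" using cotranspose_hom[OF l(1) Z] .
      have "?k \<cdot>\<^bsub>A\<^esub> ar (Lf J) Y Q q = h"
        using transpose_inject[OF obj(2) A.comp_hom[OF L.ar_hom[OF q'] k] h]
          transpose_comp_right[OF k q'] transpose_cotranspose[OF l(1) Z] l(2) by simp
      moreover have "k' = ?k"
        if k': "k' \<in> Hom A (ob (Lf J) Q) Z" "k' \<cdot>\<^bsub>A\<^esub> ar (Lf J) Y Q q = h" for k'
      proof -
        have "transpose Q Z k' \<cdot>\<^bsub>B\<^esub> q = l \<cdot>\<^bsub>B\<^esub> q"
          using transpose_comp_right[OF k'(1) q'] k'(2) l(2) by simp
        then have "transpose Q Z k' = l"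
          using epi_cancel[OF B.is_coeq_epi[OF q] transpose_hom[OF obj(3) k'(1)] l(1)] by blast
        then show ?thesis using cotranspose_transpose[OF obj(3) k'(1)] by simp
      qed
      ultimately show ?thesis using k by blast
    qed
    moreover have "ar (Lf J) Y Q q \<cdot>\<^bsub>A\<^esub> ar (Lf J) X Y f = ar (Lf J) Y Q q \<cdot>\<^bsub>A\<^esub> ar (Lf J) X Y g"
      using L.ar_comp[OF f q'] L.ar_comp[OF g q'] is_coeq_eq[OF q] by simp
    ultimately show ?thesis using L.ar_hom f g q' by (auto simp: is_coeq_def)
  qed
  then show ?thesis by (simp add: preserves_coeq_def)
qed

lemma L_preserves_regular_epi:
  "regular_epi B X Y f \<Longrightarrow> regular_epi A (ob (Lf J) X) (ob (Lf J) Y) (ar (Lf J) X Y f)"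
  using L_preserves_coeq unfolding regular_epi_def preserves_coeq_def by blast

text \<open>
  In both towers, the next left adjoint is the coequalizer of a pair \<open>q \<cdot> L b\<close>, \<open>\<epsilon>\<^sub>Y\<close>: with the given
  adjunction and \<open>q = \<pi>\<^bsub>[n]\<^esub>\<close> for the adjoint decomposition, with the adjunction of the stage itself and
  \<open>q\<close> an identity for the monadic tower. Transposing both composites gives the condition on the right,
  from which \<open>L\<close> has disappeared.
\<close>

lemma coequalizes_iff:
  assumes q: "q \<in> Hom A (ob (Lf J) X) Y" and b: "b \<in> Hom B (ob (Rf J) Y) X"
    and f: "f \<in> Hom A Y Z"
  shows "f \<cdot>\<^bsub>A\<^esub> (q \<cdot>\<^bsub>A\<^esub> ar (Lf J) (ob (Rf J) Y) X b) = f \<cdot>\<^bsub>A\<^esub> eps J Y \<longleftrightarrow>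
    (ar (Rf J) Y Z f \<cdot>\<^bsub>B\<^esub> transpose X Y q) \<cdot>\<^bsub>B\<^esub> b = ar (Rf J) Y Z f"
    (is "?l = ?r \<longleftrightarrow> _")
proof -
  have X: "X \<in> Obj B" and Y: "Y \<in> Obj A" using B.hom_cod[OF b] A.hom_dom[OF f] by auto
  note RY = R.ob_obj[OF Y] and Lb = L.ar_hom[OF b]
  have l: "?l \<in> Hom A (ob (Lf J) (ob (Rf J) Y)) Z" using A.comp_hom[OF A.comp_hom[OF Lb q] f] .
  have r: "?r \<in> Hom A (ob (Lf J) (ob (Rf J) Y)) Z" using A.comp_hom[OF eps_hom[OF Y] f] .
  have "transpose (ob (Rf J) Y) Z ?l = (ar (Rf J) Y Z f \<cdot>\<^bsub>B\<^esub> transpose X Y q) \<cdot>\<^bsub>B\<^esub> b"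
    using A.comp_assoc[OF Lb q f] transpose_comp_right[OF A.comp_hom[OF q f] b]
      transpose_comp_left[OF X q f] by simp
  moreover have "transpose (ob (Rf J) Y) Z ?r = ar (Rf J) Y Z f" using transpose_eps[OF f] .
  ultimately show ?thesis using transpose_inject[OF RY l r] by metis
qed

end

text \<open>
  Functoriality of \<open>L\<close>, naturality of \<open>\<epsilon>\<close> and the first triangle identity are equations between arrows
  out of some \<open>L X\<close>, hence follow from the uniqueness part of the universal property of \<open>\<eta>\<^sub>X\<close>.
\<close>

lemma adjunction_from_universal_arrows:
  assumes R: "is_functor A B (Rf J)"
    and L_ob: "\<And>X. X \<in> Obj B \<Longrightarrow> ob (Lf J) X \<in> Obj A"
    and eta: "\<And>X. X \<in> Obj B \<Longrightarrow> eta J X \<in> Hom B X (ob (Rf J) (ob (Lf J) X))"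
    and univ: "\<And>X Y k k'. X \<in> Obj B \<Longrightarrow> k \<in> Hom A (ob (Lf J) X) Y \<Longrightarrow> k' \<in> Hom A (ob (Lf J) X) Y
      \<Longrightarrow> ar (Rf J) (ob (Lf J) X) Y k \<cdot>\<^bsub>B\<^esub> eta J X = ar (Rf J) (ob (Lf J) X) Y k' \<cdot>\<^bsub>B\<^esub> eta J X
      \<Longrightarrow> k = k'"
    and L_ar: "\<And>X Y f. f \<in> Hom B X Y \<Longrightarrow> ar (Lf J) X Y f \<in> Hom A (ob (Lf J) X) (ob (Lf J) Y)"
    and L_eta: "\<And>X Y f. f \<in> Hom B X Y \<Longrightarrow> ar (Rf J) (ob (Lf J) X) (ob (Lf J) Y) (ar (Lf J) X Y f)
      \<cdot>\<^bsub>B\<^esub> eta J X = eta J Y \<cdot>\<^bsub>B\<^esub> f"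
    and eps: "\<And>Y. Y \<in> Obj A \<Longrightarrow> eps J Y \<in> Hom A (ob (Lf J) (ob (Rf J) Y)) Y"
    and eps_eta: "\<And>Y. Y \<in> Obj A \<Longrightarrow> ar (Rf J) (ob (Lf J) (ob (Rf J) Y)) Y (eps J Y) \<cdot>\<^bsub>B\<^esub>
        eta J (ob (Rf J) Y) = Ide B (ob (Rf J) Y)"
  shows "adjunction A B J"
proof -
  interpret R: is_functor A B "Rf J" by (rule R)
  let ?R = "Rf J" and ?L = "Lf J"
  have eta_comp: "ar ?R (ob ?L X) Z (h \<cdot>\<^bsub>A\<^esub> g) \<cdot>\<^bsub>B\<^esub> eta J X =
      ar ?R Y Z h \<cdot>\<^bsub>B\<^esub> (ar ?R (ob ?L X) Y g \<cdot>\<^bsub>B\<^esub> eta J X)"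
    if "X \<in> Obj B" "g \<in> Hom A (ob ?L X) Y" "h \<in> Hom A Y Z" for X Y Z g h
    using R.ar_comp[OF that(2,3)]
      R.D.comp_assoc[OF eta[OF that(1)] R.ar_hom[OF that(2)] R.ar_hom[OF that(3)]]
    by simp
  have eta_comp_L: "ar ?R (ob ?L X) Z (h \<cdot>\<^bsub>A\<^esub> ar ?L X Y f) \<cdot>\<^bsub>B\<^esub> eta J X =
      (ar ?R (ob ?L Y) Z h \<cdot>\<^bsub>B\<^esub> eta J Y) \<cdot>\<^bsub>B\<^esub> f"
    if f: "f \<in> Hom B X Y" and h: "h \<in> Hom A (ob ?L Y) Z" for X Y Z f h
    using eta_comp[OF R.D.hom_dom[OF f] L_ar[OF f] h] L_eta[OF f]
      R.D.comp_assoc[OF f eta[OF R.D.hom_cod[OF f]] R.ar_hom[OF h]] by simp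
  have L: "is_functor B A ?L"
  proof
    fix X assume X: "X \<in> Obj B"
    show "ob ?L X \<in> Obj A" using L_ob[OF X] .
    note i = R.D.ide_hom[OF X] and j = R.C.ide_hom[OF L_ob[OF X]]
    show "ar ?L X X (Ide B X) = Ide A (ob ?L X)"
    proof (rule univ[OF X L_ar[OF i] j])
      show "ar ?R (ob ?L X) (ob ?L X) (ar ?L X X (Ide B X)) \<cdot>\<^bsub>B\<^esub> eta J X =
          ar ?R (ob ?L X) (ob ?L X) (Ide A (ob ?L X)) \<cdot>\<^bsub>B\<^esub> eta J X"
        using L_eta[OF i] R.D.ide_right[OF eta[OF X]] R.ar_ide[OF L_ob[OF X]]
          R.D.ide_left[OF eta[OF X]] by simp
    qed
  next
    fix f X Y assume f: "f \<in> Hom B X Y"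
    show "ar ?L X Y f \<in> Hom A (ob ?L X) (ob ?L Y)" using L_ar[OF f] .
    fix g Z assume g: "g \<in> Hom B Y Z"
    show "ar ?L X Z (g \<cdot>\<^bsub>B\<^esub> f) = ar ?L Y Z g \<cdot>\<^bsub>A\<^esub> ar ?L X Y f"
      using univ[OF R.D.hom_dom[OF f] L_ar[OF R.D.comp_hom[OF f g]]
          R.C.comp_hom[OF L_ar[OF f] L_ar[OF g]]]
        L_eta[OF R.D.comp_hom[OF f g]] eta_comp_L[OF f L_ar[OF g]] L_eta[OF g]
        R.D.comp_assoc[OF f g eta[OF R.D.hom_cod[OF g]]] by simp
  qed
  interpret L: is_functor B A ?L by (rule L)
  have "nat_trans B B ftr_id (?R \<circ>\<^sub>F ?L) (eta J)"
    using is_functor_id[OF R.D.category_axioms] is_functor_comp[OF L R] eta L_eta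
    by (auto simp: nat_trans_def nat_trans_axioms_def)
  moreover have "f \<cdot>\<^bsub>A\<^esub> eps J X = eps J Y \<cdot>\<^bsub>A\<^esub> ar ?L (ob ?R X) (ob ?R Y) (ar ?R X Y f)"
    if f: "f \<in> Hom A X Y" for f X Y
  proof -
    have X: "X \<in> Obj A" and Y: "Y \<in> Obj A" using R.C.hom_dom[OF f] R.C.hom_cod[OF f] .
    note RX = R.ob_obj[OF X] and Rf = R.ar_hom[OF f]
    show ?thesis
    proof (rule univ[OF RX R.C.comp_hom[OF eps[OF X] f] R.C.comp_hom[OF L_ar[OF Rf] eps[OF Y]]])
      show "ar ?R (ob ?L (ob ?R X)) Y (f \<cdot>\<^bsub>A\<^esub> eps J X) \<cdot>\<^bsub>B\<^esub> eta J (ob ?R X) =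
        ar ?R (ob ?L (ob ?R X)) Y (eps J Y \<cdot>\<^bsub>A\<^esub> ar ?L (ob ?R X) (ob ?R Y) (ar ?R X Y f))
          \<cdot>\<^bsub>B\<^esub> eta J (ob ?R X)"
        using eta_comp[OF RX eps[OF X] f] eta_comp_L[OF Rf eps[OF Y]] eps_eta[OF X] eps_eta[OF Y]
          R.D.ide_left[OF Rf] R.D.ide_right[OF Rf] by simp
    qed
  qed
  then have "nat_trans A A (?L \<circ>\<^sub>F ?R) ftr_id (eps J)"
    using is_functor_id[OF R.C.category_axioms] is_functor_comp[OF R L] eps
    by (auto simp: nat_trans_def nat_trans_axioms_def)
  moreover have "eps J (ob ?L X) \<cdot>\<^bsub>A\<^esub> ar ?L X (ob ?R (ob ?L X)) (eta J X) = Ide A (ob ?L X)"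
    if X: "X \<in> Obj B" for X
  proof -
    note LX = L_ob[OF X] and e = eta[OF X]
    show ?thesis
      using univ[OF X R.C.comp_hom[OF L_ar[OF e] eps[OF LX]] R.C.ide_hom[OF LX]]
        eta_comp_L[OF e eps[OF LX]] eps_eta[OF LX] R.ar_ide[OF LX] by simp
  qed
  ultimately show ?thesis
    using L R eps_eta by (auto simp: adjunction_def)
qed

section \<open>The next stage of a tower\<close>

text \<open>
  In both towers, an arrow out of \<open>L\<^sub>S (prev X)\<close> coequalizes the pair at \<open>X\<close> if and only if its
  transpose is a morphism \<open>X \<rightarrow> R Y\<close> of the next category. This is why the coequalizer \<open>p\<close> yields the
  universal arrow \<open>R p \<cdot> \<eta>\<close> from \<open>X\<close> to the next right adjoint. The source \<open>W\<close> of the pair and the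
  pair itself are left open, as they differ between the towers.
\<close>

locale next_stage =
  S: adj_pair A "Ct S" S + N: category N
  for A :: "('a, 'k) cat" and S :: "('a, 'k, 'o, 'm, 'z) stage_scheme"
    and N :: "(('o, 'm) tower_obj, 'm) cat" +
  fixes qu :: "('o, 'm) tower_obj \<Rightarrow> 'a \<times> 'k" and b :: "'a \<Rightarrow> 'm"
  assumes Comp_next: "Comp N = Comp (Ct S)"
    and Ide_next: "X \<in> Obj N \<Longrightarrow> Ide N X = Ide (Ct S) (prev X)"
    and hom_prev: "f \<in> Hom N X Y \<Longrightarrow> f \<in> Hom (Ct S) (prev X) (prev Y)"
    and R_next: "is_functor A N (next_R S b)"
    and coeq_next: "X \<in> Obj N \<Longrightarrow> \<exists>W u v.
      is_coeq A W (ob (Lf S) (prev X)) u v (fst (qu X)) (snd (qu X)) \<and>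
      (\<forall>Y. \<forall>f \<in> Hom A (ob (Lf S) (prev X)) Y. f \<cdot>\<^bsub>A\<^esub> u = f \<cdot>\<^bsub>A\<^esub> v \<longleftrightarrow>
        S.transpose (prev X) Y f \<in> Hom N X (ob (next_R S b) Y))"
begin

lemma prev_obj: "X \<in> Obj N \<Longrightarrow> prev X \<in> Obj (Ct S)"
  using S.B.hom_dom[OF hom_prev[OF N.ide_hom]] .

lemma next_R_sel: "ob (next_R S b) Y = Ext (ob (Rf S) Y) (b Y)" "ar (next_R S b) = ar (Rf S)"
  by (simp_all add: next_R_def)

lemma p_epi: "X \<in> Obj N \<Longrightarrow> epi A (ob (Lf S) (prev X)) (fst (qu X)) (snd (qu X))"
  using coeq_next S.A.is_coeq_epi by blast

lemmas p_hom = epi_hom[OF p_epi]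

lemma p_regular: "X \<in> Obj N \<Longrightarrow> regular_epi A (ob (Lf S) (prev X)) (fst (qu X)) (snd (qu X))"
  using coeq_next unfolding regular_epi_def by blast

lemma p_factor:
  assumes X: "X \<in> Obj N" and f: "f \<in> Hom A (ob (Lf S) (prev X)) Y"
    and t: "S.transpose (prev X) Y f \<in> Hom N X (ob (next_R S b) Y)"
  shows "\<exists>!k. k \<in> Hom A (fst (qu X)) Y \<and> k \<cdot>\<^bsub>A\<^esub> snd (qu X) = f"
  using coeq_next[OF X] f t unfolding is_coeq_def by blast

lemma next_eta_transpose: "next_eta S qu X = S.transpose (prev X) (fst (qu X)) (snd (qu X))"
  by (simp add: next_eta_def)

lemma next_eta_hom: "X \<in> Obj N \<Longrightarrow> next_eta S qu X \<in> Hom N X (ob (next_R S b) (fst (qu X)))"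
  using coeq_next[of X] p_hom[of X] unfolding next_eta_transpose is_coeq_def by blast

lemma next_L_ar:
  assumes f: "f \<in> Hom N X Y"
  shows "ar (next_L A S qu) X Y f \<in> Hom A (fst (qu X)) (fst (qu Y)) \<and>
    ar (next_L A S qu) X Y f \<cdot>\<^bsub>A\<^esub> snd (qu X) =
      snd (qu Y) \<cdot>\<^bsub>A\<^esub> ar (Lf S) (prev X) (prev Y) f"
proof -
  have X: "X \<in> Obj N" and Y: "Y \<in> Obj N" using N.hom_dom[OF f] N.hom_cod[OF f] .
  note f' = hom_prev[OF f]
  have "S.transpose (prev X) (fst (qu Y)) (snd (qu Y) \<cdot>\<^bsub>A\<^esub> ar (Lf S) (prev X) (prev Y) f) =
      next_eta S qu Y \<cdot>\<^bsub>N\<^esub> f"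
    using S.transpose_comp_right[OF p_hom[OF Y] f'] by (simp add: next_eta_transpose Comp_next)
  also have "\<dots> \<in> Hom N X (ob (next_R S b) (fst (qu Y)))"
    using N.comp_hom[OF f next_eta_hom[OF Y]] .
  finally show ?thesis
    using theI'[OF p_factor[OF X S.A.comp_hom[OF S.L.ar_hom[OF f'] p_hom[OF Y]]]]
    by (simp add: next_L_def)
qed

lemma next_eps_arr:
  assumes Y: "Y \<in> Obj A"
  shows "next_eps A S qu b Y \<in> Hom A (fst (qu (ob (next_R S b) Y))) Y \<and>
    next_eps A S qu b Y \<cdot>\<^bsub>A\<^esub> snd (qu (ob (next_R S b) Y)) = eps S Y"
proof -
  have RY: "ob (next_R S b) Y \<in> Obj N" using is_functor.ob_obj[OF R_next Y] .
  have "S.transpose (ob (Rf S) Y) Y (eps S Y) = Ide N (ob (next_R S b) Y)"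
    using S.triangle_R[OF Y] Ide_next[OF RY] by (simp add: next_R_sel)
  then have "S.transpose (ob (Rf S) Y) Y (eps S Y) \<in> Hom N (ob (next_R S b) Y) (ob (next_R S b) Y)"
    using N.ide_hom[OF RY] by simp
  then show ?thesis
    using theI'[OF p_factor[OF RY, of "eps S Y" Y]] S.eps_hom[OF Y]
    by (simp add: next_eps_def next_R_sel)
qed

lemma next_adjunction:
  assumes T: "Lf T = next_L A S qu" "Rf T = next_R S b" "eta T = next_eta S qu"
    "eps T = next_eps A S qu b"
  shows "adjunction A N T"
proof (rule adjunction_from_universal_arrows)
  show "is_functor A N (Rf T)" using R_next T by simp
next
  fix X assume X: "X \<in> Obj N"
  show "ob (Lf T) X \<in> Obj A" using S.A.hom_cod[OF p_hom[OF X]] by (simp add: T next_L_def)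
  show "eta T X \<in> Hom N X (ob (Rf T) (ob (Lf T) X))"
    using next_eta_hom[OF X] by (simp add: T next_L_def)
  fix Y k k' assume k: "k \<in> Hom A (ob (Lf T) X) Y" and k': "k' \<in> Hom A (ob (Lf T) X) Y"
    and eq: "ar (Rf T) (ob (Lf T) X) Y k \<cdot>\<^bsub>N\<^esub> eta T X = ar (Rf T) (ob (Lf T) X) Y k' \<cdot>\<^bsub>N\<^esub> eta T X"
  note k = k[unfolded T next_L_def, simplified] and k' = k'[unfolded T next_L_def, simplified]
  note p = p_hom[OF X]
  have "k \<cdot>\<^bsub>A\<^esub> snd (qu X) = k' \<cdot>\<^bsub>A\<^esub> snd (qu X)"
    using S.transpose_inject[OF prev_obj[OF X] S.A.comp_hom[OF p k] S.A.comp_hom[OF p k']]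
      S.transpose_comp_left[OF prev_obj[OF X] p k] S.transpose_comp_left[OF prev_obj[OF X] p k'] eq
    by (simp add: T next_L_def next_R_sel next_eta_transpose Comp_next)
  then show "k = k'" using epi_cancel[OF p_epi[OF X] k k'] by blast
next
  fix X Y f assume f: "f \<in> Hom N X Y"
  have X: "X \<in> Obj N" and Y: "Y \<in> Obj N" using N.hom_dom[OF f] N.hom_cod[OF f] .
  show "ar (Lf T) X Y f \<in> Hom A (ob (Lf T) X) (ob (Lf T) Y)"
    using next_L_ar[OF f] by (simp add: T next_L_def)
  show "ar (Rf T) (ob (Lf T) X) (ob (Lf T) Y) (ar (Lf T) X Y f) \<cdot>\<^bsub>N\<^esub> eta T X = eta T Y \<cdot>\<^bsub>N\<^esub> f"
    using S.transpose_comp_left[OF prev_obj[OF X] p_hom[OF X] conjunct1[OF next_L_ar[OF f]]]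
      S.transpose_comp_right[OF p_hom[OF Y] hom_prev[OF f]] next_L_ar[OF f]
    by (simp add: T next_R_sel next_eta_transpose Comp_next) (simp add: next_L_def)
next
  fix Y assume Y: "Y \<in> Obj A"
  have RY: "ob (next_R S b) Y \<in> Obj N" using is_functor.ob_obj[OF R_next Y] .
  show "eps T Y \<in> Hom A (ob (Lf T) (ob (Rf T) Y)) Y"
    using next_eps_arr[OF Y] by (simp add: T next_L_def)
  show "ar (Rf T) (ob (Lf T) (ob (Rf T) Y)) Y (eps T Y) \<cdot>\<^bsub>N\<^esub> eta T (ob (Rf T) Y) =
      Ide N (ob (Rf T) Y)"
    using S.transpose_comp_left[OF prev_obj[OF RY] p_hom[OF RY] conjunct1[OF next_eps_arr[OF Y]]]
      next_eps_arr[OF Y] S.triangle_R[OF Y] Ide_next[OF RY]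
    by (simp add: T next_R_sel next_eta_transpose Comp_next) (simp add: next_L_def next_R_sel)
qed

end

section \<open>The two kinds of next stages\<close>

text \<open>
  Composition in a stage is composition in \<open>B\<close>, so all equations can be calculated in \<open>B\<close>; only the
  hom-sets become smaller from stage to stage.
\<close>

locale tower_stage =
  J: adj_pair A B J + S: adj_pair A "Ct S" S
  for A :: "('a, 'k) cat" and B :: "('o, 'm) cat" and J :: "('a, 'k, 'o, 'm) adj"
    and S :: "('a, 'k, 'o, 'm, 'z) stage_scheme" +
  assumes Comp_base [simp]: "Comp (Ct S) = Comp B"
    and Ide_base: "X \<in> Obj (Ct S) \<Longrightarrow> Ide (Ct S) X = Ide B (base X)"
    and hom_base: "f \<in> Hom (Ct S) X Y \<Longrightarrow> f \<in> Hom B (base X) (base Y)"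
    and Ug_ob: "X \<in> Obj (Ct S) \<Longrightarrow> ob (Ug S) X = base X"
    and Ug_ar [simp]: "ar (Ug S) X Y f = f"
    and base_R: "Z \<in> Obj A \<Longrightarrow> base (ob (Rf S) Z) = ob (Rf J) Z"
    and R_ar [simp]: "ar (Rf S) = ar (Rf J)"
begin

lemma base_obj: "X \<in> Obj (Ct S) \<Longrightarrow> base X \<in> Obj B"
  using J.B.hom_dom[OF hom_base[OF S.B.ide_hom]] .

lemma next_tower_stage:
  assumes "next_stage A S N qu b"
    and ext: "\<And>X. X \<in> Obj N \<Longrightarrow> base (prev X) = base X"
    and T: "Lf T = next_L A S qu" "Rf T = next_R S b" "eta T = next_eta S qu"
      "eps T = next_eps A S qu b" "Ct T = N" "Ug T = Ug S \<circ>\<^sub>F forget"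
  shows "tower_stage A B J T"
proof -
  interpret N: next_stage A S N qu b by (rule assms(1))
  have "adjunction A N T" using N.next_adjunction T by blast
  then have "adj_pair A (Ct T) T" by (simp add: adj_pair_def T)
  moreover have "tower_stage_axioms A B J T"
  proof
    show "Comp (Ct T) = Comp B" by (simp add: T N.Comp_next)
    show "Ide (Ct T) X = Ide B (base X)" if "X \<in> Obj (Ct T)" for X
      using that N.Ide_next Ide_base[OF N.prev_obj] ext by (simp add: T)
    show "f \<in> Hom B (base X) (base Y)" if "f \<in> Hom (Ct T) X Y" for f X Y
      using that hom_base[OF N.hom_prev] ext N.N.hom_dom N.N.hom_cod by (metis T(5))
    show "ob (Ug T) X = base X" if "X \<in> Obj (Ct T)" for X
      using that Ug_ob[OF N.prev_obj] ext by (simp add: T forget_def)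
    show "ar (Ug T) X Y f = f" for X Y f by (simp add: T forget_def)
    show "base (ob (Rf T) Y) = ob (Rf J) Y" if "Y \<in> Obj A" for Y
      using that base_R by (simp add: T N.next_R_sel)
    show "ar (Rf T) = ar (Rf J)" by (simp add: T N.next_R_sel)
  qed
  ultimately show ?thesis using J.adj_pair_axioms by (simp add: tower_stage_def)
qed

lemma em_cat_sel:
  "Ext V u \<in> Obj (em_cat (Ct S) (monad_of S)) \<longleftrightarrow> V \<in> Obj (Ct S) \<and>
     u \<in> Hom (Ct S) (ob (Rf S) (ob (Lf S) V)) V \<and> u \<cdot>\<^bsub>B\<^esub> eta S V = Ide (Ct S) V \<and>
     u \<cdot>\<^bsub>B\<^esub> ar (Rf J) (ob (Lf S) (ob (Rf S) (ob (Lf S) V))) (ob (Lf S) V)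
       (ar (Lf S) (ob (Rf S) (ob (Lf S) V)) V u) =
     u \<cdot>\<^bsub>B\<^esub> ar (Rf J) (ob (Lf S) (ob (Rf S) (ob (Lf S) V))) (ob (Lf S) V) (eps S (ob (Lf S) V))"
  "X \<in> Obj (em_cat (Ct S) (monad_of S)) \<Longrightarrow> X = Ext (prev X) (str X)"
  "f \<in> Hom (em_cat (Ct S) (monad_of S)) X Y \<longleftrightarrow>
     X \<in> Obj (em_cat (Ct S) (monad_of S)) \<and> Y \<in> Obj (em_cat (Ct S) (monad_of S)) \<and>
     f \<in> Hom (Ct S) (prev X) (prev Y) \<and> f \<cdot>\<^bsub>B\<^esub> str X = str Y \<cdot>\<^bsub>B\<^esub>
       ar (Rf J) (ob (Lf S) (prev X)) (ob (Lf S) (prev Y)) (ar (Lf S) (prev X) (prev Y) f)"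
  "Ide (em_cat (Ct S) (monad_of S)) X = Ide (Ct S) (prev X)"
  "Comp (em_cat (Ct S) (monad_of S)) = Comp B"
  by (auto simp: em_cat_def monad_of_def Let_def)

lemma dec_cat_sel:
  "Ext V u \<in> Obj (dec_cat B J S) \<longleftrightarrow> V \<in> Obj (Ct S) \<and>
     u \<in> Hom B (ob (Rf J) (ob (Lf S) V)) (base V)"
  "X \<in> Obj (dec_cat B J S) \<Longrightarrow> X = Ext (prev X) (str X)"
  "f \<in> Hom (dec_cat B J S) X Y \<longleftrightarrow>
     X \<in> Obj (dec_cat B J S) \<and> Y \<in> Obj (dec_cat B J S) \<and>
     f \<in> Hom (Ct S) (prev X) (prev Y) \<and> f \<cdot>\<^bsub>B\<^esub> str X = str Y \<cdot>\<^bsub>B\<^esub>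
       ar (Rf J) (ob (Lf S) (prev X)) (ob (Lf S) (prev Y)) (ar (Lf S) (prev X) (prev Y) f)"
  "Ide (dec_cat B J S) X = Ide (Ct S) (prev X)"
  "Comp (dec_cat B J S) = Comp B"
  by (auto simp: dec_cat_def Let_def Ug_ob)

abbreviation RL :: "('o, 'm) tower_obj \<Rightarrow> ('o, 'm) tower_obj \<Rightarrow> 'm \<Rightarrow> 'm" where
  "RL X Y f \<equiv> ar (Rf J) (ob (Lf S) X) (ob (Lf S) Y) (ar (Lf S) X Y f)"

lemma RL_hom:
  "f \<in> Hom (Ct S) X Y \<Longrightarrow> RL X Y f \<in> Hom B (ob (Rf J) (ob (Lf S) X)) (ob (Rf J) (ob (Lf S) Y))"
  using J.R.ar_hom[OF S.L.ar_hom] .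

lemma RL_comp:
  "f \<in> Hom (Ct S) X Y \<Longrightarrow> g \<in> Hom (Ct S) Y Z \<Longrightarrow> RL X Z (g \<cdot>\<^bsub>B\<^esub> f) = RL Y Z g \<cdot>\<^bsub>B\<^esub> RL X Y f"
  using S.L.ar_comp J.R.ar_comp[OF S.L.ar_hom S.L.ar_hom] by simp

lemma RL_ide:
  assumes "X \<in> Obj (Ct S)"
  shows "RL X X (Ide (Ct S) X) = Ide B (ob (Rf J) (ob (Lf S) X))"
  using S.L.ar_ide[OF assms] J.R.ar_ide[OF S.L.ob_obj[OF assms]] by simp

text \<open>
  In both towers, the morphisms of the next stage are the arrows of the previous one which commute
  with the structure arrows \<open>R L V \<rightarrow> V\<close>. So both next categories arise from the following
  construction; they differ only in the structure arrows that they admit.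
\<close>

lemma square_comp:
  assumes f: "f \<in> Hom (Ct S) X Y" and g: "g \<in> Hom (Ct S) Y Z"
    and u: "u \<in> Hom B (ob (Rf J) (ob (Lf S) X)) (base X)"
    and v: "v \<in> Hom B (ob (Rf J) (ob (Lf S) Y)) (base Y)"
    and w: "w \<in> Hom B (ob (Rf J) (ob (Lf S) Z)) (base Z)"
    and fs: "f \<cdot>\<^bsub>B\<^esub> u = v \<cdot>\<^bsub>B\<^esub> RL X Y f" and gs: "g \<cdot>\<^bsub>B\<^esub> v = w \<cdot>\<^bsub>B\<^esub> RL Y Z g"
  shows "(g \<cdot>\<^bsub>B\<^esub> f) \<cdot>\<^bsub>B\<^esub> u = w \<cdot>\<^bsub>B\<^esub> RL X Z (g \<cdot>\<^bsub>B\<^esub> f)"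
  using J.B.comp_assoc[OF u hom_base[OF f] hom_base[OF g]] fs gs RL_comp[OF f g]
    J.B.comp_assoc[OF RL_hom[OF f] v hom_base[OF g]]
    J.B.comp_assoc[OF RL_hom[OF f] RL_hom[OF g] w] by simp

lemma square_ide:
  assumes X: "X \<in> Obj (Ct S)" and u: "u \<in> Hom B (ob (Rf J) (ob (Lf S) X)) (base X)"
  shows "Ide (Ct S) X \<cdot>\<^bsub>B\<^esub> u = u \<cdot>\<^bsub>B\<^esub> RL X X (Ide (Ct S) X)"
  using Ide_base[OF X] RL_ide[OF X] J.B.ide_left[OF u] J.B.ide_right[OF u] by simp

lemma category_of_squares:
  assumes Comp: "Comp N = Comp B" and Ide: "\<And>X. Ide N X = Ide (Ct S) (prev X)"
    and Hom: "\<And>X Y f. f \<in> Hom N X Y \<longleftrightarrow> X \<in> Obj N \<and> Y \<in> Obj N \<and>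
      f \<in> Hom (Ct S) (prev X) (prev Y) \<and> f \<cdot>\<^bsub>B\<^esub> str X = str Y \<cdot>\<^bsub>B\<^esub> RL (prev X) (prev Y) f"
    and obj: "\<And>X. X \<in> Obj N \<Longrightarrow> prev X \<in> Obj (Ct S)"
    and str: "\<And>X. X \<in> Obj N \<Longrightarrow> str X \<in> Hom B (ob (Rf J) (ob (Lf S) (prev X))) (base (prev X))"
  shows "category N"
proof
  show "Ide N X \<in> Hom N X X" if X: "X \<in> Obj N" for X
    unfolding Hom using X S.B.ide_hom[OF obj[OF X]] square_ide[OF obj[OF X] str[OF X]]
    by (simp add: Ide)
  show "g \<cdot>\<^bsub>N\<^esub> f \<in> Hom N X Z" if "f \<in> Hom N X Y" and "g \<in> Hom N Y Z" for X Y Z f g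
  proof -
    have f: "X \<in> Obj N" "Y \<in> Obj N" "f \<in> Hom (Ct S) (prev X) (prev Y)"
        "f \<cdot>\<^bsub>B\<^esub> str X = str Y \<cdot>\<^bsub>B\<^esub> RL (prev X) (prev Y) f"
      and g: "Z \<in> Obj N" "g \<in> Hom (Ct S) (prev Y) (prev Z)"
        "g \<cdot>\<^bsub>B\<^esub> str Y = str Z \<cdot>\<^bsub>B\<^esub> RL (prev Y) (prev Z) g"
      using that by (simp_all add: Hom)
    show ?thesis
      unfolding Hom Comp
      using f(1) g(1) S.B.comp_hom[OF f(3) g(2)]
        square_comp[OF f(3) g(2) str[OF f(1)] str[OF f(2)] str[OF g(1)] f(4) g(3)] by simp
  qed
qed (auto simp: Hom Ide Comp S.B.ide_left[simplified] S.B.ide_right[simplified]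
    intro: S.B.comp_assoc[simplified])

lemma dec_str_hom:
  assumes "X \<in> Obj (dec_cat B J S)"
  shows "prev X \<in> Obj (Ct S)" and "str X \<in> Hom B (ob (Rf J) (ob (Lf S) (prev X))) (base (prev X))"
  using assms dec_cat_sel(1)[of "prev X" "str X"] dec_cat_sel(2)[OF assms] by metis+

lemma category_dec_cat: "category (dec_cat B J S)"
  using dec_cat_sel(5,4,3) dec_str_hom by (rule category_of_squares)

lemma em_str_hom:
  assumes "X \<in> Obj (em_cat (Ct S) (monad_of S))"
  shows "prev X \<in> Obj (Ct S)" and "str X \<in> Hom (Ct S) (ob (Rf S) (ob (Lf S) (prev X))) (prev X)"
    and "str X \<in> Hom B (ob (Rf J) (ob (Lf S) (prev X))) (base (prev X))"
proof -
  show X: "prev X \<in> Obj (Ct S)"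
    and u: "str X \<in> Hom (Ct S) (ob (Rf S) (ob (Lf S) (prev X))) (prev X)"
    using assms em_cat_sel(1)[of "prev X" "str X"] em_cat_sel(2)[OF assms] by metis+
  show "str X \<in> Hom B (ob (Rf J) (ob (Lf S) (prev X))) (base (prev X))"
    using hom_base[OF u] base_R[OF S.L.ob_obj[OF X]] by simp
qed

lemma category_em_cat: "category (em_cat (Ct S) (monad_of S))"
  using em_cat_sel(5,4,3) em_str_hom(1,3) by (rule category_of_squares)

text \<open>
  With this naturality square, \<open>R \<epsilon>\<^sub>S\<close> is a structure arrow with which the right adjoint lifts to the
  next stage, in either tower.
\<close>

lemma struct_square:
  assumes f: "f \<in> Hom A Y Z"
  shows "ar (Rf J) Y Z f \<cdot>\<^bsub>B\<^esub> ar (Rf J) (ob (Lf S) (ob (Rf S) Y)) Y (eps S Y) =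
    ar (Rf J) (ob (Lf S) (ob (Rf S) Z)) Z (eps S Z) \<cdot>\<^bsub>B\<^esub>
      RL (ob (Rf S) Y) (ob (Rf S) Z) (ar (Rf J) Y Z f)"
proof -
  have Y: "Y \<in> Obj A" and Z: "Z \<in> Obj A" using J.A.hom_dom[OF f] J.A.hom_cod[OF f] .
  note Rf = S.R.ar_hom[OF f, simplified]
  show ?thesis
    using J.R.ar_comp[OF S.eps_hom[OF Y] f] S.eps_natural[OF f]
      J.R.ar_comp[OF S.L.ar_hom[OF Rf] S.eps_hom[OF Z]] by simp
qed

text \<open>
  This identifies the right-hand side of the square which the transpose of \<open>f\<close> has to satisfy in order
  to be a morphism into \<open>(R Z, R \<epsilon>\<^sub>Z)\<close>; the condition becomes the one in \<open>coequalizes_iff\<close>.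
\<close>

lemma struct_transpose:
  assumes X: "X \<in> Obj (Ct S)" and f: "f \<in> Hom A (ob (Lf S) X) Z"
  shows "ar (Rf J) (ob (Lf S) (ob (Rf S) Z)) Z (eps S Z) \<cdot>\<^bsub>B\<^esub>
    RL X (ob (Rf S) Z) (S.transpose X Z f) = ar (Rf J) (ob (Lf S) X) Z f"
proof -
  have Z: "Z \<in> Obj A" using J.A.hom_cod[OF f] .
  note t = S.transpose_hom[OF X f]
  show ?thesis
    using J.R.ar_comp[OF S.L.ar_hom[OF t] S.eps_hom[OF Z]] S.cotranspose_transpose[OF X f] by simp
qed

lemma next_R_dec: "is_functor A (dec_cat B J S) (next_R S (dec_struct J S))"
proof -
  have obj: "ob (next_R S (dec_struct J S)) Y \<in> Obj (dec_cat B J S)" if Y: "Y \<in> Obj A" for Y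
    using S.R.ob_obj[OF Y] J.R.ar_hom[OF S.eps_hom[OF Y]] base_R[OF Y]
    by (simp add: next_R_def dec_struct_def dec_cat_sel)
  show ?thesis
  proof (intro is_functor.intro is_functor_axioms.intro)
    show "category A" ..
    show "category (dec_cat B J S)" by (rule category_dec_cat)
    show "ar (next_R S (dec_struct J S)) X Y f \<in> Hom (dec_cat B J S)
        (ob (next_R S (dec_struct J S)) X) (ob (next_R S (dec_struct J S)) Y)"
      if f: "f \<in> Hom A X Y" for X Y f
      using obj[OF J.A.hom_dom[OF f]] obj[OF J.A.hom_cod[OF f]] S.R.ar_hom[OF f] struct_square[OF f]
      by (simp add: dec_cat_sel(3) next_R_def dec_struct_def)
  qed (use obj S.R.ar_ide S.R.ar_comp in \<open>auto simp: next_R_def dec_cat_sel(4,5)\<close>)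
qed

lemma next_R_em: "is_functor A (em_cat (Ct S) (monad_of S)) (next_R S (dec_struct J S))"
  (is "is_functor A ?C _")
proof -
  have obj: "ob (next_R S (dec_struct J S)) Y \<in> Obj ?C" if Y: "Y \<in> Obj A" for Y
    using S.R.ob_obj[OF Y] S.R.ar_hom[OF S.eps_hom[OF Y]] S.triangle_R[OF Y]
      struct_square[OF S.eps_hom[OF Y]]
    by (simp add: next_R_def dec_struct_def em_cat_sel)
  show ?thesis
  proof (intro is_functor.intro is_functor_axioms.intro)
    show "category A" ..
    show "category ?C" by (rule category_em_cat)
    show "ar (next_R S (dec_struct J S)) X Y f \<in> Hom ?C
        (ob (next_R S (dec_struct J S)) X) (ob (next_R S (dec_struct J S)) Y)"
      if f: "f \<in> Hom A X Y" for X Y f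
      using obj[OF J.A.hom_dom[OF f]] obj[OF J.A.hom_cod[OF f]] S.R.ar_hom[OF f] struct_square[OF f]
      by (simp add: em_cat_sel(3) next_R_def dec_struct_def)
  qed (use obj S.R.ar_ide S.R.ar_comp in \<open>auto simp: next_R_def em_cat_sel(4,5)\<close>)
qed

end

lemma chosen_coeq:
  assumes "coeq_choice C cq" and "has_coeqs C" and "f \<in> Hom C X Y" and "g \<in> Hom C X Y"
  shows "is_coeq C X Y f g (fst (cq X Y f g)) (snd (cq X Y f g))"
proof -
  have "\<exists>Q q. is_coeq C X Y f g Q q" using assms(2-4) by (simp add: has_coeqs_def)
  then show ?thesis using assms(1) by (simp add: coeq_choice_def)
qed

locale dec_tower_stage =
  tower_stage A B J S
  for A :: "('a, 'k) cat" and B :: "('o, 'm) cat" and J :: "('a, 'k, 'o, 'm) adj"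
    and S :: "('a, 'k, 'o, 'm) dec_stage" +
  assumes pr_regular: "X \<in> Obj (Ct S) \<Longrightarrow>
      regular_epi_composite A (ob (Lf J) (base X)) (ob (Lf S) X) (pr S X)"
    and pr_eta: "X \<in> Obj (Ct S) \<Longrightarrow> J.transpose (base X) (ob (Lf S) X) (pr S X) = eta S X"
begin

lemma pr_hom: "X \<in> Obj (Ct S) \<Longrightarrow> pr S X \<in> Hom A (ob (Lf J) (base X)) (ob (Lf S) X)"
  using epi_hom[OF J.A.regular_epi_composite_epi[OF pr_regular]] .

text \<open>
  By \<open>pr_eta\<close>, the transpose of \<open>\<pi>\<^bsub>[n]\<^esub>\<close> under \<open>(L, R)\<close> is the unit of the stage; that is, \<open>\<pi>\<^bsub>[n]\<^esub>\<close> is the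
  mate of the identity \<open>U\<^bsub>[n]\<^esub> R\<^bsub>[n]\<^esub> = R\<close>. Its naturality and its compatibility with the counits follow
  by transposition.
\<close>

lemma pr_natural:
  assumes f: "f \<in> Hom (Ct S) X Y"
  shows "ar (Lf S) X Y f \<cdot>\<^bsub>A\<^esub> pr S X = pr S Y \<cdot>\<^bsub>A\<^esub> ar (Lf J) (base X) (base Y) f"
proof -
  have X: "X \<in> Obj (Ct S)" and Y: "Y \<in> Obj (Ct S)" using S.B.hom_dom[OF f] S.B.hom_cod[OF f] .
  note f' = hom_base[OF f]
  show ?thesis
    using J.transpose_inject[OF base_obj[OF X] J.A.comp_hom[OF pr_hom[OF X] S.L.ar_hom[OF f]]
        J.A.comp_hom[OF J.L.ar_hom[OF f'] pr_hom[OF Y]]]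
      J.transpose_comp_left[OF base_obj[OF X] pr_hom[OF X] S.L.ar_hom[OF f]]
      J.transpose_comp_right[OF pr_hom[OF Y] f'] pr_eta[OF X] pr_eta[OF Y] S.eta_natural[OF f]
    by simp
qed

lemma pr_eps:
  assumes Y: "Y \<in> Obj A"
  shows "eps S Y \<cdot>\<^bsub>A\<^esub> pr S (ob (Rf S) Y) = eps J Y"
proof -
  note RY = S.R.ob_obj[OF Y] and b = base_R[OF Y]
  note p = pr_hom[OF RY, unfolded b]
  show ?thesis
    using J.transpose_inject[OF J.R.ob_obj[OF Y] J.A.comp_hom[OF p S.eps_hom[OF Y]] J.eps_hom[OF Y]]
      J.transpose_comp_left[OF J.R.ob_obj[OF Y] p S.eps_hom[OF Y]] pr_eta[OF RY] S.triangle_R[OF Y]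
      J.triangle_R[OF Y] Ide_base[OF RY] b by simp
qed

lemma dec_coeq_is_coeq:
  assumes "coeq_choice A cq" and "has_coeqs A" and X: "X \<in> Obj (dec_cat B J S)"
  shows "is_coeq A (ob (Lf J) (ob (Rf J) (ob (Lf S) (prev X)))) (ob (Lf S) (prev X))
    (pr S (prev X) \<cdot>\<^bsub>A\<^esub> ar (Lf J) (ob (Rf J) (ob (Lf S) (prev X))) (base (prev X)) (str X))
    (eps J (ob (Lf S) (prev X))) (fst (dec_coeq A J cq S X)) (snd (dec_coeq A J cq S X))"
  using chosen_coeq[OF assms(1,2) J.A.comp_hom[OF J.L.ar_hom[OF dec_str_hom(2)[OF X]]
        pr_hom[OF dec_str_hom(1)[OF X]]] J.eps_hom[OF S.L.ob_obj[OF dec_str_hom(1)[OF X]]]]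
    Ug_ob[OF dec_str_hom(1)[OF X]]
  by (simp add: dec_coeq_def Let_def)

lemma next_stage_dec:
  assumes "coeq_choice A cq" and "has_coeqs A"
  shows "next_stage A S (dec_cat B J S) (dec_coeq A J cq S) (dec_struct J S)"
proof (intro next_stage.intro next_stage_axioms.intro)
  show "adj_pair A (Ct S) S" ..
  show "category (dec_cat B J S)" by (rule category_dec_cat)
  show "is_functor A (dec_cat B J S) (next_R S (dec_struct J S))" by (rule next_R_dec)
next
  fix X assume X: "X \<in> Obj (dec_cat B J S)"
  note V = dec_str_hom(1)[OF X] and u = dec_str_hom(2)[OF X]
  have "f \<cdot>\<^bsub>A\<^esub> (pr S (prev X) \<cdot>\<^bsub>A\<^esub> ar (Lf J) (ob (Rf J) (ob (Lf S) (prev X))) (base (prev X)) (str X)) =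
        f \<cdot>\<^bsub>A\<^esub> eps J (ob (Lf S) (prev X)) \<longleftrightarrow>
      S.transpose (prev X) Y f \<in> Hom (dec_cat B J S) X (ob (next_R S (dec_struct J S)) Y)"
    if f: "f \<in> Hom A (ob (Lf S) (prev X)) Y" for Y f
    using J.coequalizes_iff[OF pr_hom[OF V] u f] struct_transpose[OF V f]
      is_functor.ob_obj[OF next_R_dec J.A.hom_cod[OF f]] X S.transpose_hom[OF V f] pr_eta[OF V]
    by (simp add: dec_cat_sel(3)) (auto simp: next_R_def dec_struct_def)
  then show "\<exists>W u v. is_coeq A W (ob (Lf S) (prev X)) u v
         (fst (dec_coeq A J cq S X)) (snd (dec_coeq A J cq S X)) \<and>
      (\<forall>Y. \<forall>f\<in>Hom A (ob (Lf S) (prev X)) Y. f \<cdot>\<^bsub>A\<^esub> u = f \<cdot>\<^bsub>A\<^esub> v \<longleftrightarrow>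
         S.transpose (prev X) Y f \<in> Hom (dec_cat B J S) X (ob (next_R S (dec_struct J S)) Y))"
    using dec_coeq_is_coeq[OF assms X] by blast
qed (auto simp: dec_cat_sel(3-5))

text \<open>
  On objects of the form \<open>L\<^bsub>[n]\<^esub> X\<close> the counit \<open>\<epsilon>\<^bsub>[n]\<^esub>\<close> is a split epimorphism by the triangle identity,
  and \<open>\<epsilon>\<close> is \<open>\<epsilon>\<^bsub>[n]\<^esub>\<close> after a component of \<open>\<pi>\<^bsub>[n]\<^esub>\<close>. This is what makes the hypothesis on coequalizers of
  pairs \<open>(f e, f)\<close> applicable to \<open>f = F \<epsilon>\<close>.
\<close>

lemma eps_L_regular:
  assumes X: "X \<in> Obj (Ct S)"
  shows "regular_epi_composite A (ob (Lf J) (ob (Rf J) (ob (Lf S) X))) (ob (Lf S) X)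
    (eps J (ob (Lf S) X))"
proof -
  note LX = S.L.ob_obj[OF X]
  note RLX = S.R.ob_obj[OF LX] and e = S.eta_hom[OF X]
  have "regular_epi A (ob (Lf S) (ob (Rf S) (ob (Lf S) X))) (ob (Lf S) X) (eps S (ob (Lf S) X))"
    using J.A.split_epi_regular[OF S.eps_hom[OF LX] S.L.ar_hom[OF e] S.triangle_L[OF X]] .
  then show ?thesis
    using regular_epi_composite.compose[OF pr_regular[OF RLX]] pr_eps[OF LX] base_R[OF LX] by metis
qed

end

lemma (in tower_stage) next_stage_mon:
  assumes "coeq_choice A cq" and "has_coeqs A"
    and qu: "\<And>X. qu X = (let Y = ob (Lf S) (prev X); RY = ob (Rf S) Y
     in cq (ob (Lf S) RY) Y (ar (Lf S) RY (prev X) (str X)) (eps S Y))"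
  shows "next_stage A S (em_cat (Ct S) (monad_of S)) qu (dec_struct J S)"
proof (intro next_stage.intro next_stage_axioms.intro)
  show "adj_pair A (Ct S) S" ..
  show "category (em_cat (Ct S) (monad_of S))" by (rule category_em_cat)
  show "is_functor A (em_cat (Ct S) (monad_of S)) (next_R S (dec_struct J S))" by (rule next_R_em)
next
  fix X assume X: "X \<in> Obj (em_cat (Ct S) (monad_of S))"
  note V = em_str_hom(1)[OF X] and u = em_str_hom(2)[OF X]
  note LV = S.L.ob_obj[OF V]
  have "f \<cdot>\<^bsub>A\<^esub> ar (Lf S) (ob (Rf S) (ob (Lf S) (prev X))) (prev X) (str X) =
        f \<cdot>\<^bsub>A\<^esub> eps S (ob (Lf S) (prev X)) \<longleftrightarrow>
      S.transpose (prev X) Y f \<in> Hom (em_cat (Ct S) (monad_of S)) X (ob (next_R S (dec_struct J S)) Y)"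
    if f: "f \<in> Hom A (ob (Lf S) (prev X)) Y" for Y f
    using S.coequalizes_iff[OF J.A.ide_hom[OF LV] u f] struct_transpose[OF V f]
      is_functor.ob_obj[OF next_R_em J.A.hom_cod[OF f]] X S.transpose_hom[OF V f]
      J.A.ide_left[OF S.L.ar_hom[OF u]] S.R.ar_ide[OF LV] S.B.ide_left[OF S.eta_hom[OF V]]
    by (simp add: em_cat_sel(3)) (auto simp: next_R_def dec_struct_def)
  moreover have "is_coeq A (ob (Lf S) (ob (Rf S) (ob (Lf S) (prev X)))) (ob (Lf S) (prev X))
      (ar (Lf S) (ob (Rf S) (ob (Lf S) (prev X))) (prev X) (str X))
      (eps S (ob (Lf S) (prev X))) (fst (qu X)) (snd (qu X))"
    using chosen_coeq[OF assms(1,2) S.L.ar_hom[OF u] S.eps_hom[OF LV]] by (simp add: qu Let_def)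
  ultimately show "\<exists>W u v. is_coeq A W (ob (Lf S) (prev X)) u v (fst (qu X)) (snd (qu X)) \<and>
      (\<forall>Y. \<forall>f\<in>Hom A (ob (Lf S) (prev X)) Y. f \<cdot>\<^bsub>A\<^esub> u = f \<cdot>\<^bsub>A\<^esub> v \<longleftrightarrow>
         S.transpose (prev X) Y f \<in> Hom (em_cat (Ct S) (monad_of S)) X (ob (next_R S (dec_struct J S)) Y))"
    by blast
qed (auto simp: em_cat_sel(3-5))

section \<open>The two towers\<close>

locale towers = J: adj_pair A B J
  for A :: "('a, 'k) cat" and B :: "('o, 'm) cat" and J :: "('a, 'k, 'o, 'm) adj" +
  fixes cq :: "('a, 'k) coeq_fun"
  assumes choice: "coeq_choice A cq" and coeqs: "has_coeqs A"
begin

lemma tagged_cat_sel: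
  "Base X \<in> Obj (tagged_cat B) \<longleftrightarrow> X \<in> Obj B"
  "V \<in> Obj (tagged_cat B) \<Longrightarrow> V = Base (base V)"
  "f \<in> Hom (tagged_cat B) V W \<longleftrightarrow> V \<in> Obj (tagged_cat B) \<and> W \<in> Obj (tagged_cat B) \<and>
     f \<in> Hom B (base V) (base W)"
  "Ide (tagged_cat B) V = Ide B (base V)"
  "Comp (tagged_cat B) = Comp B"
  using J.B.hom_dom J.B.hom_cod by (auto simp: tagged_cat_def image_iff)

lemma base_tagged: "V \<in> Obj (tagged_cat B) \<Longrightarrow> base V \<in> Obj B"
  using tagged_cat_sel(1,2) by metis

lemma category_tagged: "category (tagged_cat B)"
  by unfold_locales
    (auto simp: tagged_cat_sel(3-5) base_tagged
      intro: J.B.ide_hom J.B.ide_left J.B.ide_right J.B.comp_assoc J.B.comp_hom)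

lemma is_functor_tag: "is_functor B (tagged_cat B) tag"
  using category_tagged J.B.hom_dom J.B.hom_cod
  by (auto simp: is_functor_def is_functor_axioms_def tag_def tagged_cat_sel J.B.category_axioms)

lemma base_tower_stage:
  fixes S :: "('a, 'k, 'o, 'm, 'z) stage_scheme"
  assumes S: "Lf S = Lf J \<circ>\<^sub>F untag" "Rf S = tag \<circ>\<^sub>F Rf J" "eta S = (\<lambda>X. eta J (base X))"
    "eps S = eps J" "Ct S = tagged_cat B" "Ug S = untag"
  shows "tower_stage A B J S"
proof -
  have "adjunction A (tagged_cat B) S"
  proof (rule adjunction_from_universal_arrows)
    show "is_functor A (tagged_cat B) (Rf S)"
      unfolding S using is_functor_comp[OF J.R_functor is_functor_tag] .
  next
    fix X assume "X \<in> Obj (tagged_cat B)"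
    then have X: "X = Base (base X)" "base X \<in> Obj B" "X \<in> Obj (tagged_cat B)"
      using tagged_cat_sel(2) base_tagged by auto
    show "ob (Lf S) X \<in> Obj A" using J.L.ob_obj[OF X(2)] by (simp add: S untag_def)
    show "eta S X \<in> Hom (tagged_cat B) X (ob (Rf S) (ob (Lf S) X))"
      using J.eta_hom[OF X(2)] X(3) J.R.ob_obj[OF J.L.ob_obj[OF X(2)]]
      by (simp add: S untag_def tag_def tagged_cat_sel(1,3))
    show "k = k'" if "k \<in> Hom A (ob (Lf S) X) Y" "k' \<in> Hom A (ob (Lf S) X) Y"
      "ar (Rf S) (ob (Lf S) X) Y k \<cdot>\<^bsub>tagged_cat B\<^esub> eta S X =
       ar (Rf S) (ob (Lf S) X) Y k' \<cdot>\<^bsub>tagged_cat B\<^esub> eta S X" for Y k k'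
      using that J.transpose_inject[OF X(2)] by (simp add: S untag_def tag_def tagged_cat_sel(5))
  next
    fix X Y f assume "f \<in> Hom (tagged_cat B) X Y"
    then have f: "f \<in> Hom B (base X) (base Y)" by (simp add: tagged_cat_sel(3))
    show "ar (Lf S) X Y f \<in> Hom A (ob (Lf S) X) (ob (Lf S) Y)"
      using J.L.ar_hom[OF f] by (simp add: S untag_def)
    show "ar (Rf S) (ob (Lf S) X) (ob (Lf S) Y) (ar (Lf S) X Y f) \<cdot>\<^bsub>tagged_cat B\<^esub> eta S X =
        eta S Y \<cdot>\<^bsub>tagged_cat B\<^esub> f"
      using J.eta_natural[OF f] by (simp add: S untag_def tag_def tagged_cat_sel(5))
  next
    fix Y assume Y: "Y \<in> Obj A"
    show "eps S Y \<in> Hom A (ob (Lf S) (ob (Rf S) Y)) Y"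
      using J.eps_hom[OF Y] by (simp add: S untag_def tag_def)
    show "ar (Rf S) (ob (Lf S) (ob (Rf S) Y)) Y (eps S Y) \<cdot>\<^bsub>tagged_cat B\<^esub> eta S (ob (Rf S) Y) =
        Ide (tagged_cat B) (ob (Rf S) Y)"
      using J.triangle_R[OF Y] by (simp add: S untag_def tag_def tagged_cat_sel(4,5))
  qed
  then have "adj_pair A (Ct S) S" by (simp add: adj_pair_def S)
  moreover have "tower_stage_axioms A B J S"
    by unfold_locales (auto simp: S untag_def tag_def tagged_cat_sel(3-5) fun_eq_iff)
  ultimately show ?thesis using J.adj_pair_axioms by (simp add: tower_stage_def)
qed

abbreviation "Dec n \<equiv> dec A B J cq n"
abbreviation "Mon n \<equiv> mon A B J cq n"

lemma dec_Suc_sel: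
  "Lf (Dec (Suc n)) = next_L A (Dec n) (dec_coeq A J cq (Dec n))"
  "Rf (Dec (Suc n)) = next_R (Dec n) (dec_struct J (Dec n))"
  "eta (Dec (Suc n)) = next_eta (Dec n) (dec_coeq A J cq (Dec n))"
  "eps (Dec (Suc n)) = next_eps A (Dec n) (dec_coeq A J cq (Dec n)) (dec_struct J (Dec n))"
  "Ct (Dec (Suc n)) = dec_cat B J (Dec n)"
  "Ug (Dec (Suc n)) = Ug (Dec n) \<circ>\<^sub>F forget"
  "pr (Dec (Suc n)) X = snd (dec_coeq A J cq (Dec n) X) \<cdot>\<^bsub>A\<^esub> pr (Dec n) (prev X)"
  by (simp_all add: Let_def)

text \<open>
  The right adjoints of all stages agree with \<open>R\<close> on arrows, so both towers use the same formula for
  the structure arrow of \<open>R\<^bsub>n+1\<^esub> Y\<close>.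
\<close>

lemma mon_struct_eq: "mon_struct (Mon n) = dec_struct J (Mon n)"
proof -
  have "ar (Rf (Mon n)) = ar (Rf J)"
    by (induction n) (simp_all add: tag_def fun_eq_iff Let_def next_R_def)
  then show ?thesis by (simp add: mon_struct_def dec_struct_def)
qed

lemma mon_Suc_sel:
  "Lf (Mon (Suc n)) = next_L A (Mon n) (mon_coeq cq (Mon n))"
  "Rf (Mon (Suc n)) = next_R (Mon n) (dec_struct J (Mon n))"
  "eta (Mon (Suc n)) = next_eta (Mon n) (mon_coeq cq (Mon n))"
  "eps (Mon (Suc n)) = next_eps A (Mon n) (mon_coeq cq (Mon n)) (dec_struct J (Mon n))"
  "Ct (Mon (Suc n)) = em_cat (Ct (Mon n)) (monad_of (Mon n))"
  "Ug (Mon (Suc n)) = Ug (Mon n) \<circ>\<^sub>F forget"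
  by (simp_all add: Let_def mon_struct_eq)

lemma mon_tower_stage: "tower_stage A B J (Mon n)"
proof (induction n)
  case 0
  show ?case by (rule base_tower_stage) simp_all
next
  case (Suc n)
  interpret M: tower_stage A B J "Mon n" by (rule Suc.IH)
  have "next_stage A (Mon n) (em_cat (Ct (Mon n)) (monad_of (Mon n))) (mon_coeq cq (Mon n))
      (dec_struct J (Mon n))"
    using choice coeqs by (rule M.next_stage_mon) (simp add: mon_coeq_def)
  moreover have "base (prev X) = base X" if "X \<in> Obj (em_cat (Ct (Mon n)) (monad_of (Mon n)))" for X
    using M.em_cat_sel(2)[OF that] by (metis base.simps(2))
  ultimately show ?case
    using mon_Suc_sel by (rule M.next_tower_stage)
qed

lemma dec_tower_stage: "dec_tower_stage A B J (Dec n)"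
proof (induction n)
  case 0
  interpret D: tower_stage A B J "Dec 0" by (rule base_tower_stage) simp_all
  show ?case
  proof
    fix X assume "X \<in> Obj (Ct (Dec 0))"
    then have bX: "base X \<in> Obj B" using base_tagged by simp
    then show "regular_epi_composite A (ob (Lf J) (base X)) (ob (Lf (Dec 0)) X) (pr (Dec 0) X)"
      and "J.transpose (base X) (ob (Lf (Dec 0)) X) (pr (Dec 0) X) = eta (Dec 0) X"
      using J.A.ide_regular_epi[OF J.L.ob_obj[OF bX]] J.R.ar_ide[OF J.L.ob_obj[OF bX]]
        J.B.ide_left[OF J.eta_hom[OF bX]]
      by (auto simp: untag_def intro: regular_epi_composite.single)
  qed
next
  case (Suc n)
  interpret D: dec_tower_stage A B J "Dec n" by (rule Suc.IH)
  interpret N: next_stage A "Dec n" "dec_cat B J (Dec n)" "dec_coeq A J cq (Dec n)" "dec_struct J (Dec n)"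
    using choice coeqs by (rule D.next_stage_dec)
  have base: "base (prev X) = base X" if "X \<in> Obj (dec_cat B J (Dec n))" for X
    using D.dec_cat_sel(2)[OF that] by (metis base.simps(2))
  interpret T: tower_stage A B J "Dec (Suc n)"
    using N.next_stage_axioms base dec_Suc_sel(1-6) by (rule D.next_tower_stage)
  show ?case
  proof
    fix X assume "X \<in> Obj (Ct (Dec (Suc n)))"
    then have X: "X \<in> Obj (dec_cat B J (Dec n))" by (simp only: dec_Suc_sel)
    note V = N.prev_obj[OF X]
    show "regular_epi_composite A (ob (Lf J) (base X)) (ob (Lf (Dec (Suc n))) X) (pr (Dec (Suc n)) X)"
      using regular_epi_composite.compose[OF D.pr_regular[OF V] N.p_regular[OF X]] base[OF X]
      unfolding dec_Suc_sel by (simp add: next_L_def)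
    show "J.transpose (base X) (ob (Lf (Dec (Suc n))) X) (pr (Dec (Suc n)) X) = eta (Dec (Suc n)) X"
      using J.transpose_comp_left[OF D.base_obj[OF V] D.pr_hom[OF V] N.p_hom[OF X]]
        D.pr_eta[OF V] base[OF X]
      unfolding dec_Suc_sel by (simp add: next_L_def next_eta_def)
  qed
qed

end

section \<open>Comparison of the two towers\<close>

text \<open>
  Full faithfulness of \<open>\<Lambda>\<close> and \<open>\<Lambda> R\<^sub>n = R\<^bsub>[n]\<^esub>\<close> together say that \<open>L\<^bsub>[n]\<^esub> \<Lambda>\<close> and \<open>L\<^sub>n\<close> are left
  adjoint to the same functor \<open>R\<^sub>n\<close>, and \<open>\<lambda>\<^sub>n\<close> is the resulting isomorphism. Each of its properties is
  checked on transposes, since composition with \<open>R \<lambda>\<^sub>n\<close> turns one unit into the other.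
\<close>

locale comparison = D: tower_stage A B J D + M: tower_stage A B J M
  for A :: "('a, 'k) cat" and B :: "('o, 'm) cat" and J :: "('a, 'k, 'o, 'm) adj"
    and D :: "('a, 'k, 'o, 'm) dec_stage" and M :: "('a, 'k, 'o, 'm) stage" +
  fixes Lm :: "(('o, 'm) tower_obj, 'm, ('o, 'm) tower_obj, 'm) ftr"
  assumes Lm_ar [simp]: "ar Lm V W f = f"
    and Lm_obj: "V \<in> Obj (Ct M) \<Longrightarrow> ob Lm V \<in> Obj (Ct D)"
    and Lm_base: "V \<in> Obj (Ct M) \<Longrightarrow> base (ob Lm V) = base V"
    and Lm_hom: "V \<in> Obj (Ct M) \<Longrightarrow> W \<in> Obj (Ct M) \<Longrightarrow>
      Hom (Ct D) (ob Lm V) (ob Lm W) = Hom (Ct M) V W"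
    and Lm_R: "Y \<in> Obj A \<Longrightarrow> ob Lm (ob (Rf M) Y) = ob (Rf D) Y"
begin

abbreviation "lm \<equiv> lam_of A D M Lm"
abbreviation "LD V \<equiv> ob (Lf D) (ob Lm V)"

lemma LD_obj: "V \<in> Obj (Ct M) \<Longrightarrow> LD V \<in> Obj A"
  using D.S.L.ob_obj[OF Lm_obj] .

lemma Lm_arr:
  assumes "f \<in> Hom (Ct M) V W"
  shows "f \<in> Hom (Ct D) (ob Lm V) (ob Lm W)"
  using assms Lm_hom[OF M.S.B.hom_dom[OF assms] M.S.B.hom_cod[OF assms]] by simp

lemma Lm_hom_R:
  "V \<in> Obj (Ct M) \<Longrightarrow> Y \<in> Obj A \<Longrightarrow> Hom (Ct D) (ob Lm V) (ob (Rf D) Y) = Hom (Ct M) V (ob (Rf M) Y)"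
  using Lm_hom[OF _ M.S.R.ob_obj] Lm_R by metis

lemma eta_M_hom:
  "V \<in> Obj (Ct M) \<Longrightarrow> eta M V \<in> Hom (Ct D) (ob Lm V) (ob (Rf D) (ob (Lf M) V))"
  using M.S.eta_hom Lm_hom_R M.S.L.ob_obj by metis

lemma eta_D_hom:
  "V \<in> Obj (Ct M) \<Longrightarrow> eta D (ob Lm V) \<in> Hom (Ct M) V (ob (Rf M) (LD V))"
  using D.S.eta_hom Lm_hom_R Lm_obj D.S.L.ob_obj by metis

lemma lm_cotranspose:
  assumes "V \<in> Obj (Ct M)"
  shows "lm V = D.S.cotranspose (ob Lm V) (ob (Lf M) V) (eta M V)"
  using Lm_R[OF M.S.L.ob_obj[OF assms]] by (simp add: lam_of_def Let_def)

lemma lm_hom: "V \<in> Obj (Ct M) \<Longrightarrow> lm V \<in> Hom A (LD V) (ob (Lf M) V)"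
  using D.S.cotranspose_hom[OF eta_M_hom M.S.L.ob_obj] lm_cotranspose by simp

lemma lm_eta:
  "V \<in> Obj (Ct M) \<Longrightarrow> ar (Rf J) (LD V) (ob (Lf M) V) (lm V) \<cdot>\<^bsub>B\<^esub> eta D (ob Lm V) = eta M V"
  using D.S.transpose_cotranspose[OF eta_M_hom M.S.L.ob_obj] lm_cotranspose by simp

text \<open>
  The inverse of \<open>\<lambda>\<^sub>n\<close>: the same formula with the roles of the two adjunctions exchanged.
\<close>

definition lm_inv :: "('o, 'm) tower_obj \<Rightarrow> 'k" where
  "lm_inv V = M.S.cotranspose V (LD V) (eta D (ob Lm V))"

lemma lm_inv_hom: "V \<in> Obj (Ct M) \<Longrightarrow> lm_inv V \<in> Hom A (ob (Lf M) V) (LD V)"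
  using M.S.cotranspose_hom[OF eta_D_hom LD_obj] by (simp add: lm_inv_def)

lemma lm_inv_eta:
  "V \<in> Obj (Ct M) \<Longrightarrow> ar (Rf J) (ob (Lf M) V) (LD V) (lm_inv V) \<cdot>\<^bsub>B\<^esub> eta M V = eta D (ob Lm V)"
  using M.S.transpose_cotranspose[OF eta_D_hom LD_obj] by (simp add: lm_inv_def)

lemma lm_inv_lm:
  assumes V: "V \<in> Obj (Ct M)"
  shows "lm_inv V \<cdot>\<^bsub>A\<^esub> lm V = Ide A (LD V)"
  using D.S.transpose_inject[OF Lm_obj[OF V] D.J.A.comp_hom[OF lm_hom[OF V] lm_inv_hom[OF V]]
      D.J.A.ide_hom[OF LD_obj[OF V]]]
    D.S.transpose_comp_left[OF Lm_obj[OF V] lm_hom[OF V] lm_inv_hom[OF V]] lm_eta[OF V] lm_inv_eta[OF V]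
    D.S.R.ar_ide[OF LD_obj[OF V]] D.S.B.ide_left[OF D.S.eta_hom[OF Lm_obj[OF V]]] by simp

lemma lm_lm_inv:
  assumes V: "V \<in> Obj (Ct M)"
  shows "lm V \<cdot>\<^bsub>A\<^esub> lm_inv V = Ide A (ob (Lf M) V)"
  using M.S.transpose_inject[OF V D.J.A.comp_hom[OF lm_inv_hom[OF V] lm_hom[OF V]]
      D.J.A.ide_hom[OF M.S.L.ob_obj[OF V]]]
    M.S.transpose_comp_left[OF V lm_inv_hom[OF V] lm_hom[OF V]] lm_eta[OF V] lm_inv_eta[OF V]
    M.S.R.ar_ide[OF M.S.L.ob_obj[OF V]] M.S.B.ide_left[OF M.S.eta_hom[OF V]] by simp

lemma lm_iso: "V \<in> Obj (Ct M) \<Longrightarrow> is_iso A (LD V) (ob (Lf M) V) (lm V)"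
  using lm_hom lm_inv_hom lm_lm_inv lm_inv_lm unfolding is_iso_def by blast

lemma lm_inv_natural:
  assumes f: "f \<in> Hom (Ct M) V W"
  shows "lm_inv W \<cdot>\<^bsub>A\<^esub> ar (Lf M) V W f = ar (Lf D) (ob Lm V) (ob Lm W) f \<cdot>\<^bsub>A\<^esub> lm_inv V"
proof -
  have V: "V \<in> Obj (Ct M)" and W: "W \<in> Obj (Ct M)" using M.S.B.hom_dom[OF f] M.S.B.hom_cod[OF f] .
  note Lf = D.S.L.ar_hom[OF Lm_arr[OF f]]
  show ?thesis
    using M.S.transpose_inject[OF V D.J.A.comp_hom[OF M.S.L.ar_hom[OF f] lm_inv_hom[OF W]]
        D.J.A.comp_hom[OF lm_inv_hom[OF V] Lf]]
      M.S.transpose_comp_right[OF lm_inv_hom[OF W] f] M.S.transpose_comp_left[OF V lm_inv_hom[OF V] Lf]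
      lm_inv_eta[OF V] lm_inv_eta[OF W] D.S.eta_natural[OF Lm_arr[OF f]] by simp
qed

lemma lm_natural:
  assumes f: "f \<in> Hom (Ct M) V W"
  shows "lm W \<cdot>\<^bsub>A\<^esub> ar (Lf D) (ob Lm V) (ob Lm W) f = ar (Lf M) V W f \<cdot>\<^bsub>A\<^esub> lm V"
proof -
  have V: "V \<in> Obj (Ct M)" and W: "W \<in> Obj (Ct M)" using M.S.B.hom_dom[OF f] M.S.B.hom_cod[OF f] .
  note f' = Lm_arr[OF f]
  note Lf = M.S.L.ar_hom[OF f]
  show ?thesis
    using D.S.transpose_inject[OF Lm_obj[OF V] D.J.A.comp_hom[OF D.S.L.ar_hom[OF f'] lm_hom[OF W]]
        D.J.A.comp_hom[OF lm_hom[OF V] Lf]]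
      D.S.transpose_comp_right[OF lm_hom[OF W] f'] D.S.transpose_comp_left[OF Lm_obj[OF V] lm_hom[OF V] Lf]
      lm_eta[OF V] lm_eta[OF W] M.S.eta_natural[OF f] by simp
qed

lemma eps_lm_inv:
  assumes Y: "Y \<in> Obj A"
  shows "eps D Y \<cdot>\<^bsub>A\<^esub> lm_inv (ob (Rf M) Y) = eps M Y"
proof -
  note RY = M.S.R.ob_obj[OF Y]
  note k = lm_inv_hom[OF RY, unfolded Lm_R[OF Y]] and e = D.S.eps_hom[OF Y]
  have "Ide (Ct M) (ob (Rf M) Y) = Ide (Ct D) (ob (Rf D) Y)"
    using M.Ide_base[OF RY] D.Ide_base[OF D.S.R.ob_obj[OF Y]] M.base_R[OF Y] D.base_R[OF Y] by simp
  then show ?thesis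
    using M.S.transpose_inject[OF RY D.J.A.comp_hom[OF k e] M.S.eps_hom[OF Y]]
      M.S.transpose_comp_left[OF RY k e] lm_inv_eta[OF RY] Lm_R[OF Y] D.S.triangle_R[OF Y]
      M.S.triangle_R[OF Y] by simp
qed

lemma eps_lm:
  assumes Y: "Y \<in> Obj A"
  shows "eps M Y \<cdot>\<^bsub>A\<^esub> lm (ob (Rf M) Y) = eps D Y"
proof -
  note RY = M.S.R.ob_obj[OF Y]
  note l = lm_hom[OF RY, unfolded Lm_R[OF Y]] and k = lm_inv_hom[OF RY, unfolded Lm_R[OF Y]]
  have "eps M Y \<cdot>\<^bsub>A\<^esub> lm (ob (Rf M) Y) = eps D Y \<cdot>\<^bsub>A\<^esub> (lm_inv (ob (Rf M) Y) \<cdot>\<^bsub>A\<^esub> lm (ob (Rf M) Y))"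
    using eps_lm_inv[OF Y] D.J.A.comp_assoc[OF l k D.S.eps_hom[OF Y]] by simp
  then show ?thesis
    using lm_inv_lm[OF RY] Lm_R[OF Y] D.J.A.ide_right[OF D.S.eps_hom[OF Y]] by simp
qed

abbreviation Rlm :: "('o, 'm) tower_obj \<Rightarrow> 'm" where
  "Rlm V \<equiv> ar (Rf J) (LD V) (ob (Lf M) V) (lm V)"

lemma Rlm_hom: "V \<in> Obj (Ct M) \<Longrightarrow> Rlm V \<in> Hom B (ob (Rf J) (LD V)) (ob (Rf J) (ob (Lf M) V))"
  using D.J.R.ar_hom[OF lm_hom] .

lemma Rlm_epi:
  assumes V: "V \<in> Obj (Ct M)"
  shows "epi B (ob (Rf J) (LD V)) (ob (Rf J) (ob (Lf M) V)) (Rlm V)"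
proof -
  have "Rlm V \<cdot>\<^bsub>B\<^esub> ar (Rf J) (ob (Lf M) V) (LD V) (lm_inv V) = Ide B (ob (Rf J) (ob (Lf M) V))"
    using D.J.R.ar_comp[OF lm_inv_hom[OF V] lm_hom[OF V]] lm_lm_inv[OF V]
      D.J.R.ar_ide[OF M.S.L.ob_obj[OF V]] by simp
  then show ?thesis
    using D.J.B.regular_epi_epi
      D.J.B.split_epi_regular[OF Rlm_hom[OF V] D.J.R.ar_hom[OF lm_inv_hom[OF V]]]
    by blast
qed

text \<open>
  By naturality of \<open>\<lambda>\<close>, the square defining a morphism of the adjoint decomposition between the images
  is the square of the monadic tower composed with \<open>R \<lambda>\<close>. As \<open>R \<lambda>\<close> is an epimorphism, the two
  conditions are equivalent, and full faithfulness passes to the next stage.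
\<close>

lemma next_comparison:
  assumes D': "tower_stage A B J D'" and M': "tower_stage A B J M'"
    and Ct_D': "Ct D' = dec_cat B J D" and Ct_M': "Ct M' = em_cat (Ct M) (monad_of M)"
    and R_D': "Rf D' = next_R D (dec_struct J D)" and R_M': "Rf M' = next_R M (dec_struct J M)"
    and Lm'_ob: "\<And>X. ob Lm' X = Ext (ob Lm (prev X)) (str X \<cdot>\<^bsub>B\<^esub> Rlm (prev X))"
    and Lm'_ar: "\<And>X Y f. ar Lm' X Y f = f"
  shows "comparison A B J D' M' Lm'"
proof -
  have str: "str X \<cdot>\<^bsub>B\<^esub> Rlm (prev X) \<in> Hom B (ob (Rf J) (LD (prev X))) (base (prev X))"
    if X: "X \<in> Obj (Ct M')" for X
    using D.J.B.comp_hom[OF Rlm_hom M.em_str_hom(3)] M.em_str_hom(1) X by (simp add: Ct_M')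
  have obj: "ob Lm' X \<in> Obj (Ct D')" if X: "X \<in> Obj (Ct M')" for X
    using X str[OF X] Lm_obj[OF M.em_str_hom(1)] Lm_base[OF M.em_str_hom(1)]
    by (simp add: Ct_M' Ct_D' Lm'_ob D.dec_cat_sel(1))
  have "comparison_axioms A D' M' Lm'"
  proof
    show "ar Lm' V W f = f" for V W f by (rule Lm'_ar)
    show "ob Lm' V \<in> Obj (Ct D')" if "V \<in> Obj (Ct M')" for V using obj[OF that] .
    show "base (ob Lm' V) = base V" if "V \<in> Obj (Ct M')" for V
      using that Lm_base[OF M.em_str_hom(1)] M.em_cat_sel(2)[of V] unfolding Ct_M' Lm'_ob
      by (metis base.simps(2))
    show "ob Lm' (ob (Rf M') Y) = ob (Rf D') Y" if Y: "Y \<in> Obj A" for Y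
    proof -
      note RY = M.S.R.ob_obj[OF Y]
      have "dec_struct J M Y \<cdot>\<^bsub>B\<^esub> Rlm (ob (Rf M) Y) = dec_struct J D Y"
        using D.J.R.ar_comp[OF lm_hom[OF RY] M.S.eps_hom[OF Y]] eps_lm[OF Y] Lm_R[OF Y]
        by (simp add: dec_struct_def)
      then show ?thesis using Lm_R[OF Y] by (simp add: Lm'_ob R_M' R_D' next_R_def)
    qed
  next
    fix X Y assume X': "X \<in> Obj (Ct M')" and Y': "Y \<in> Obj (Ct M')"
    have X: "prev X \<in> Obj (Ct M)" and Y: "prev Y \<in> Obj (Ct M)"
      and u: "str X \<in> Hom B (ob (Rf J) (ob (Lf M) (prev X))) (base (prev X))"
      and v: "str Y \<in> Hom B (ob (Rf J) (ob (Lf M) (prev Y))) (base (prev Y))"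
      using X' Y' M.em_str_hom by (simp_all add: Ct_M')
    have "f \<cdot>\<^bsub>B\<^esub> (str X \<cdot>\<^bsub>B\<^esub> Rlm (prev X)) =
          (str Y \<cdot>\<^bsub>B\<^esub> Rlm (prev Y)) \<cdot>\<^bsub>B\<^esub> D.RL (ob Lm (prev X)) (ob Lm (prev Y)) f \<longleftrightarrow>
        f \<cdot>\<^bsub>B\<^esub> str X = str Y \<cdot>\<^bsub>B\<^esub> M.RL (prev X) (prev Y) f"
      if f: "f \<in> Hom (Ct M) (prev X) (prev Y)" for f
    proof -
      note fB = M.hom_base[OF f] and RLf = D.RL_hom[OF Lm_arr[OF f]] and RMf = M.RL_hom[OF f]
      have "Rlm (prev Y) \<cdot>\<^bsub>B\<^esub> D.RL (ob Lm (prev X)) (ob Lm (prev Y)) f =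
          M.RL (prev X) (prev Y) f \<cdot>\<^bsub>B\<^esub> Rlm (prev X)"
        using D.J.R.ar_comp[OF D.S.L.ar_hom[OF Lm_arr[OF f]] lm_hom[OF Y]]
          D.J.R.ar_comp[OF lm_hom[OF X] M.S.L.ar_hom[OF f]] lm_natural[OF f] by simp
      then have "(str Y \<cdot>\<^bsub>B\<^esub> Rlm (prev Y)) \<cdot>\<^bsub>B\<^esub> D.RL (ob Lm (prev X)) (ob Lm (prev Y)) f =
          (str Y \<cdot>\<^bsub>B\<^esub> M.RL (prev X) (prev Y) f) \<cdot>\<^bsub>B\<^esub> Rlm (prev X)"
        using D.J.B.comp_assoc[OF RLf Rlm_hom[OF Y] v] D.J.B.comp_assoc[OF Rlm_hom[OF X] RMf v]
        by simp
      then show ?thesis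
        using D.J.B.comp_assoc[OF Rlm_hom[OF X] u fB]
          epi_cancel[OF Rlm_epi[OF X] D.J.B.comp_hom[OF u fB] D.J.B.comp_hom[OF RMf v]] by auto
    qed
    then show "Hom (Ct D') (ob Lm' X) (ob Lm' Y) = Hom (Ct M') X Y"
      using obj[OF X'] obj[OF Y'] X' Y' Lm_hom[OF X Y]
      unfolding Ct_D' Ct_M' by (auto simp: D.dec_cat_sel(3) M.em_cat_sel(3) Lm'_ob)
  qed
  then show ?thesis using D' M' by (simp add: comparison_def)
qed

end

lemma (in towers) comparison: "comparison A B J (Dec n) (Mon n) (Lam A B J cq n)"
proof (induction n)
  case 0
  interpret D: dec_tower_stage A B J "Dec 0" by (rule dec_tower_stage)
  interpret M: tower_stage A B J "Mon 0" by (rule mon_tower_stage)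
  show ?case by unfold_locales auto
next
  case (Suc n)
  interpret C: comparison A B J "Dec n" "Mon n" "Lam A B J cq n" by (rule Suc.IH)
  show ?case
  proof (rule C.next_comparison[OF dec_tower_stage.axioms(1)[OF dec_tower_stage] mon_tower_stage])
    show "ob (Lam A B J cq (Suc n)) X =
        Ext (ob (Lam A B J cq n) (prev X)) (str X \<cdot>\<^bsub>B\<^esub> C.Rlm (prev X))" for X
      by (simp add: Let_def)
    show "ar (Lam A B J cq (Suc n)) X Y f = f" for X Y f
      by (simp add: Let_def)
  qed (rule dec_Suc_sel mon_Suc_sel)+
qed

section \<open>Factorizations of the augmentation\<close>

locale augmented_towers =
  towers A B J cq + J': adj_pair A' B J' + F: is_functor A A' F
  for A :: "('a, 'k) cat" and B :: "('o, 'm) cat" and J :: "('a, 'k, 'o, 'm) adj"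
    and cq :: "('a, 'k) coeq_fun"
    and A' :: "('a2, 'k2) cat" and J' :: "('a2, 'k2, 'o, 'm) adj"
    and F :: "('a, 'k, 'a2, 'k2) ftr" +
  fixes c' :: "'o \<Rightarrow> 'm"
  assumes F_L: "ftr_eq B (F \<circ>\<^sub>F Lf J) (Lf J')"
    and F_coeq: "\<And>X Y f g. preserves_coeq A A' F X Y f g"
    and R'_coeq: "\<And>X Y e f. idempotent A' X e \<Longrightarrow> regular_epi_composite A' X Y f
           \<Longrightarrow> preserves_coeq A' B (Rf J') X Y (f \<cdot>\<^bsub>A'\<^esub> e) f"
    and R'_regular: "\<And>X Y f. regular_epi A' X Y f \<Longrightarrow>
           regular_epi B (ob (Rf J') X) (ob (Rf J') Y) (ar (Rf J') X Y f)"
    and aug: "augmentation B (monad_of J') c'"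
begin

lemma F_L_ob: "X \<in> Obj B \<Longrightarrow> ob F (ob (Lf J) X) = ob (Lf J') X"
  using F_L by (simp add: ftr_eq_def)

lemma F_L_ar: "f \<in> Hom B X Y \<Longrightarrow> ar F (ob (Lf J) X) (ob (Lf J) Y) (ar (Lf J) X Y f) = ar (Lf J') X Y f"
  using F_L by (simp add: ftr_eq_def)

abbreviation RFo :: "'a \<Rightarrow> 'o" where
  "RFo Y \<equiv> ob (Rf J') (ob F Y)"

abbreviation RF :: "'a \<Rightarrow> 'a \<Rightarrow> 'k \<Rightarrow> 'm" where
  "RF Y Z f \<equiv> ar (Rf J') (ob F Y) (ob F Z) (ar F Y Z f)"

abbreviation RL' :: "'o \<Rightarrow> 'o \<Rightarrow> 'm \<Rightarrow> 'm" where
  "RL' X Y f \<equiv> ar (Rf J') (ob (Lf J') X) (ob (Lf J') Y) (ar (Lf J') X Y f)"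

lemma RF_functor: "is_functor A B (Rf J' \<circ>\<^sub>F F)"
  using is_functor_comp[OF F.is_functor_axioms J'.R_functor] .

lemma RF_hom: "f \<in> Hom A Y Z \<Longrightarrow> RF Y Z f \<in> Hom B (RFo Y) (RFo Z)"
  using J'.R.ar_hom[OF F.ar_hom] .

lemma RF_comp: "f \<in> Hom A X Y \<Longrightarrow> g \<in> Hom A Y Z \<Longrightarrow> RF X Z (g \<cdot>\<^bsub>A\<^esub> f) = RF Y Z g \<cdot>\<^bsub>B\<^esub> RF X Y f"
  using is_functor.ar_comp[OF RF_functor, of f X Y g Z] by simp

lemma RL'_hom: "f \<in> Hom B X Y \<Longrightarrow> RL' X Y f \<in> Hom B (ob (Rf J') (ob (Lf J') X)) (ob (Rf J') (ob (Lf J') Y))"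
  using J'.R.ar_hom[OF J'.L.ar_hom] .

lemma RF_L_ar: "f \<in> Hom B X Y \<Longrightarrow> RF (ob (Lf J) X) (ob (Lf J) Y) (ar (Lf J) X Y f) = RL' X Y f"
  using F_L_ar F_L_ob J.B.hom_dom J.B.hom_cod by metis

lemma F_regular: "regular_epi A X Y f \<Longrightarrow> regular_epi A' (ob F X) (ob F Y) (ar F X Y f)"
  using F_coeq unfolding regular_epi_def preserves_coeq_def by blast

lemma F_regular_composite:
  "regular_epi_composite A X Y f \<Longrightarrow> regular_epi_composite A' (ob F X) (ob F Y) (ar F X Y f)"
  using preserves_regular_epi_composite[OF F.is_functor_axioms F_regular] .

lemma R'_regular_composite: "regular_epi_composite A' X Y f \<Longrightarrow>
    regular_epi_composite B (ob (Rf J') X) (ob (Rf J') Y) (ar (Rf J') X Y f)"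
  using preserves_regular_epi_composite[OF J'.R_functor R'_regular] .

lemma RF_epi: "regular_epi_composite A X Y f \<Longrightarrow> epi B (RFo X) (RFo Y) (RF X Y f)"
  using J.B.regular_epi_composite_epi[OF R'_regular_composite[OF F_regular_composite]] .

lemma aug_hom: "X \<in> Obj B \<Longrightarrow> c' X \<in> Hom B (ob (Rf J') (ob (Lf J') X)) X"
  and aug_natural: "f \<in> Hom B X Y \<Longrightarrow> c' Y \<cdot>\<^bsub>B\<^esub> RL' X Y f = f \<cdot>\<^bsub>B\<^esub> c' X"
  and aug_unit: "X \<in> Obj B \<Longrightarrow> c' X \<cdot>\<^bsub>B\<^esub> eta J' X = Ide B X"
  and aug_mult: "X \<in> Obj B \<Longrightarrow> c' X \<cdot>\<^bsub>B\<^esub> RL' (ob (Rf J') (ob (Lf J') X)) X (c' X) =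
    c' X \<cdot>\<^bsub>B\<^esub> ar (Rf J') (ob (Lf J') (ob (Rf J') (ob (Lf J') X))) (ob (Lf J') X) (eps J' (ob (Lf J') X))"
  using aug nat_trans.component[of B B "Rf J' \<circ>\<^sub>F Lf J'" ftr_id c' X]
    nat_trans.natural[of B B "Rf J' \<circ>\<^sub>F Lf J'" ftr_id c' f X Y]
  by (auto simp: augmentation_def monad_of_def)

abbreviation "\<xi> \<equiv> xi B J J' F"

lemma xi_transpose:
  assumes "Y \<in> Obj A"
  shows "\<xi> Y = J'.transpose (ob (Rf J) Y) (ob F Y) (ar F (ob (Lf J) (ob (Rf J) Y)) Y (eps J Y))"
  using F_L_ob[OF J.R.ob_obj[OF assms]] by (simp add: xi_def)

lemma F_eps_hom:
  assumes "Y \<in> Obj A"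
  shows "ar F (ob (Lf J) (ob (Rf J) Y)) Y (eps J Y) \<in> Hom A' (ob (Lf J') (ob (Rf J) Y)) (ob F Y)"
  using F.ar_hom[OF J.eps_hom[OF assms]] F_L_ob[OF J.R.ob_obj[OF assms]] by simp

lemma xi_hom: "Y \<in> Obj A \<Longrightarrow> \<xi> Y \<in> Hom B (ob (Rf J) Y) (RFo Y)"
  using J'.transpose_hom[OF J.R.ob_obj F_eps_hom] xi_transpose by simp

text \<open>
  By definition \<open>\<xi>\<close> is the transpose of \<open>F \<epsilon>\<close> under \<open>(L', R')\<close>, and transposing back gives \<open>F \<epsilon>\<close>.
\<close>

lemma F_eps:
  "Y \<in> Obj A \<Longrightarrow> ar F (ob (Lf J) (ob (Rf J) Y)) Y (eps J Y) = J'.cotranspose (ob (Rf J) Y) (ob F Y) (\<xi> Y)"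
  using J'.cotranspose_transpose[OF J.R.ob_obj F_eps_hom] xi_transpose by simp

lemma xi_natural:
  assumes f: "f \<in> Hom A Y Z"
  shows "\<xi> Z \<cdot>\<^bsub>B\<^esub> ar (Rf J) Y Z f = RF Y Z f \<cdot>\<^bsub>B\<^esub> \<xi> Y"
proof -
  have Y: "Y \<in> Obj A" and Z: "Z \<in> Obj A" using J.A.hom_dom[OF f] J.A.hom_cod[OF f] .
  note Rf = J.R.ar_hom[OF f]
  have "ar F (ob (Lf J) (ob (Rf J) Z)) Z (eps J Z) \<cdot>\<^bsub>A'\<^esub> ar (Lf J') (ob (Rf J) Y) (ob (Rf J) Z) (ar (Rf J) Y Z f)
      = ar F Y Z f \<cdot>\<^bsub>A'\<^esub> ar F (ob (Lf J) (ob (Rf J) Y)) Y (eps J Y)"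
    using F.ar_comp[OF J.L.ar_hom[OF Rf] J.eps_hom[OF Z]] F.ar_comp[OF J.eps_hom[OF Y] f]
      J.eps_natural[OF f] F_L_ar[OF Rf] by simp
  then show ?thesis
    using J'.transpose_comp_right[OF F_eps_hom[OF Z] Rf]
      J'.transpose_comp_left[OF J.R.ob_obj[OF Y] F_eps_hom[OF Y] F.ar_hom[OF f]]
      xi_transpose[OF Y] xi_transpose[OF Z] by simp
qed

text \<open>
  As \<open>\<xi> L\<close> carries the unit of \<open>R L\<close> to the unit of \<open>R'L'\<close>, the composite \<open>\<gamma>' \<cdot> \<xi> L\<close> is a
  retraction of \<open>\<eta>\<close>; by naturality of \<open>\<xi>\<close> this extends to the quotients of \<open>L X\<close> considered below.
\<close>

lemma xi_eta:
  assumes X: "X \<in> Obj B"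
  shows "\<xi> (ob (Lf J) X) \<cdot>\<^bsub>B\<^esub> eta J X = eta J' X"
proof -
  note LX = J.L.ob_obj[OF X] and e = J.eta_hom[OF X]
  have "\<xi> (ob (Lf J) X) \<cdot>\<^bsub>B\<^esub> eta J X = J'.transpose X (ob F (ob (Lf J) X))
      (ar F (ob (Lf J) (ob (Rf J) (ob (Lf J) X))) (ob (Lf J) X) (eps J (ob (Lf J) X)) \<cdot>\<^bsub>A'\<^esub>
       ar (Lf J') X (ob (Rf J) (ob (Lf J) X)) (eta J X))"
    using J'.transpose_comp_right[OF F_eps_hom[OF LX] e] xi_transpose[OF LX] by simp
  also have "\<dots> = J'.transpose X (ob (Lf J') X) (Ide A' (ob (Lf J') X))"
    using F.ar_comp[OF J.L.ar_hom[OF e] J.eps_hom[OF LX]] J.triangle_L[OF X] F_L_ar[OF e]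
      F.ar_ide[OF LX] F_L_ob[OF X] by simp
  also have "\<dots> = eta J' X"
    using J'.R.ar_ide[OF J'.L.ob_obj[OF X]] J.B.ide_left[OF J'.eta_hom[OF X]] by simp
  finally show ?thesis .
qed

text \<open>
  If \<open>\<gamma>'\<^sub>X\<close> factors through \<open>R' p\<close> as \<open>h \<cdot> R' p\<close>, then \<open>h\<close> inherits the multiplication law from
  \<open>\<gamma>'\<^sub>X\<close>. Precomposed with \<open>R'L'R' p\<close>, both sides become the two sides of that law at \<open>X\<close>. That
  \<open>R'L'R' p\<close> is an epimorphism holds because \<open>R'\<close> and the left adjoint \<open>L'\<close> preserve regular
  epimorphisms.
\<close>

lemma quotient_algebra:
  assumes X: "X \<in> Obj B" and p: "regular_epi_composite A' (ob (Lf J') X) Z p"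
    and h: "h \<in> Hom B (ob (Rf J') Z) X"
    and hp: "h \<cdot>\<^bsub>B\<^esub> ar (Rf J') (ob (Lf J') X) Z p = c' X"
  shows "h \<cdot>\<^bsub>B\<^esub> ar (Rf J') (ob (Lf J') (ob (Rf J') Z)) Z (eps J' Z) = h \<cdot>\<^bsub>B\<^esub> c' (ob (Rf J') Z)"
proof -
  let ?R = "Rf J'" and ?L = "Lf J'"
  let ?RLX = "ob ?R (ob ?L X)" and ?RZ = "ob ?R Z" and ?Rp = "ar ?R (ob ?L X) Z p"
  have p': "p \<in> Hom A' (ob ?L X) Z" using epi_hom[OF J'.A.regular_epi_composite_epi[OF p]] .
  have Z: "Z \<in> Obj A'" using J'.A.hom_cod[OF p'] .
  note LX = J'.L.ob_obj[OF X] and RZ = J'.R.ob_obj[OF Z]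
  note RLX = J'.R.ob_obj[OF LX] and Rp = J'.R.ar_hom[OF p']
  note RLRp = RL'_hom[OF Rp] and eZ = J'.eps_hom[OF Z] and eLX = J'.eps_hom[OF LX]
  note ReZ = J'.R.ar_hom[OF eZ] and ReLX = J'.R.ar_hom[OF eLX]
  have epi: "epi B (ob ?R (ob ?L ?RLX)) (ob ?R (ob ?L ?RZ)) (RL' ?RLX ?RZ ?Rp)"
    using J.B.regular_epi_composite_epi[OF R'_regular_composite[OF preserves_regular_epi_composite[OF
          J'.L_functor J'.L_preserves_regular_epi R'_regular_composite[OF p]]]] .
  have "ar ?R (ob ?L ?RZ) Z (eps J' Z) \<cdot>\<^bsub>B\<^esub> RL' ?RLX ?RZ ?Rp =
      ?Rp \<cdot>\<^bsub>B\<^esub> ar ?R (ob ?L ?RLX) (ob ?L X) (eps J' (ob ?L X))"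
    using J'.R.ar_comp[OF J'.L.ar_hom[OF Rp] eZ] J'.R.ar_comp[OF eLX p'] J'.eps_natural[OF p'] by
      simp
  then have "(h \<cdot>\<^bsub>B\<^esub> ar ?R (ob ?L ?RZ) Z (eps J' Z)) \<cdot>\<^bsub>B\<^esub> RL' ?RLX ?RZ ?Rp =
      c' X \<cdot>\<^bsub>B\<^esub> ar ?R (ob ?L ?RLX) (ob ?L X) (eps J' (ob ?L X))"
    using J.B.comp_assoc[OF RLRp ReZ h] J.B.comp_assoc[OF ReLX Rp h] hp by simp
  also have "\<dots> = c' X \<cdot>\<^bsub>B\<^esub> c' ?RLX"
    using aug_mult[OF X] aug_natural[OF aug_hom[OF X]] by simp
  also have "\<dots> = (h \<cdot>\<^bsub>B\<^esub> c' ?RZ) \<cdot>\<^bsub>B\<^esub> RL' ?RLX ?RZ ?Rp"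
    using J.B.comp_assoc[OF RLRp aug_hom[OF RZ] h] aug_natural[OF Rp]
      J.B.comp_assoc[OF aug_hom[OF RLX] Rp h] hp
    by simp
  finally show ?thesis
    using epi_cancel[OF epi J.B.comp_hom[OF ReZ h] J.B.comp_hom[OF aug_hom[OF RZ] h]] by blast
qed

text \<open>
  The invariant that is carried along the tower: a quotient \<open>q : L X \<rightarrow> S\<close> over which the component
  \<open>\<gamma>'\<^sub>X\<close> of the augmentation factors as \<open>h\<close> after \<open>R'F q\<close>.
\<close>

definition factors_aug :: "'o \<Rightarrow> 'a \<Rightarrow> 'k \<Rightarrow> 'm \<Rightarrow> bool" where
  "factors_aug X S q h \<longleftrightarrow> X \<in> Obj B \<and> regular_epi_composite A (ob (Lf J) X) S q \<and>
     h \<in> Hom B (RFo S) X \<and> h \<cdot>\<^bsub>B\<^esub> RF (ob (Lf J) X) S q = c' X"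

lemma factors_augD:
  assumes "factors_aug X S q h"
  shows "X \<in> Obj B" and "S \<in> Obj A" and "q \<in> Hom A (ob (Lf J) X) S" and "h \<in> Hom B (RFo S) X"
    and "h \<cdot>\<^bsub>B\<^esub> \<xi> S \<in> Hom B (ob (Rf J) S) X"
proof -
  show "X \<in> Obj B" and q: "q \<in> Hom A (ob (Lf J) X) S" and h: "h \<in> Hom B (RFo S) X"
    using assms epi_hom[OF J.A.regular_epi_composite_epi] by (auto simp: factors_aug_def)
  show S: "S \<in> Obj A" using J.A.hom_cod[OF q] .
  show "h \<cdot>\<^bsub>B\<^esub> \<xi> S \<in> Hom B (ob (Rf J) S) X" using J.B.comp_hom[OF xi_hom[OF S] h] .
qed

lemma factors_aug_algebra:
  assumes "factors_aug X S q h"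
  shows "h \<cdot>\<^bsub>B\<^esub> RF (ob (Lf J) (ob (Rf J) S)) S (eps J S) = (h \<cdot>\<^bsub>B\<^esub> \<xi> S) \<cdot>\<^bsub>B\<^esub> c' (ob (Rf J) S)"
proof -
  note X = factors_augD(1)[OF assms] and S = factors_augD(2)[OF assms] and h =
    factors_augD(4)[OF assms]
  note FS = F.ob_obj[OF S] and RS = J.R.ob_obj[OF S] and xi = xi_hom[OF S]
  note RFS = J'.R.ob_obj[OF FS] and e = J'.eps_hom[OF FS]
  have hp: "regular_epi_composite A' (ob (Lf J') X) (ob F S) (ar F (ob (Lf J) X) S q)"
    "h \<cdot>\<^bsub>B\<^esub> ar (Rf J') (ob (Lf J') X) (ob F S) (ar F (ob (Lf J) X) S q) = c' X"
    using assms F_regular_composite[of "ob (Lf J) X" S q] F_L_ob[OF X] by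
      (auto simp: factors_aug_def)
  have "RF (ob (Lf J) (ob (Rf J) S)) S (eps J S) =
      ar (Rf J') (ob (Lf J') (RFo S)) (ob F S) (eps J' (ob F S)) \<cdot>\<^bsub>B\<^esub> RL' (ob (Rf J) S) (RFo S) (\<xi> S)"
    using F_eps[OF S] F_L_ob[OF RS] J'.R.ar_comp[OF J'.L.ar_hom[OF xi] e] by simp
  then show ?thesis
    using J.B.comp_assoc[OF RL'_hom[OF xi] J'.R.ar_hom[OF e] h] quotient_algebra[OF X hp(1) h hp(2)]
      J.B.comp_assoc[OF RL'_hom[OF xi] aug_hom[OF RFS] h] aug_natural[OF xi]
      J.B.comp_assoc[OF aug_hom[OF RS] xi h] by simp
qed

text \<open>
  The transpose of \<open>q\<close> is a section of \<open>\<gamma> = h \<cdot> \<xi>\<^sub>S\<close>. At stage \<open>n\<close> it is the unit \<open>\<eta>\<^bsub>[n]\<^esub>\<close>, so this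
  is the unit law for \<open>\<gamma>\<^bsub>[n]\<^esub>\<close>; it also provides the idempotent below.
\<close>

lemma factors_aug_unit:
  assumes "factors_aug X S q h"
  shows "(h \<cdot>\<^bsub>B\<^esub> \<xi> S) \<cdot>\<^bsub>B\<^esub> J.transpose X S q = Ide B X"
proof -
  note X = factors_augD(1)[OF assms] and S = factors_augD(2)[OF assms] and q =
    factors_augD(3)[OF assms]
    and h = factors_augD(4)[OF assms]
  note e = J.eta_hom[OF X] and Rq = J.R.ar_hom[OF q] and xi = xi_hom[OF S]
  note LX = J.L.ob_obj[OF X]
  have "\<xi> S \<cdot>\<^bsub>B\<^esub> J.transpose X S q = RF (ob (Lf J) X) S q \<cdot>\<^bsub>B\<^esub> eta J' X"
    using J.B.comp_assoc[OF e Rq xi] xi_natural[OF q]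
      J.B.comp_assoc[OF e xi_hom[OF LX] RF_hom[OF q]]
      xi_eta[OF X] by simp
  then show ?thesis
    using J.B.comp_assoc[OF J.transpose_hom[OF X q] xi h]
      J.B.comp_assoc[OF J'.eta_hom[OF X] RF_hom[OF q, unfolded F_L_ob[OF X]] h]
      assms aug_unit[OF X] F_L_ob[OF X] by (simp add: factors_aug_def)
qed

text \<open>
  The pair is \<open>(q \<cdot> L \<gamma>, \<epsilon>\<^sub>S)\<close> with \<open>\<gamma> = h \<cdot> \<xi>\<^sub>S\<close>. Let \<open>u\<close> be the transpose of \<open>q\<close>, a section of
  \<open>\<gamma>\<close>. Since \<open>q = \<epsilon>\<^sub>S \<cdot> L u\<close>, the first arrow is \<open>\<epsilon>\<^sub>S \<cdot> L (u \<gamma>)\<close>, and \<open>u \<gamma>\<close> is idempotent; so after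
  applying \<open>F\<close> the coequalizer is one that \<open>R'\<close> preserves. By \<open>factors_aug_algebra\<close>, \<open>h\<close> coequalizes
  the image of the pair in \<open>B\<close>.
\<close>

lemma factors_aug_coeq:
  assumes fac: "factors_aug X S q h" and eps: "regular_epi_composite A (ob (Lf J) (ob (Rf J) S)) S (eps J S)"
    and coeq: "is_coeq A (ob (Lf J) (ob (Rf J) S)) S
      (q \<cdot>\<^bsub>A\<^esub> ar (Lf J) (ob (Rf J) S) X (h \<cdot>\<^bsub>B\<^esub> \<xi> S)) (eps J S) Q p"
  shows "\<exists>!k. k \<in> Hom B (RFo Q) X \<and> k \<cdot>\<^bsub>B\<^esub> RF S Q p = h"
proof -
  note X = factors_augD(1)[OF fac] and S = factors_augD(2)[OF fac] and q = factors_augD(3)[OF fac]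
    and h = factors_augD(4)[OF fac] and g = factors_augD(5)[OF fac]
  note RS = J.R.ob_obj[OF S] and e = J.eps_hom[OF S] and Lg = J.L.ar_hom[OF g]
  let ?RS = "ob (Rf J) S" and ?g = "h \<cdot>\<^bsub>B\<^esub> \<xi> S" and ?u = "J.transpose X S q"
  note u = J.transpose_hom[OF X q]
  note ug = J.B.comp_hom[OF g u]
  let ?e = "ar (Lf J') ?RS ?RS (?u \<cdot>\<^bsub>B\<^esub> ?g)"
  let ?Fe = "ar F (ob (Lf J) ?RS) S (eps J S)"
  have "(?u \<cdot>\<^bsub>B\<^esub> ?g) \<cdot>\<^bsub>B\<^esub> (?u \<cdot>\<^bsub>B\<^esub> ?g) = ?u \<cdot>\<^bsub>B\<^esub> ?g"
    using J.B.comp_assoc[OF ug g u] J.B.comp_assoc[OF g u g] factors_aug_unit[OF fac]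
      J.B.ide_left[OF g]
    by simp
  then have idem: "idempotent A' (ob (Lf J') ?RS) ?e"
    using J'.L.ar_comp[OF ug ug] J'.L.ar_hom[OF ug] by (simp add: idempotent_def)
  have "q \<cdot>\<^bsub>A\<^esub> ar (Lf J) ?RS X ?g = eps J S \<cdot>\<^bsub>A\<^esub> ar (Lf J) ?RS ?RS (?u \<cdot>\<^bsub>B\<^esub> ?g)"
    using J.L.ar_comp[OF g u] J.A.comp_assoc[OF Lg J.L.ar_hom[OF u] e]
      J.cotranspose_transpose[OF X q]
    by simp
  then have "ar F (ob (Lf J) ?RS) S (q \<cdot>\<^bsub>A\<^esub> ar (Lf J) ?RS X ?g) = ?Fe \<cdot>\<^bsub>A'\<^esub> ?e"
    using F.ar_comp[OF J.L.ar_hom[OF ug] e] F_L_ar[OF ug] by simp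
  moreover have "is_coeq A' (ob F (ob (Lf J) ?RS)) (ob F S)
      (ar F (ob (Lf J) ?RS) S (q \<cdot>\<^bsub>A\<^esub> ar (Lf J) ?RS X ?g)) ?Fe (ob F Q) (ar F S Q p)"
    using coeq F_coeq by (auto simp: preserves_coeq_def)
  ultimately have "is_coeq A' (ob (Lf J') ?RS) (ob F S) (?Fe \<cdot>\<^bsub>A'\<^esub> ?e) ?Fe (ob F Q) (ar F S Q p)"
    using F_L_ob[OF RS] by simp
  moreover have "regular_epi_composite A' (ob (Lf J') ?RS) (ob F S) ?Fe"
    using F_regular_composite[OF eps] F_L_ob[OF RS] by simp
  ultimately have coeq_B: "is_coeq B (ob (Rf J') (ob (Lf J') ?RS)) (RFo S)
      (ar (Rf J') (ob (Lf J') ?RS) (ob F S) (?Fe \<cdot>\<^bsub>A'\<^esub> ?e))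
      (ar (Rf J') (ob (Lf J') ?RS) (ob F S) ?Fe) (RFo Q) (RF S Q p)"
    using R'_coeq[OF idem] by (auto simp: preserves_coeq_def)
  have "h \<cdot>\<^bsub>B\<^esub> RF (ob (Lf J) ?RS) S (q \<cdot>\<^bsub>A\<^esub> ar (Lf J) ?RS X ?g) = c' X \<cdot>\<^bsub>B\<^esub> RL' ?RS X ?g"
    using RF_comp[OF Lg q] RF_L_ar[OF g] fac F_L_ob[OF X] F_L_ob[OF RS]
      J.B.comp_assoc[OF RF_hom[OF Lg] RF_hom[OF q] h] by (simp add: factors_aug_def)
  also have "\<dots> = h \<cdot>\<^bsub>B\<^esub> RF (ob (Lf J) ?RS) S (eps J S)"
    using aug_natural[OF g] factors_aug_algebra[OF fac] by simp
  finally have "h \<cdot>\<^bsub>B\<^esub> ar (Rf J') (ob (Lf J') ?RS) (ob F S) (?Fe \<cdot>\<^bsub>A'\<^esub> ?e) =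
      h \<cdot>\<^bsub>B\<^esub> ar (Rf J') (ob (Lf J') ?RS) (ob F S) ?Fe"
    using F_L_ob[OF RS]
      \<open>ar F (ob (Lf J) ?RS) S (q \<cdot>\<^bsub>A\<^esub> ar (Lf J) ?RS X ?g) = ?Fe \<cdot>\<^bsub>A'\<^esub> ?e\<close> by simp
  then show ?thesis using coeq_B h by (simp add: is_coeq_def)
qed

lemma factors_aug_next:
  assumes fac: "factors_aug X S q h" and p: "regular_epi A S Q p" and k: "k \<in> Hom B (RFo Q) X"
    and lm_inv_at: "k \<cdot>\<^bsub>B\<^esub> RF S Q p = h"
  shows "factors_aug X Q (p \<cdot>\<^bsub>A\<^esub> q) k"
proof -
  note q = factors_augD(3)[OF fac]
  have p': "p \<in> Hom A S Q" using epi_hom[OF J.A.regular_epi_epi[OF p]] .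
  have "k \<cdot>\<^bsub>B\<^esub> RF (ob (Lf J) X) Q (p \<cdot>\<^bsub>A\<^esub> q) = c' X"
    using RF_comp[OF q p'] J.B.comp_assoc[OF RF_hom[OF q] RF_hom[OF p'] k] lm_inv_at fac
    by (simp add: factors_aug_def)
  then show ?thesis
    using fac p k by (auto simp: factors_aug_def intro: regular_epi_composite.compose)
qed

section \<open>The functors into the adjoint decomposition\<close>

text \<open>
  In the literature \<open>Gn n\<close>, \<open>Sn n\<close>, \<open>g' n\<close> and \<open>gm n\<close> are \<open>\<Gamma>\<^bsub>[n]\<^esub>\<close>, \<open>S\<^bsub>[n]\<^esub>\<close>, \<open>\<gamma>'\<^bsub>[n]\<^esub>\<close> and
  \<open>\<gamma>\<^bsub>[n]\<^esub>\<close>; \<open>Gx n\<close> is \<open>\<Gamma>\<^bsub>[n]\<^esub>\<close> on objects.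
\<close>

abbreviation "Gn n \<equiv> Gam A B J cq J' F c' n"
abbreviation "Gx n X \<equiv> ob (Gn n) X"
abbreviation "Sn n X \<equiv> ob (Lf (Dec n)) (Gx n X)"
abbreviation "g' n \<equiv> snd (Gam_aux A B J cq J' F c' n)"
abbreviation "gm n \<equiv> gam A B J cq J' F c' n"

lemma gam_eq: "gm n X = g' n X \<cdot>\<^bsub>B\<^esub> \<xi> (Sn n X)"
  by (simp add: gam_def)

lemma Gx_Suc: "Gx (Suc n) X = Ext (Gx n X) (gm n X)"
  by (simp add: Gam_def gam_def Let_def)

lemma Gx_0: "Gx 0 X = Base X"
  by (simp add: Gam_def tag_def)

lemma Gn_ar [simp]: "ar (Gn n) X Y f = f"
  by (induction n) (simp_all add: Gam_def tag_def Let_def)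

lemma Gn_Suc: "Gn (Suc n) = \<lparr>ob = \<lambda>X. Ext (Gx n X) (gm n X), ar = ar (Gn n)\<rparr>"
  by (simp add: Gam_def gam_def Let_def)

lemma g'_Suc: "g' (Suc n) = (THE t. t \<in> extensional (Obj B) \<and>
     nat_trans B B (Rf J' \<circ>\<^sub>F F \<circ>\<^sub>F Lf (Dec (Suc n)) \<circ>\<^sub>F Gn (Suc n)) ftr_id t \<and>
     (\<forall>X \<in> Obj B. t X \<cdot>\<^bsub>B\<^esub> RF (Sn n X) (Sn (Suc n) X) (dec_pi A B J cq n (Gx (Suc n) X)) = g' n X))"
  unfolding Gn_Suc by (simp add: Gam_def gam_def Let_def del: dec.simps)

text \<open>
  \<open>\<gamma>'\<^bsub>[n+1]\<^esub>\<close> is given by a definite description whose existence and uniqueness rest on the properties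
  of stage \<open>n\<close>. The following predicate collects what the induction has to carry along.
\<close>

definition Gam_well_defined :: "nat \<Rightarrow> bool" where
  "Gam_well_defined n \<longleftrightarrow> is_functor B (Ct (Dec n)) (Gn n) \<and> (\<forall>X \<in> Obj B. base (Gx n X) = X) \<and>
     (\<forall>X \<in> Obj B. factors_aug X (Sn n X) (pr (Dec n) (Gx n X)) (g' n X)) \<and>
     (\<forall>X Y. \<forall>f \<in> Hom B X Y. g' n Y \<cdot>\<^bsub>B\<^esub> RF (Sn n X) (Sn n Y) (ar (Lf (Dec n)) (Gx n X) (Gx n Y) f) =
        f \<cdot>\<^bsub>B\<^esub> g' n X)"

lemma Gam_well_definedD:
  assumes "Gam_well_defined n"
  shows "is_functor B (Ct (Dec n)) (Gn n)"
    and "X \<in> Obj B \<Longrightarrow> Gx n X \<in> Obj (Ct (Dec n))"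
    and "f \<in> Hom B X Y \<Longrightarrow> f \<in> Hom (Ct (Dec n)) (Gx n X) (Gx n Y)"
    and "X \<in> Obj B \<Longrightarrow> base (Gx n X) = X"
    and "X \<in> Obj B \<Longrightarrow> factors_aug X (Sn n X) (pr (Dec n) (Gx n X)) (g' n X)"
    and "f \<in> Hom B X Y \<Longrightarrow> g' n Y \<cdot>\<^bsub>B\<^esub> RF (Sn n X) (Sn n Y) (ar (Lf (Dec n)) (Gx n X) (Gx n Y) f) =
        f \<cdot>\<^bsub>B\<^esub> g' n X"
  using assms is_functor.ob_obj[of B "Ct (Dec n)" "Gn n" X]
    is_functor.ar_hom[of B "Ct (Dec n)" "Gn n" f X Y]
  by (auto simp: Gam_well_defined_def)

text \<open>
  This makes \<open>\<Gamma>\<^bsub>[n+1]\<^esub>\<close> a functor: a naturality square of \<open>\<gamma>\<^bsub>[n]\<^esub>\<close> is exactly the square defining a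
  morphism of stage \<open>n + 1\<close>.
\<close>

lemma gam_natural_step:
  assumes n: "Gam_well_defined n" and f: "f \<in> Hom B X Y"
  shows "gm n Y \<cdot>\<^bsub>B\<^esub> ar (Rf J) (Sn n X) (Sn n Y) (ar (Lf (Dec n)) (Gx n X) (Gx n Y) f) =
    f \<cdot>\<^bsub>B\<^esub> gm n X"
proof -
  interpret D: dec_tower_stage A B J "Dec n" by (rule dec_tower_stage)
  have X: "X \<in> Obj B" and Y: "Y \<in> Obj B" using J.B.hom_dom[OF f] J.B.hom_cod[OF f] .
  note Lf = D.S.L.ar_hom[OF Gam_well_definedD(3)[OF n f]]
  note fX = Gam_well_definedD(5)[OF n X] and fY = Gam_well_definedD(5)[OF n Y]
  show ?thesis
    using xi_natural[OF Lf] Gam_well_definedD(6)[OF n f]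
      J.B.comp_assoc[OF J.R.ar_hom[OF Lf] xi_hom[OF factors_augD(2)[OF fY]] factors_augD(4)[OF fY]]
      J.B.comp_assoc[OF xi_hom[OF factors_augD(2)[OF fX]] RF_hom[OF Lf] factors_augD(4)[OF fY]]
      J.B.comp_assoc[OF xi_hom[OF factors_augD(2)[OF fX]] factors_augD(4)[OF fX] f]
    by (simp add: gam_eq)
qed

lemma Gam_well_defined_0: "Gam_well_defined 0"
proof -
  \<comment> \<open>\<open>\<pi>\<^bsub>[0]\<^esub>\<close> is an identity, which is a regular epimorphism and so counts as a composite of such.\<close>
  have "factors_aug X (Sn 0 X) (pr (Dec 0) (Gx 0 X)) (g' 0 X)" if X: "X \<in> Obj B" for X
    using X J.A.ide_regular_epi[OF J.L.ob_obj[OF X]] aug_hom[OF X] F_L_ob[OF X]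
      F.ar_ide[OF J.L.ob_obj[OF X]] J'.R.ar_ide[OF J'.L.ob_obj[OF X]] J.B.ide_right[OF aug_hom[OF X]]
    by (auto simp: factors_aug_def Gx_0 untag_def intro: regular_epi_composite.single)
  moreover have "is_functor B (Ct (Dec 0)) (Gn 0)" using is_functor_tag by (simp add: Gam_def)
  moreover have "g' 0 Y \<cdot>\<^bsub>B\<^esub> RF (Sn 0 X) (Sn 0 Y) (ar (Lf (Dec 0)) (Gx 0 X) (Gx 0 Y) f) =
      f \<cdot>\<^bsub>B\<^esub> g' 0 X" if "f \<in> Hom B X Y" for f X Y
    using aug_natural[OF that] RF_L_ar[OF that] by (simp add: Gx_0 untag_def)
  ultimately show ?thesis by (simp add: Gam_well_defined_def Gx_0)
qed

lemma Gam_well_defined_Suc: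
  assumes n: "Gam_well_defined n"
  shows "Gam_well_defined (Suc n)"
proof -
  interpret D: dec_tower_stage A B J "Dec n" by (rule dec_tower_stage)
  interpret D': dec_tower_stage A B J "Dec (Suc n)" by (rule dec_tower_stage)
  interpret N: next_stage A "Dec n" "dec_cat B J (Dec n)" "dec_coeq A J cq (Dec n)" "dec_struct J (Dec n)"
    using choice coeqs by (rule D.next_stage_dec)
  let ?Q = "\<lambda>X. Sn (Suc n) X" and ?p = "\<lambda>X. dec_pi A B J cq n (Gx (Suc n) X)"
  have obj: "Gx (Suc n) X \<in> Obj (Ct (Dec (Suc n)))" if X: "X \<in> Obj B" for X
    using Gam_well_definedD(2)[OF n X] Gam_well_definedD(4)[OF n X]
      factors_augD(5)[OF Gam_well_definedD(5)[OF n X]]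
    unfolding Gx_Suc dec_Suc_sel gam_eq by (simp add: D.dec_cat_sel(1))
  have hom: "f \<in> Hom (Ct (Dec (Suc n))) (Gx (Suc n) X) (Gx (Suc n) Y)" if f: "f \<in> Hom B X Y" for f X Y
    using obj[OF J.B.hom_dom[OF f]] obj[OF J.B.hom_cod[OF f]] Gam_well_definedD(3)[OF n f]
      gam_natural_step[OF n f]
    unfolding Gx_Suc dec_Suc_sel by (simp add: D.dec_cat_sel(3))
  have base: "base (Gx (Suc n) X) = X" if X: "X \<in> Obj B" for X
    using Gam_well_definedD(4)[OF n X] by (simp add: Gx_Suc)
  have Q: "?Q X = fst (dec_coeq A J cq (Dec n) (Gx (Suc n) X))" for X
    unfolding dec_Suc_sel by (simp add: next_L_def)
  have Gn_functor: "is_functor B (Ct (Dec (Suc n))) (Gn (Suc n))"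
    using obj hom D'.Ide_base[OF obj] base J.B.category_axioms D'.S.B.category_axioms
    by (auto simp: is_functor_def is_functor_axioms_def simp del: dec.simps)
  have coeq: "is_coeq A (ob (Lf J) (ob (Rf J) (Sn n X))) (Sn n X)
      (pr (Dec n) (Gx n X) \<cdot>\<^bsub>A\<^esub> ar (Lf J) (ob (Rf J) (Sn n X)) X (g' n X \<cdot>\<^bsub>B\<^esub> \<xi> (Sn n X)))
      (eps J (Sn n X)) (?Q X) (?p X)" if X: "X \<in> Obj B" for X
    using D.dec_coeq_is_coeq[OF choice coeqs obj[OF X, unfolded dec_Suc_sel]]
      Gam_well_definedD(4)[OF n X]
    unfolding Q by (simp add: Gx_Suc dec_pi_def gam_eq)
  have p: "?p X \<in> Hom A (Sn n X) (?Q X)" and p_reg: "regular_epi A (Sn n X) (?Q X) (?p X)"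
    if "X \<in> Obj B" for X
    using is_coeq_hom(3)[OF coeq[OF that]] coeq[OF that] unfolding regular_epi_def by blast+
  have p_nat: "ar (Lf (Dec (Suc n))) (Gx (Suc n) X) (Gx (Suc n) Y) f \<cdot>\<^bsub>A\<^esub> ?p X =
      ?p Y \<cdot>\<^bsub>A\<^esub> ar (Lf (Dec n)) (Gx n X) (Gx n Y) f" if f: "f \<in> Hom B X Y" for f X Y
    using N.next_L_ar[OF hom[OF f, unfolded dec_Suc_sel]]
    unfolding dec_Suc_sel by (simp add: dec_pi_def Gx_Suc)
  have factor: "\<exists>!k. k \<in> Hom B (RFo (?Q X)) X \<and> k \<cdot>\<^bsub>B\<^esub> RF (Sn n X) (?Q X) (?p X) = g' n X"
    if X: "X \<in> Obj B" for X
    using factors_aug_coeq[OF Gam_well_definedD(5)[OF n X] D.eps_L_regular[OF Gam_well_definedD(2)[OF n X]] coeq[OF X]] .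
  \<comment> \<open>The components of \<open>\<gamma>'\<^bsub>[n+1]\<^esub>\<close>.\<close>
  define k where "k X = (THE k. k \<in> Hom B (RFo (?Q X)) X \<and> k \<cdot>\<^bsub>B\<^esub> RF (Sn n X) (?Q X) (?p X) = g' n X)" for X
  have k: "k X \<in> Hom B (RFo (?Q X)) X" "k X \<cdot>\<^bsub>B\<^esub> RF (Sn n X) (?Q X) (?p X) = g' n X"
    if "X \<in> Obj B" for X
    using theI'[OF factor[OF that]] by (simp_all add: k_def)
  have k_nat: "k Y \<cdot>\<^bsub>B\<^esub> RF (?Q X) (?Q Y) (ar (Lf (Dec (Suc n))) (Gx (Suc n) X) (Gx (Suc n) Y) f) = f \<cdot>\<^bsub>B\<^esub> k X"
    if f: "f \<in> Hom B X Y" for f X Y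
  proof -
    have X: "X \<in> Obj B" and Y: "Y \<in> Obj B" using J.B.hom_dom[OF f] J.B.hom_cod[OF f] .
    note Lf = D.S.L.ar_hom[OF Gam_well_definedD(3)[OF n f]] and L'f = D'.S.L.ar_hom[OF hom[OF f]]
    let ?Lf = "ar (Lf (Dec n)) (Gx n X) (Gx n Y) f"
    let ?L'f = "ar (Lf (Dec (Suc n))) (Gx (Suc n) X) (Gx (Suc n) Y) f"
    have "RF (?Q X) (?Q Y) ?L'f \<cdot>\<^bsub>B\<^esub> RF (Sn n X) (?Q X) (?p X) =
        RF (Sn n Y) (?Q Y) (?p Y) \<cdot>\<^bsub>B\<^esub> RF (Sn n X) (Sn n Y) ?Lf"
      using RF_comp[OF p[OF X] L'f] RF_comp[OF Lf p[OF Y]] p_nat[OF f] by simp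
    then have "(k Y \<cdot>\<^bsub>B\<^esub> RF (?Q X) (?Q Y) ?L'f) \<cdot>\<^bsub>B\<^esub> RF (Sn n X) (?Q X) (?p X) =
        (f \<cdot>\<^bsub>B\<^esub> k X) \<cdot>\<^bsub>B\<^esub> RF (Sn n X) (?Q X) (?p X)"
      using J.B.comp_assoc[OF RF_hom[OF p[OF X]] RF_hom[OF L'f] k(1)[OF Y]]
        J.B.comp_assoc[OF RF_hom[OF Lf] RF_hom[OF p[OF Y]] k(1)[OF Y]]
        J.B.comp_assoc[OF RF_hom[OF p[OF X]] k(1)[OF X] f] k(2)[OF X] k(2)[OF Y] Gam_well_definedD(6)[OF n f]
      by simp
    then show ?thesis
      using epi_cancel[OF RF_epi[OF regular_epi_composite.single[OF p_reg[OF X]]]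
          J.B.comp_hom[OF RF_hom[OF L'f] k(1)[OF Y]] J.B.comp_hom[OF k(1)[OF X] f]] by blast
  qed
  have nat: "nat_trans B B (Rf J' \<circ>\<^sub>F F \<circ>\<^sub>F Lf (Dec (Suc n)) \<circ>\<^sub>F Gn (Suc n)) ftr_id (restrict k (Obj B))"
    using is_functor_comp[OF is_functor_comp[OF is_functor_comp[OF Gn_functor D'.S.L_functor]
          F.is_functor_axioms] J'.R_functor]
      is_functor_id[OF J.B.category_axioms] k(1) k_nat J.B.hom_dom J.B.hom_cod
    by (auto simp: nat_trans_def nat_trans_axioms_def simp del: dec.simps)
  have g': "g' (Suc n) = restrict k (Obj B)"
    unfolding g'_Suc
  proof (rule the_equality)
    show "restrict k (Obj B) \<in> extensional (Obj B) \<and>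
      nat_trans B B (Rf J' \<circ>\<^sub>F F \<circ>\<^sub>F Lf (Dec (Suc n)) \<circ>\<^sub>F Gn (Suc n)) ftr_id (restrict k (Obj B)) \<and>
      (\<forall>X\<in>Obj B. restrict k (Obj B) X \<cdot>\<^bsub>B\<^esub> RF (Sn n X) (?Q X) (?p X) = g' n X)"
      using nat k(2) by simp
  next
    fix t assume t: "t \<in> extensional (Obj B) \<and>
      nat_trans B B (Rf J' \<circ>\<^sub>F F \<circ>\<^sub>F Lf (Dec (Suc n)) \<circ>\<^sub>F Gn (Suc n)) ftr_id t \<and>
      (\<forall>X\<in>Obj B. t X \<cdot>\<^bsub>B\<^esub> RF (Sn n X) (?Q X) (?p X) = g' n X)"
    have "t X = k X" if X: "X \<in> Obj B" for X
      using t nat_trans.component[OF _ X] k[OF X] factor[OF X] X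
      by (metis (no_types, lifting) ftr_comp_sel(1) ftr_id_sel(1))
    then show "t = restrict k (Obj B)" using t by (auto simp: extensional_def restrict_def)
  qed
  have "factors_aug X (?Q X) (pr (Dec (Suc n)) (Gx (Suc n) X)) (g' (Suc n) X)" if X: "X \<in> Obj B" for X
    using factors_aug_next[OF Gam_well_definedD(5)[OF n X] p_reg[OF X] k[OF X]] X
    unfolding g' dec_Suc_sel(7) by (simp add: dec_pi_def Gx_Suc del: dec.simps)
  moreover have "g' (Suc n) Y \<cdot>\<^bsub>B\<^esub> RF (?Q X) (?Q Y) (ar (Lf (Dec (Suc n))) (Gx (Suc n) X) (Gx (Suc n) Y) f) =
      f \<cdot>\<^bsub>B\<^esub> g' (Suc n) X" if f: "f \<in> Hom B X Y" for f X Y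
    using k_nat[OF f] J.B.hom_dom[OF f] J.B.hom_cod[OF f] unfolding g' by (simp del: dec.simps)
  ultimately show ?thesis using Gn_functor base by (simp add: Gam_well_defined_def del: dec.simps Gam_aux.simps)
qed

lemma Gam_well_defined: "Gam_well_defined n"
  by (induction n) (auto intro: Gam_well_defined_0 Gam_well_defined_Suc)

lemmas Gam_functor = Gam_well_definedD(1)[OF Gam_well_defined]
lemmas Gam_obj = Gam_well_definedD(2)[OF Gam_well_defined]
lemmas Gam_hom = Gam_well_definedD(3)[OF Gam_well_defined]
lemmas base_Gam = Gam_well_definedD(4)[OF Gam_well_defined]
lemmas gam_factors = Gam_well_definedD(5)[OF Gam_well_defined]
lemmas gam_natural = gam_natural_step[OF Gam_well_defined]


lemma gam_hom: "X \<in> Obj B \<Longrightarrow> gm n X \<in> Hom B (ob (Rf J) (Sn n X)) X"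
  using factors_augD(5)[OF gam_factors] by (simp add: gam_eq)

text \<open>
  Both sides are arrows \<open>R T \<rightarrow> X\<close> with \<open>T = L\<^bsub>[k]\<^esub> R\<^bsub>[k]\<^esub> S\<close>. By naturality of \<open>\<xi>\<close> they are
  \<open>\<gamma>'\<^bsub>[m]\<^esub> \<cdot> R'F \<epsilon>\<^bsub>[k]\<^esub> \<cdot> \<xi>\<^sub>T\<close> and \<open>\<gamma>'\<^bsub>[k]\<^esub> \<cdot> R'F L\<^bsub>[k]\<^esub> \<gamma>\<^bsub>[m]\<^esub> \<cdot> \<xi>\<^sub>T\<close>. The factors before \<open>\<xi>\<^sub>T\<close> agree after
  composition with the epimorphism \<open>R'F \<pi>\<^bsub>[k]\<^esub>\<close> from \<open>R'L'R S\<close>, where both equal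
  \<open>\<gamma>\<^bsub>[m]\<^esub> \<cdot> \<gamma>'\<^bsub>R S\<^esub>\<close>: the first by \<open>factors_aug_algebra\<close>, the second by naturality of \<open>\<pi>\<^bsub>[k]\<^esub>\<close> and \<open>\<gamma>'\<close>.
\<close>

lemma gam_square:
  assumes X: "X \<in> Obj B"
    and g: "gm m X \<in> Hom (Ct (Dec k)) (ob (Rf (Dec k)) (Sn m X)) (Gx k X)"
  shows "gm m X \<cdot>\<^bsub>B\<^esub> ar (Rf J) (ob (Lf (Dec k)) (ob (Rf (Dec k)) (Sn m X))) (Sn m X) (eps (Dec k) (Sn m X)) =
    gm k X \<cdot>\<^bsub>B\<^esub> ar (Rf J) (ob (Lf (Dec k)) (ob (Rf (Dec k)) (Sn m X))) (Sn k X)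
      (ar (Lf (Dec k)) (ob (Rf (Dec k)) (Sn m X)) (Gx k X) (gm m X))"
proof -
  interpret D: dec_tower_stage A B J "Dec k" by (rule dec_tower_stage)
  let ?S = "Sn m X" and ?h = "gm m X" and ?V = "ob (Rf (Dec k)) (Sn m X)"
  let ?T = "ob (Lf (Dec k)) ?V" and ?e = "eps (Dec k) ?S"
  let ?Lh = "ar (Lf (Dec k)) ?V (Gx k X) ?h"
  let ?LRS = "ob (Lf J) (ob (Rf J) ?S)" and ?p = "pr (Dec k) ?V" and ?q = "pr (Dec k) (Gx k X)"
  note fm = gam_factors[OF X, of m] and fk = gam_factors[OF X, of k]
  note S = factors_augD(2)[OF fm] and gm' = factors_augD(4)[OF fm] and gk' = factors_augD(4)[OF fk]
    and q = factors_augD(3)[OF fk]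
  note V = D.S.R.ob_obj[OF S] and baseV = D.base_R[OF S] and baseG = base_Gam[OF X]
  note T = D.S.L.ob_obj[OF V] and RS = J.R.ob_obj[OF S]
  note p = D.pr_hom[OF V, unfolded baseV] and e = D.S.eps_hom[OF S] and Lh = D.S.L.ar_hom[OF g]
  note hB = gam_hom[OF X, of m]
  have epi: "epi B (RFo ?LRS) (RFo ?T) (RF ?LRS ?T ?p)"
    using RF_epi[OF D.pr_regular[OF V]] baseV by simp
  have "(g' m X \<cdot>\<^bsub>B\<^esub> RF ?T ?S ?e) \<cdot>\<^bsub>B\<^esub> RF ?LRS ?T ?p = ?h \<cdot>\<^bsub>B\<^esub> c' (ob (Rf J) ?S)"
    using J.B.comp_assoc[OF RF_hom[OF p] RF_hom[OF e] gm'] RF_comp[OF p e] D.pr_eps[OF S]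
      factors_aug_algebra[OF fm] by (simp add: gam_eq)
  moreover have "(g' k X \<cdot>\<^bsub>B\<^esub> RF ?T (Sn k X) ?Lh) \<cdot>\<^bsub>B\<^esub> RF ?LRS ?T ?p = ?h \<cdot>\<^bsub>B\<^esub> c' (ob (Rf J) ?S)"
  proof -
    have "?Lh \<cdot>\<^bsub>A\<^esub> ?p = ?q \<cdot>\<^bsub>A\<^esub> ar (Lf J) (ob (Rf J) ?S) X ?h"
      using D.pr_natural[OF g] baseV baseG by simp
    then have "RF ?T (Sn k X) ?Lh \<cdot>\<^bsub>B\<^esub> RF ?LRS ?T ?p =
        RF (ob (Lf J) X) (Sn k X) ?q \<cdot>\<^bsub>B\<^esub> RL' (ob (Rf J) ?S) X ?h"
      using RF_comp[OF p Lh] RF_comp[OF J.L.ar_hom[OF hB] q] RF_L_ar[OF hB] by simp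
    then show ?thesis
      using J.B.comp_assoc[OF RF_hom[OF p] RF_hom[OF Lh] gk']
        J.B.comp_assoc[OF RF_hom[OF J.L.ar_hom[OF hB]] RF_hom[OF q] gk'] RF_L_ar[OF hB]
        fk aug_natural[OF hB] by (simp add: factors_aug_def)
  qed
  ultimately have "g' m X \<cdot>\<^bsub>B\<^esub> RF ?T ?S ?e = g' k X \<cdot>\<^bsub>B\<^esub> RF ?T (Sn k X) ?Lh"
    using epi_cancel[OF epi J.B.comp_hom[OF RF_hom[OF e] gm'] J.B.comp_hom[OF RF_hom[OF Lh] gk']]
    by simp
  then show ?thesis
    using xi_natural[OF e] xi_natural[OF Lh]
      J.B.comp_assoc[OF J.R.ar_hom[OF e] xi_hom[OF S] gm']
      J.B.comp_assoc[OF xi_hom[OF T] RF_hom[OF e] gm']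
      J.B.comp_assoc[OF J.R.ar_hom[OF Lh] xi_hom[OF factors_augD(2)[OF fk]] gk']
      J.B.comp_assoc[OF xi_hom[OF T] RF_hom[OF Lh] gk']
    by (simp add: gam_eq)
qed

text \<open>
  The square needed to pass from stage \<open>k\<close> to stage \<open>k + 1\<close> is \<open>gam_square\<close> at \<open>k\<close>. The case \<open>k = m\<close>
  says that \<open>\<gamma>\<^bsub>[m]\<^esub>\<close> is a morphism \<open>R\<^bsub>[m]\<^esub> L\<^bsub>[m]\<^esub> \<Gamma>\<^bsub>[m]\<^esub> \<rightarrow> \<Gamma>\<^bsub>[m]\<^esub>\<close> of its own stage, and not only an
  arrow of \<open>B\<close>.
\<close>

lemma gam_hom_dec:
  assumes X: "X \<in> Obj B"
  shows "k \<le> m \<Longrightarrow> gm m X \<in> Hom (Ct (Dec k)) (ob (Rf (Dec k)) (Sn m X)) (Gx k X)"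
proof (induction k)
  case 0
  have "ob (Rf J) (Sn m X) \<in> Obj B" using J.B.hom_dom[OF gam_hom[OF X]] .
  then show ?case
    using gam_hom[OF X, of m] X by (simp add: Gx_0 tag_def tagged_cat_sel(1,3))
next
  case (Suc k)
  interpret D: dec_tower_stage A B J "Dec k" by (rule dec_tower_stage)
  interpret D': dec_tower_stage A B J "Dec (Suc k)" by (rule dec_tower_stage)
  note g = Suc.IH[OF Suc_leD[OF Suc.prems]]
  note S = factors_augD(2)[OF gam_factors[OF X, of m]]
  show ?case
    using D'.S.R.ob_obj[OF S] Gam_obj[OF X, of "Suc k"] g gam_square[OF X g]
    unfolding dec_Suc_sel Gx_Suc by (simp add: D.dec_cat_sel(3) next_R_def dec_struct_def)
qed

section \<open>The functors into the monadic tower\<close>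

abbreviation "Lm n \<equiv> Lam A B J cq n"
abbreviation "lm_inv_at n \<equiv> comparison.lm_inv A (Dec n) (Mon n) (Lm n)"

text \<open>
  The component \<open>\<gamma>\<^bsub>[n]\<^esub> \<cdot> R \<lambda>\<^sub>n\<^sup>-\<^sup>1\<close> of \<open>\<gamma>\<^sub>n\<close>. The object \<open>V\<close> that is to be \<open>\<Gamma>\<^sub>n X\<close> is a parameter, so that
  \<open>\<Gamma>\<^sub>n\<close> can be defined by recursion from it.
\<close>

definition mon_gam :: "nat \<Rightarrow> ('o, 'm) tower_obj \<Rightarrow> 'o \<Rightarrow> 'm" where
  "mon_gam n V X = gm n X \<cdot>\<^bsub>B\<^esub> ar (Rf J) (ob (Lf (Mon n)) V) (Sn n X) (lm_inv_at n V)"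

primrec mon_Gam :: "nat \<Rightarrow> 'o \<Rightarrow> ('o, 'm) tower_obj" where
  "mon_Gam 0 X = Base X"
| "mon_Gam (Suc n) X = Ext (mon_Gam n X) (mon_gam n (mon_Gam n X) X)"

text \<open>
  What \<open>\<Gamma>\<^sub>n X\<close> has to satisfy for its extension by \<open>\<gamma>\<^sub>n\<close> to be an object of stage \<open>n + 1\<close> over
  \<open>\<Gamma>\<^bsub>[n+1]\<^esub> X\<close>.
\<close>

definition lies_over :: "nat \<Rightarrow> ('o, 'm) tower_obj \<Rightarrow> 'o \<Rightarrow> bool" where
  "lies_over n V X \<longleftrightarrow> X \<in> Obj B \<and> V \<in> Obj (Ct (Mon n)) \<and> ob (Lm n) V = Gx n X"

lemma lies_over_lm_inv_hom:
  assumes "lies_over n V X"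
  shows "lm_inv_at n V \<in> Hom A (ob (Lf (Mon n)) V) (Sn n X)"
  using comparison.lm_inv_hom[OF comparison, of V n] assms by (simp add: lies_over_def)

text \<open>
  Both factors are morphisms of the adjoint decomposition, hence so is their composite. As \<open>\<Lambda>\<^sub>n\<close> is
  fully faithful and \<open>\<Lambda>\<^sub>n R\<^sub>n = R\<^bsub>[n]\<^esub>\<close>, the composite is then a morphism of the monadic tower.
\<close>

lemma mon_gam_hom:
  assumes V: "lies_over n V X"
  shows "mon_gam n V X \<in> Hom (Ct (Mon n)) (ob (Rf (Mon n)) (ob (Lf (Mon n)) V)) V"
    and "mon_gam n V X \<in> Hom (Ct (Dec n)) (ob (Rf (Dec n)) (ob (Lf (Mon n)) V)) (Gx n X)"
proof -
  interpret D: dec_tower_stage A B J "Dec n" by (rule dec_tower_stage)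
  interpret C: comparison A B J "Dec n" "Mon n" "Lm n" by (rule comparison)
  have X: "X \<in> Obj B" and V': "V \<in> Obj (Ct (Mon n))" and VG: "ob (Lm n) V = Gx n X"
    using V by (auto simp: lies_over_def)
  note LV = C.M.S.L.ob_obj[OF V']
  show g: "mon_gam n V X \<in> Hom (Ct (Dec n)) (ob (Rf (Dec n)) (ob (Lf (Mon n)) V)) (Gx n X)"
    using D.S.B.comp_hom[OF D.S.R.ar_hom[OF lies_over_lm_inv_hom[OF V]] gam_hom_dec[OF X order_refl]]
    by (simp add: mon_gam_def)
  show "mon_gam n V X \<in> Hom (Ct (Mon n)) (ob (Rf (Mon n)) (ob (Lf (Mon n)) V)) V"
    using g C.Lm_hom[OF C.M.S.R.ob_obj[OF LV] V'] C.Lm_R[OF LV] VG by simp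
qed

lemma mon_gam_unit:
  assumes V: "lies_over n V X"
  shows "mon_gam n V X \<cdot>\<^bsub>B\<^esub> eta (Mon n) V = Ide (Ct (Mon n)) V"
proof -
  interpret D: dec_tower_stage A B J "Dec n" by (rule dec_tower_stage)
  interpret C: comparison A B J "Dec n" "Mon n" "Lm n" by (rule comparison)
  have X: "X \<in> Obj B" and V': "V \<in> Obj (Ct (Mon n))" and VG: "ob (Lm n) V = Gx n X"
    using V by (auto simp: lies_over_def)
  note G = Gam_obj[OF X, of n] and bG = base_Gam[OF X, of n]
  have bV: "base V = X" using C.Lm_base[OF V'] VG bG by simp
  have "eta (Mon n) V \<in> Hom B X (ob (Rf J) (ob (Lf (Mon n)) V))"
    using C.M.hom_base[OF C.M.S.eta_hom[OF V']] bV C.M.base_R[OF C.M.S.L.ob_obj[OF V']] by simp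
  then have "mon_gam n V X \<cdot>\<^bsub>B\<^esub> eta (Mon n) V = gm n X \<cdot>\<^bsub>B\<^esub> eta (Dec n) (Gx n X)"
    using J.B.comp_assoc[OF _ J.R.ar_hom[OF lies_over_lm_inv_hom[OF V]] gam_hom[OF X]]
      C.lm_inv_eta[OF V'] VG
    by (simp add: mon_gam_def)
  also have "\<dots> = Ide B X"
    using factors_aug_unit[OF gam_factors[OF X, of n]] D.pr_eta[OF G] bG by (simp add: gam_eq)
  finally show ?thesis using C.M.Ide_base[OF V'] bV by simp
qed

text \<open>
  Naturality of \<open>\<lambda>\<^sub>n\<^sup>-\<^sup>1\<close> turns \<open>\<gamma>\<^sub>n \<cdot> R L\<^sub>n \<gamma>\<^sub>n\<close> into \<open>\<gamma>\<^bsub>[n]\<^esub> \<cdot> R L\<^bsub>[n]\<^esub> \<gamma>\<^bsub>[n]\<^esub>\<close> composed with two instances of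
  \<open>R \<lambda>\<^sub>n\<^sup>-\<^sup>1\<close>; then \<open>gam_square\<close> with \<open>k = m = n\<close> brings in \<open>\<epsilon>\<^bsub>[n]\<^esub>\<close>, which naturality and
  \<open>\<epsilon>\<^bsub>[n]\<^esub> \<cdot> \<lambda>\<^sub>n\<^sup>-\<^sup>1 R\<^sub>n = \<epsilon>\<^sub>n\<close> convert into \<open>\<epsilon>\<^sub>n\<close>.
\<close>

lemma mon_gam_mult:
  assumes V: "lies_over n V X"
  shows "mon_gam n V X \<cdot>\<^bsub>B\<^esub> ar (Rf J) (ob (Lf (Mon n)) (ob (Rf (Mon n)) (ob (Lf (Mon n)) V))) (ob (Lf (Mon n)) V)
       (ar (Lf (Mon n)) (ob (Rf (Mon n)) (ob (Lf (Mon n)) V)) V (mon_gam n V X)) =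
     mon_gam n V X \<cdot>\<^bsub>B\<^esub> ar (Rf J) (ob (Lf (Mon n)) (ob (Rf (Mon n)) (ob (Lf (Mon n)) V))) (ob (Lf (Mon n)) V)
       (eps (Mon n) (ob (Lf (Mon n)) V))"
proof -
  interpret D: dec_tower_stage A B J "Dec n" by (rule dec_tower_stage)
  interpret C: comparison A B J "Dec n" "Mon n" "Lm n" by (rule comparison)
  have X: "X \<in> Obj B" and V': "V \<in> Obj (Ct (Mon n))" and VG: "ob (Lm n) V = Gx n X"
    using V by (auto simp: lies_over_def)
  let ?Y = "ob (Lf (Mon n)) V" and ?S = "Sn n X" and ?R = "Rf J"
  let ?W = "ob (Rf (Mon n)) ?Y" and ?W' = "ob (Rf (Dec n)) ?Y"
  let ?U = "ob (Rf (Dec n)) ?S" and ?LW = "ob (Lf (Mon n)) ?W"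
  note Y = C.M.S.L.ob_obj[OF V'] and S = factors_augD(2)[OF gam_factors[OF X, of n]]
  note W = C.M.S.R.ob_obj[OF Y] and WW' = C.Lm_R[OF Y]
  note k = lies_over_lm_inv_hom[OF V] and g = gam_hom_dec[OF X order_refl, of n] and gB =
    gam_hom[OF X, of n]
  note k' = C.lm_inv_hom[OF W, unfolded WW']
  note Rk = D.S.R.ar_hom[OF k, simplified]
  note LRk = D.S.L.ar_hom[OF Rk] and Lg = D.S.L.ar_hom[OF g]
  note eS = D.S.eps_hom[OF S] and eY = D.S.eps_hom[OF Y] and eM = C.M.S.eps_hom[OF Y]
  note LgM = C.M.S.L.ar_hom[OF mon_gam_hom(1)[OF V]]
  let ?LRk = "ar (Lf (Dec n)) ?W' ?U (ar ?R ?Y ?S (lm_inv_at n V))" and ?Lg = "ar (Lf (Dec n)) ?U (Gx n X) (gm n X)"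
  let ?LgM = "ar (Lf (Mon n)) ?W V (mon_gam n V X)"
  note r = J.A.comp_hom[OF k' LRk]
  have "lm_inv_at n V \<cdot>\<^bsub>A\<^esub> ?LgM = ?Lg \<cdot>\<^bsub>A\<^esub> (?LRk \<cdot>\<^bsub>A\<^esub> lm_inv_at n ?W)"
    using C.lm_inv_natural[OF mon_gam_hom(1)[OF V]] VG WW' D.S.L.ar_comp[OF Rk g]
      J.A.comp_assoc[OF k' LRk Lg] by (simp add: mon_gam_def)
  then have "mon_gam n V X \<cdot>\<^bsub>B\<^esub> ar ?R ?LW ?Y ?LgM =
      (gm n X \<cdot>\<^bsub>B\<^esub> ar ?R (ob (Lf (Dec n)) ?U) ?S ?Lg) \<cdot>\<^bsub>B\<^esub>
        ar ?R ?LW (ob (Lf (Dec n)) ?U) (?LRk \<cdot>\<^bsub>A\<^esub> lm_inv_at n ?W)"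
    using J.B.comp_assoc[OF J.R.ar_hom[OF LgM] J.R.ar_hom[OF k] gB] J.R.ar_comp[OF LgM k]
      J.R.ar_comp[OF r Lg] J.B.comp_assoc[OF J.R.ar_hom[OF r] J.R.ar_hom[OF Lg] gB]
    by (simp add: mon_gam_def)
  also have "\<dots> = gm n X \<cdot>\<^bsub>B\<^esub> ar ?R ?LW ?S (eps (Dec n) ?S \<cdot>\<^bsub>A\<^esub> (?LRk \<cdot>\<^bsub>A\<^esub> lm_inv_at n ?W))"
    using gam_square[OF X g] J.R.ar_comp[OF r eS]
      J.B.comp_assoc[OF J.R.ar_hom[OF r] J.R.ar_hom[OF eS] gB]
    by simp
  also have "eps (Dec n) ?S \<cdot>\<^bsub>A\<^esub> (?LRk \<cdot>\<^bsub>A\<^esub> lm_inv_at n ?W) = lm_inv_at n V \<cdot>\<^bsub>A\<^esub> eps (Mon n) ?Y"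
    using J.A.comp_assoc[OF k' LRk eS] D.S.eps_natural[OF k] J.A.comp_assoc[OF k' eY k]
      C.eps_lm_inv[OF Y]
    by simp
  also have "gm n X \<cdot>\<^bsub>B\<^esub> ar ?R ?LW ?S (lm_inv_at n V \<cdot>\<^bsub>A\<^esub> eps (Mon n) ?Y) =
      mon_gam n V X \<cdot>\<^bsub>B\<^esub> ar ?R ?LW ?Y (eps (Mon n) ?Y)"
    using J.R.ar_comp[OF eM k] J.B.comp_assoc[OF J.R.ar_hom[OF eM] J.R.ar_hom[OF k] gB]
    by (simp add: mon_gam_def)
  finally show ?thesis .
qed

lemma mon_gam_Rlam:
  assumes V: "lies_over n V X"
  shows "mon_gam n V X \<cdot>\<^bsub>B\<^esub> ar (Rf J) (Sn n X) (ob (Lf (Mon n)) V) (lam A B J cq n V) = gm n X"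
proof -
  interpret C: comparison A B J "Dec n" "Mon n" "Lm n" by (rule comparison)
  have X: "X \<in> Obj B" and V': "V \<in> Obj (Ct (Mon n))" and VG: "ob (Lm n) V = Gx n X"
    using V by (auto simp: lies_over_def)
  note k = lies_over_lm_inv_hom[OF V] and l = C.lm_hom[OF V', unfolded VG] and g =
    gam_hom[OF X, of n]
  have "mon_gam n V X \<cdot>\<^bsub>B\<^esub> ar (Rf J) (Sn n X) (ob (Lf (Mon n)) V) (lam A B J cq n V) =
      gm n X \<cdot>\<^bsub>B\<^esub> ar (Rf J) (Sn n X) (Sn n X) (Ide A (Sn n X))"
    using J.B.comp_assoc[OF J.R.ar_hom[OF l] J.R.ar_hom[OF k] g] J.R.ar_comp[OF l k]
      C.lm_inv_lm[OF V'] VG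
    by (simp add: mon_gam_def lam_def)
  then show ?thesis
    using J.R.ar_ide[OF J.A.hom_cod[OF k]] J.B.ide_right[OF g] by simp
qed

text \<open>
  The laws of \<open>mon_gam\<close> make the next object an Eilenberg-Moore algebra, and \<open>\<gamma>\<^sub>n \<cdot> R \<lambda>\<^sub>n = \<gamma>\<^bsub>[n]\<^esub>\<close> makes
  its image under \<open>\<Lambda>\<^bsub>n+1\<^esub>\<close> equal to \<open>\<Gamma>\<^bsub>[n+1]\<^esub> X\<close>.
\<close>

lemma mon_Gam_lies_over: "X \<in> Obj B \<Longrightarrow> lies_over n (mon_Gam n X) X"
proof (induction n)
  case 0
  then show ?case by (simp add: lies_over_def Gx_0 tagged_cat_sel)
next
  case (Suc n)
  interpret M: tower_stage A B J "Mon n" by (rule mon_tower_stage)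
  note X = Suc.prems and V = Suc.IH[OF Suc.prems]
  have "mon_Gam (Suc n) X \<in> Obj (Ct (Mon (Suc n)))"
    using V mon_gam_hom(1)[OF V] mon_gam_unit[OF V] mon_gam_mult[OF V]
    unfolding mon_Suc_sel lies_over_def by (simp add: M.em_cat_sel(1))
  moreover have "ob (Lm (Suc n)) (mon_Gam (Suc n) X) = Gx (Suc n) X"
    using V mon_gam_Rlam[OF V] by (simp add: lies_over_def Gx_Suc Let_def lam_def)
  ultimately show ?case using X unfolding lies_over_def by blast
qed


definition Gamma :: "nat \<Rightarrow> ('o, 'm, ('o, 'm) tower_obj, 'm) ftr" where
  "Gamma n = \<lparr>ob = mon_Gam n, ar = \<lambda>X Y f. f\<rparr>"

definition gamma :: "nat \<Rightarrow> 'o \<Rightarrow> 'm" where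
  "gamma n X = mon_gam n (mon_Gam n X) X"

lemma Gamma_sel [simp]: "ob (Gamma n) X = mon_Gam n X" "ar (Gamma n) X Y f = f"
  by (simp_all add: Gamma_def)

lemma mon_Gam_facts:
  assumes "X \<in> Obj B"
  shows "mon_Gam n X \<in> Obj (Ct (Mon n))" and "ob (Lm n) (mon_Gam n X) = Gx n X"
  using mon_Gam_lies_over[OF assms, of n] by (auto simp: lies_over_def)

lemma Gamma_hom:
  assumes f: "f \<in> Hom B X Y"
  shows "f \<in> Hom (Ct (Mon n)) (mon_Gam n X) (mon_Gam n Y)"
proof -
  interpret C: comparison A B J "Dec n" "Mon n" "Lm n" by (rule comparison)
  show ?thesis
    using Gam_hom[OF f, of n] mon_Gam_facts(2)[OF J.B.hom_dom[OF f], of n]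
      mon_Gam_facts(2)[OF J.B.hom_cod[OF f], of n]
      C.Lm_hom[OF mon_Gam_facts(1)[OF J.B.hom_dom[OF f]] mon_Gam_facts(1)[OF J.B.hom_cod[OF f]]] by simp
qed

lemma Gamma_functor: "is_functor B (Ct (Mon n)) (Gamma n)"
proof -
  interpret C: comparison A B J "Dec n" "Mon n" "Lm n" by (rule comparison)
  have "Ide B X = Ide (Ct (Mon n)) (mon_Gam n X)" if X: "X \<in> Obj B" for X
    using C.M.Ide_base[OF mon_Gam_facts(1)[OF X]] C.Lm_base[OF mon_Gam_facts(1)[OF X]]
      mon_Gam_facts(2)[OF X]
      base_Gam[OF X, of n] by simp
  then show ?thesis
    using mon_Gam_facts(1) Gamma_hom J.B.category_axioms C.M.S.B.category_axioms
    by (auto simp: is_functor_def is_functor_axioms_def)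
qed

lemma Lam_Gamma: "ftr_eq B (Lm n \<circ>\<^sub>F Gamma n) (Gn n)"
proof -
  interpret C: comparison A B J "Dec n" "Mon n" "Lm n" by (rule comparison)
  show ?thesis using mon_Gam_facts(2) by (simp add: ftr_eq_def)
qed

lemma gamma_nat_trans:
  "nat_trans B (Ct (Mon n)) (Rf (Mon n) \<circ>\<^sub>F Lf (Mon n) \<circ>\<^sub>F Gamma n) (Gamma n) (gamma n)"
proof -
  interpret D: dec_tower_stage A B J "Dec n" by (rule dec_tower_stage)
  interpret C: comparison A B J "Dec n" "Mon n" "Lm n" by (rule comparison)
  have "gamma n Y \<cdot>\<^bsub>B\<^esub> C.M.RL (mon_Gam n X) (mon_Gam n Y) f = f \<cdot>\<^bsub>B\<^esub> gamma n X"
    if f: "f \<in> Hom B X Y" for f X Y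
  proof -
    have X: "X \<in> Obj B" and Y: "Y \<in> Obj B" using J.B.hom_dom[OF f] J.B.hom_cod[OF f] .
    note f' = Gamma_hom[OF f, of n]
    note Lf = C.M.S.L.ar_hom[OF f'] and LDf = D.S.L.ar_hom[OF Gam_hom[OF f, of n]]
    note kX = lies_over_lm_inv_hom[OF mon_Gam_lies_over[OF X, of n]] and kY =
      lies_over_lm_inv_hom[OF mon_Gam_lies_over[OF Y, of n]]
    note gX = gam_hom[OF X, of n] and gY = gam_hom[OF Y, of n]
    have "lm_inv_at n (mon_Gam n Y) \<cdot>\<^bsub>A\<^esub> ar (Lf (Mon n)) (mon_Gam n X) (mon_Gam n Y) f =
        ar (Lf (Dec n)) (Gx n X) (Gx n Y) f \<cdot>\<^bsub>A\<^esub> lm_inv_at n (mon_Gam n X)"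
      using C.lm_inv_natural[OF f'] mon_Gam_facts(2)[OF X] mon_Gam_facts(2)[OF Y] by simp
    then show ?thesis
      using J.B.comp_assoc[OF J.R.ar_hom[OF Lf] J.R.ar_hom[OF kY] gY] J.R.ar_comp[OF Lf kY]
        J.R.ar_comp[OF kX LDf] J.B.comp_assoc[OF J.R.ar_hom[OF kX] J.R.ar_hom[OF LDf] gY]
        gam_natural[OF f, of n] J.B.comp_assoc[OF J.R.ar_hom[OF kX] gX f]
      by (simp add: gamma_def mon_gam_def)
  qed
  then show ?thesis
    using is_functor_comp[OF is_functor_comp[OF Gamma_functor C.M.S.L_functor] C.M.S.R_functor]
      Gamma_functor mon_gam_hom(1)[OF mon_Gam_lies_over]
    by (auto simp: nat_trans_def nat_trans_axioms_def gamma_def)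
qed

lemma lam_Gamma_nat_iso:
  "nat_iso B A (Lf (Dec n) \<circ>\<^sub>F Gn n) (Lf (Mon n) \<circ>\<^sub>F Gamma n) (\<lambda>X. lam A B J cq n (mon_Gam n X))"
proof -
  interpret D: dec_tower_stage A B J "Dec n" by (rule dec_tower_stage)
  interpret C: comparison A B J "Dec n" "Mon n" "Lm n" by (rule comparison)
  have "lam A B J cq n (mon_Gam n Y) \<cdot>\<^bsub>A\<^esub> ar (Lf (Dec n)) (Gx n X) (Gx n Y) f =
      ar (Lf (Mon n)) (mon_Gam n X) (mon_Gam n Y) f \<cdot>\<^bsub>A\<^esub> lam A B J cq n (mon_Gam n X)"
    if f: "f \<in> Hom B X Y" for f X Y
    using C.lm_natural[OF Gamma_hom[OF f]] mon_Gam_facts(2)[OF J.B.hom_dom[OF f], of n]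
      mon_Gam_facts(2)[OF J.B.hom_cod[OF f], of n] by (simp add: lam_def)
  moreover have "is_iso A (Sn n X) (ob (Lf (Mon n)) (mon_Gam n X)) (lam A B J cq n (mon_Gam n X))"
    if X: "X \<in> Obj B" for X
    using C.lm_iso[OF mon_Gam_facts(1)[OF X]] mon_Gam_facts(2)[OF X, of n] by (simp add: lam_def)
  ultimately show ?thesis
    using is_functor_comp[OF Gam_functor D.S.L_functor]
      is_functor_comp[OF Gamma_functor C.M.S.L_functor]
    by (auto simp: nat_iso_def nat_trans_def nat_trans_axioms_def is_iso_def)
qed

end

theorem proposition5p2:
  fixes A :: "('a, 'k) cat" and A' :: "('a2, 'k2) cat" and B :: "('o, 'm) cat"
    and J :: "('a, 'k, 'o, 'm) adj" and J' :: "('a2, 'k2, 'o, 'm) adj"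
    and F :: "('a, 'k, 'a2, 'k2) ftr"
    and cq :: "('a, 'k) coeq_fun"
    and c' :: "'o \<Rightarrow> 'm"
  assumes "adjunction A B J"
    and "adjunction A' B J'"
    and "is_functor A A' F"
    and "ftr_eq B (F \<circ>\<^sub>F Lf J) (Lf J')"
    and "coeq_choice A cq"
    and "has_coeqs A"
    and "\<And>X Y f g. preserves_coeq A A' F X Y f g"
    and "\<And>X Y e f. idempotent A' X e \<Longrightarrow> regular_epi_composite A' X Y f
           \<Longrightarrow> preserves_coeq A' B (Rf J') X Y (f \<cdot>\<^bsub>A'\<^esub> e) f"
    and "\<And>X Y f. regular_epi A' X Y f \<Longrightarrow> regular_epi B (ob (Rf J') X) (ob (Rf J') Y) (ar (Rf J') X Y f)"
    and "augmentation B (monad_of J') c'"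
  shows "\<exists>(\<Gamma> :: nat \<Rightarrow> ('o, 'm, ('o, 'm) tower_obj, 'm) ftr) (\<gamma> :: nat \<Rightarrow> 'o \<Rightarrow> 'm). \<forall>n.
      is_functor B (Ct (mon A B J cq n)) (\<Gamma> n) \<and>
      ftr_eq B (Lam A B J cq n \<circ>\<^sub>F \<Gamma> n) (Gam A B J cq J' F c' n) \<and>
      ftr_eq B (forget \<circ>\<^sub>F \<Gamma> (Suc n)) (\<Gamma> n) \<and>
      nat_trans B (Ct (mon A B J cq n))
        (Rf (mon A B J cq n) \<circ>\<^sub>F Lf (mon A B J cq n) \<circ>\<^sub>F \<Gamma> n) (\<Gamma> n) (\<gamma> n) \<and>
      (\<forall>X \<in> Obj B. ob (\<Gamma> (Suc n)) X = Ext (ob (\<Gamma> n) X) (\<gamma> n X)) \<and>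
      (\<forall>X \<in> Obj B.
        ar (Ug (mon A B J cq n))
           (ob (Rf (mon A B J cq n) \<circ>\<^sub>F Lf (mon A B J cq n) \<circ>\<^sub>F \<Gamma> n) X) (ob (\<Gamma> n) X) (\<gamma> n X)
        \<cdot>\<^bsub>B\<^esub> ar (Rf J) (ob (Lf (dec A B J cq n) \<circ>\<^sub>F Gam A B J cq J' F c' n) X)
                       (ob (Lf (mon A B J cq n) \<circ>\<^sub>F \<Gamma> n) X)
                       (lam A B J cq n (ob (\<Gamma> n) X))
        = gam A B J cq J' F c' n X) \<and>
      nat_iso B A (Lf (dec A B J cq n) \<circ>\<^sub>F Gam A B J cq J' F c' n) (Lf (mon A B J cq n) \<circ>\<^sub>F \<Gamma> n)
        (\<lambda>X. lam A B J cq n (ob (\<Gamma> n) X))"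
proof -
  interpret augmented_towers A B J cq A' J' F c'
    using assms by (intro augmented_towers.intro augmented_towers_axioms.intro towers.intro
        towers_axioms.intro adj_pair.intro)
  show ?thesis
  proof (intro exI allI conjI)
    fix n
    interpret M: tower_stage A B J "Mon n" by (rule mon_tower_stage)
    show "is_functor B (Ct (Mon n)) (Gamma n)" by (rule Gamma_functor)
    show "ftr_eq B (Lm n \<circ>\<^sub>F Gamma n) (Gn n)" by (rule Lam_Gamma)
    show "ftr_eq B (forget \<circ>\<^sub>F Gamma (Suc n)) (Gamma n)"
      by (simp add: ftr_eq_def forget_def)
    show "nat_trans B (Ct (Mon n)) (Rf (Mon n) \<circ>\<^sub>F Lf (Mon n) \<circ>\<^sub>F Gamma n) (Gamma n) (gamma n)"
      by (rule gamma_nat_trans)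
    show "\<forall>X \<in> Obj B. ob (Gamma (Suc n)) X = Ext (ob (Gamma n) X) (gamma n X)"
      by (simp add: gamma_def)
    show "\<forall>X \<in> Obj B.
        ar (Ug (Mon n)) (ob (Rf (Mon n) \<circ>\<^sub>F Lf (Mon n) \<circ>\<^sub>F Gamma n) X) (ob (Gamma n) X) (gamma n X)
        \<cdot>\<^bsub>B\<^esub> ar (Rf J) (ob (Lf (Dec n) \<circ>\<^sub>F Gn n) X) (ob (Lf (Mon n) \<circ>\<^sub>F Gamma n) X)
             (lam A B J cq n (ob (Gamma n) X)) = gm n X"
      using mon_gam_Rlam[OF mon_Gam_lies_over] by (simp add: gamma_def)
    show "nat_iso B A (Lf (Dec n) \<circ>\<^sub>F Gn n) (Lf (Mon n) \<circ>\<^sub>F Gamma n)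
        (\<lambda>X. lam A B J cq n (ob (Gamma n) X))"
      using lam_Gamma_nat_iso by simp
  qed
qed

end
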